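(* Let $(Y,X)$ and $(Y_i,X_i)$, $i=1,2,\dots,n$, be iid random vectors in $[0,\infty)\times\mathbb R^d$, jointly regularly varying and satisfying Assumptions A and B of the context. Let $\widehat g_n=\widehat g_{\alpha_n,K(n)}$ be the peaks-over-threshold predictors described in the context. Suppose that $\alpha_n\to\alpha^*$ in probability, where $\alpha^*\in(0,1)$ satisfies $C(g_{\alpha^*})=\mathbb E[U]$, and that the thresholds $t_n\to\infty$ are such that the number of exceedances satisfies $K(n)\to\infty$ in probability and $$n\,\mathbb P(\tau(Y,X)>t_n)\,\|P_{t_n}-P_\infty\|_{\rm TV}\longrightarrow 0,\quad n\to\infty.$$ Then: (i) We have $$\widehat c_n:=\lim_{t\to\infty}\frac{\mathbb P[\widehat g_n(X)>t\mid\widehat g_n]}{\mathbb P[Y>t]}\ \stackrel{\mathbb P}{\longrightarrow}\ 1,\quad n\to\infty,$$ and consequently, for $\widehat c_n>0$, $$\lambda(Y,\widehat g_n(X)\mid\widehat g_n)=\lim_{t\to\infty}\mathbb P[\widehat g_n(X)>\widehat c_n t\mid Y>t,\ \widehat g_n]=\Lambda(\widehat g_n(\cdot)/\widehat c_n).$$ (ii) The predictors $\widehat g_n$ and $\widehat g_n/\widehat c_n$ are both precision-optimal: $\Lambda(\widehat g_n/\widehat c_n)$ and $\Lambda(\widehat g_n)$ both converge in probability to $\Lambda(g_{\alpha^*})$ as $n\to\infty$. (iii) If, moreover, for some sequence of (random) non-negative, continuous, $1$-homogeneous functions $\widehat h_n:\mathbb R^d\to[0,\infty)$, independent from $(Y,X)$,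 we have $$\widehat d_n:=\lim_{t\to\infty}\frac{\mathbb P[\widehat h_n(X)>t\mid\widehat h_n]}{\mathbb P[Y>t]}\ \stackrel{\mathbb P}{\longrightarrow}\ 1,\quad n\to\infty,$$ then for all $\epsilon>0$, $$\lim_{n\to\infty}\mathbb P[\Lambda(\widehat h_n)\le\Lambda(\widehat g_n)+\epsilon]=1.$$
   Context: Setup. $\|\cdot\|=\|\cdot\|_1$ is the $\ell_1$-norm on $\mathbb R^d$, $\tau(y,x)=y+\|x\|_1$ for $(y,x)\in[0,\infty)\times\mathbb R^d$, $S_X=\{x\in\mathbb R^d:\|x\|_1=1\}$, $S_\tau=\{\tau=1\}$. $(Y,X)$ is jointly regularly varying: there is a positive sequence $a_n$ with $n\mathbb P[\tau(Y,X)>ta_n]\to t^{-1}$ for all $t>0$, and the conditional law of $(Y,X)/\tau(Y,X)$ given $\tau(Y,X)>r$ converges weakly as $r\to\infty$ to the law of a random vector $(U,(1-U)\Theta)$ on $S_\tau$, where $U\in[0,1]$, $\Theta\in S_X$, $\mathbb P[U=0]<1$, $\mathbb P[U=1]<1$. Put $\widetilde U=Y/(Y+\|X\|_1)$, $\widetilde\Theta=X/\|X\|_1$; let $P_t$ be the conditional law of $(\widetilde U,\widetilde\Theta)$ given $\tau(Y,X)>t$ and $P_\infty$ the law of $(U,\Theta)$. $\|\cdot\|_{\rm TV}$ is the total variation norm. Assumption A. $\|P_t-P_\infty\|_{\rm TV}\to0$ as $t\to\infty$, and $P_\infty(du,d\theta)=f_{U|\Theta}(u|\theta)\,du\,p_\Theta(d\theta)$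 with $f_{U|\Theta}(u|\theta)>0$ for $du\,p_\Theta(d\theta)$-almost all $(u,\theta)\in(0,1)\times S_X$. Let $q_\alpha(\theta)$ be the left-continuous $\alpha$-quantile of the probability density on $[0,1]$ proportional to $u\mapsto(1-u)f_{U|\Theta}(u|\theta)$, and $$g_\alpha(x)=\|x\|\,\frac{q_\alpha(x/\|x\|)}{1-q_\alpha(x/\|x\|)},\qquad C(g)=\mathbb E[(1-U)g(\Theta)],\qquad \Lambda(g)=\frac{1}{\mathbb E[U]}\mathbb E[U\wedge(1-U)g(\Theta)].$$ For a random function $\widehat g$ built from the data (or independent of $(Y,X)$), $C(\widehat g)$ and $\Lambda(\widehat g)$ are these functionals evaluated at the realized function, i.e. $(U,\Theta)$ is taken independent of $\widehat g$ and one conditions on $\widehat g$. Assumption B. The map $(\alpha,\theta)\mapsto q_\alpha(\theta)$ is defined and continuous on $(0,1)\times S_\Theta$ for some compact $S_\Theta\subseteq S_X$ with $p_\Theta(S_\Theta)=1$. For iid $(U_i,\Theta_i)$, $i=1,\dots,k$, from $P_\infty$, there is an estimator $\widehat q_{\alpha,k}(\theta)$ of $q_\alpha(\theta)$ based on this sample such that: for all $\alpha\in(0,1)$, $k\in\mathbb N$, $\theta\mapsto\widehat q_{\alpha,k}(\theta)$ is defined and continuous on $S_X$; $0<\widehat q_{\alpha,k}(\theta)<1$ for all $\alpha\in(0,1)$, $\theta\in S_X$; and for all $0<\alpha_0<\alpha_1<1$, $$\sup_{\alpha\in[\alpha_0,\alpha_1]}\sup_{\theta\in S_\Theta}|\widehat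 q_{\alpha,k}(\theta)-q_\alpha(\theta)|\stackrel{\mathbb P}{\to}0,\quad k\to\infty.$$ Predictors. Let $\widehat g_{\alpha,k}(x)=\|x\|\,\widehat q_{\alpha,k}(x/\|x\|)/(1-\widehat q_{\alpha,k}(x/\|x\|))$ for $x\ne0$ and $\widehat g_{\alpha,k}(0)=0$. For thresholds $t_n\to\infty$ let $R_i=Y_i+\|X_i\|_1$, $\mathcal I_n=\{i\le n:R_i>t_n\}$, $K(n)=|\mathcal I_n|$, $\widetilde U_i=Y_i/R_i$, $\widetilde\Theta_i=X_i/\|X_i\|_1$, $i\in\mathcal I_n$. Let $\alpha_n\in(0,1)$ be a sequence of estimators of $\alpha^*$ based on the training data $(Y_i,X_i)$, $i\le n$. Then $\widehat g_n:=\widehat g_{\alpha_n,K(n)}$, computed with the sample $(U_i,\Theta_i)$ replaced by $(\widetilde U_i,\widetilde\Theta_i)$, $i\in\mathcal I_n$. The vector $(Y,X)$ is independent of the training data. $\lambda(\xi,\eta)=\lim_{p\uparrow1}\mathbb P[\xi>F_\xi^\leftarrow(p)\mid\eta>F_\eta^\leftarrow(p)]$ is the tail-dependence coefficient ($F^\leftarrow$ is the left-continuous generalized inverse of the cdf), and $\lambda(Y,\widehat g_n(X)\mid\widehat g_n)$ is the coefficient computed under the conditional law given $\widehat g_n$. *)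

theory Defs
  imports "HOL-Probability.Probability"
begin

section \<open>Convergence notions\<close>

text \<open>
  Convergence in probability to a constant, on a sequence of probability spaces. The outer
  measure makes the notion meaningful also for suprema over uncountable sets; for random
  variables it is the usual one, see \<open>tendsto_in_prob_iff_measure\<close> below.
\<close>
definition tendsto_in_prob :: "(nat \<Rightarrow> 'a measure) \<Rightarrow> (nat \<Rightarrow> 'a \<Rightarrow> real) \<Rightarrow> real \<Rightarrow> bool" where
  "tendsto_in_prob M \<xi> c \<longleftrightarrow>
     (\<forall>\<epsilon>>0. (\<lambda>n. outer_measure_of (M n) {\<omega> \<in> space (M n). \<epsilon> < \<bar>\<xi> n \<omega> - c\<bar>}) \<longlonglongrightarrow> 0)"

lemma tendsto_in_prob_iff_measure:
  assumes "\<And>n. prob_space (M n)" and [measurable]: "\<And>n. \<xi> n \<in> borel_measurable (M n)"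
  shows "tendsto_in_prob M \<xi> c \<longleftrightarrow> (\<forall>\<epsilon>>0. (\<lambda>n. \<P>(\<omega> in M n. \<epsilon> < \<bar>\<xi> n \<omega> - c\<bar>)) \<longlonglongrightarrow> 0)"
proof -
  have eq: "outer_measure_of (M n) {\<omega> \<in> space (M n). \<epsilon> < \<bar>\<xi> n \<omega> - c\<bar>}
      = ennreal \<P>(\<omega> in M n. \<epsilon> < \<bar>\<xi> n \<omega> - c\<bar>)" for n \<epsilon>
  proof -
    interpret prob_space "M n" by fact
    show ?thesis
      by (subst outer_measure_of_eq) (measurable, rule emeasure_eq_measure)
  qed
  show ?thesis
    unfolding tendsto_in_prob_def eq
    by (subst ennreal_0[symmetric], subst tendsto_ennreal_iff) (auto simp del: ennreal_0)
qed

definition weakly_tendsto ::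
    "(real \<Rightarrow> 'a::topological_space measure) \<Rightarrow> 'a measure \<Rightarrow> real filter \<Rightarrow> bool" where
  "weakly_tendsto \<mu> \<nu> F \<longleftrightarrow>
     (\<forall>h :: 'a \<Rightarrow> real. continuous_on UNIV h \<and> bounded (range h) \<longrightarrow>
        ((\<lambda>r. \<integral>x. h x \<partial>\<mu> r) \<longlongrightarrow> (\<integral>x. h x \<partial>\<nu>)) F)"

text \<open>
  Some authors take twice this value for the total variation norm of a difference of two
  probability measures; only convergence to zero is used.
\<close>
definition tv_norm_diff :: "'a measure \<Rightarrow> 'a measure \<Rightarrow> real" where
  "tv_norm_diff \<mu> \<nu> = (SUP A\<in>sets \<mu>. \<bar>measure \<mu> A - measure \<nu> A\<bar>)"


section \<open>Quantiles and tail dependence\<close>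

definition left_quantile :: "real measure \<Rightarrow> real \<Rightarrow> real" where
  "left_quantile \<mu> p = Inf {x. p \<le> cdf \<mu> x}"

definition has_tail_dependence :: "'w measure \<Rightarrow> ('w \<Rightarrow> real) \<Rightarrow> ('w \<Rightarrow> real) \<Rightarrow> real \<Rightarrow> bool" where
  "has_tail_dependence M \<xi> \<eta> l \<longleftrightarrow>
     ((\<lambda>p. \<P>(\<omega> in M. left_quantile (distr M borel \<xi>) p < \<xi> \<omega>
               \<bar> left_quantile (distr M borel \<eta>) p < \<eta> \<omega>)) \<longlongrightarrow> l) (at_left 1)"


section \<open>Joint regular variation\<close>

definition l1norm :: "real ^ 'd \<Rightarrow> real" where
  "l1norm x = (\<Sum>i\<in>UNIV. \<bar>x $ i\<bar>)"

definition l1sphere :: "(real ^ 'd) set" where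
  "l1sphere = {x. l1norm x = 1}"

text \<open>
  The direction of \<open>0\<close> is an arbitrary point of the sphere. The choice is immaterial: \<open>X = 0\<close>
  forces the first polar coordinate to be \<open>1\<close>, a value which has probability zero under the
  limit law of Assumption A.
\<close>
definition l1dir :: "real ^ 'd \<Rightarrow> real ^ 'd" where
  "l1dir x = (if x = 0 then (SOME e. e \<in> l1sphere) else x /\<^sub>R l1norm x)"

definition tau :: "real \<times> (real ^ 'd) \<Rightarrow> real" where
  "tau z = fst z + l1norm (snd z)"

definition polar :: "real \<times> (real ^ 'd) \<Rightarrow> real \<times> (real ^ 'd)" where
  "polar z = (fst z / tau z, l1dir (snd z))"

text \<open>
  \<open>cond_exceed M Z \<phi> t\<close> is the conditional law of \<open>\<phi> Z\<close> given \<open>tau Z > t\<close>;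
  for \<open>\<phi> = polar\<close> this is \<open>P\<^sub>t\<close>.
\<close>
definition cond_exceed ::
    "'w measure \<Rightarrow> ('w \<Rightarrow> real \<times> (real ^ 'd)) \<Rightarrow> (real \<times> (real ^ 'd) \<Rightarrow> real \<times> (real ^ 'd)) \<Rightarrow> real
      \<Rightarrow> (real \<times> (real ^ 'd)) measure" where
  "cond_exceed M Z \<phi> t =
     distr (uniform_measure M {\<omega> \<in> space M. t < tau (Z \<omega>)}) borel (\<lambda>\<omega>. \<phi> (Z \<omega>))"

text \<open>\<open>P\<close> is the law \<open>P\<^sub>\<infinity>\<close> of \<open>(U, \<Theta>)\<close>.\<close>
definition jointly_regularly_varying ::
    "'w measure \<Rightarrow> ('w \<Rightarrow> real \<times> (real ^ 'd)) \<Rightarrow> (real \<times> (real ^ 'd)) measure \<Rightarrow> bool" where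
  "jointly_regularly_varying M Z P \<longleftrightarrow>
     (\<exists>a :: nat \<Rightarrow> real. (\<forall>n. 0 < a n) \<and>
        (\<forall>t>0. (\<lambda>n. real n * \<P>(\<omega> in M. t * a n < tau (Z \<omega>))) \<longlonglongrightarrow> 1 / t)) \<and>
     prob_space P \<and> sets P = sets borel \<and>
     (AE (u, \<theta>) in P. u \<in> {0..1} \<and> \<theta> \<in> l1sphere) \<and>
     \<P>((u, \<theta>) in P. u = 0) < 1 \<and> \<P>((u, \<theta>) in P. u = 1) < 1 \<and>
     weakly_tendsto (cond_exceed M Z (\<lambda>z. z /\<^sub>R tau z))
       (distr P borel (\<lambda>(u, \<theta>). (u, (1 - u) *\<^sub>R \<theta>))) at_top"


section \<open>Scale functional, precision functional and the optimal predictors\<close>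

definition C_fun :: "(real \<times> (real ^ 'd)) measure \<Rightarrow> (real ^ 'd \<Rightarrow> real) \<Rightarrow> real" where
  "C_fun P g = (\<integral>(u, \<theta>). (1 - u) * g \<theta> \<partial>P)"

definition Lambda_fun :: "(real \<times> (real ^ 'd)) measure \<Rightarrow> (real ^ 'd \<Rightarrow> real) \<Rightarrow> real" where
  "Lambda_fun P g = (\<integral>(u, \<theta>). min u ((1 - u) * g \<theta>) \<partial>P) / (\<integral>(u, \<theta>). u \<partial>P)"

definition q_opt :: "(real \<Rightarrow> real ^ 'd \<Rightarrow> real) \<Rightarrow> real \<Rightarrow> real ^ 'd \<Rightarrow> real" where
  "q_opt f \<alpha> \<theta> =
     left_quantile
       (density lborel (\<lambda>u. ennreal (indicator {0..1} u * ((1 - u) * f u \<theta>)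
                                      / (LBINT v:{0..1}. (1 - v) * f v \<theta>)))) \<alpha>"

definition ratio_predictor :: "(real ^ 'd \<Rightarrow> real) \<Rightarrow> real ^ 'd \<Rightarrow> real" where
  "ratio_predictor q x = (if x = 0 then 0 else l1norm x * q (l1dir x) / (1 - q (l1dir x)))"

definition g_opt :: "(real \<Rightarrow> real ^ 'd \<Rightarrow> real) \<Rightarrow> real \<Rightarrow> real ^ 'd \<Rightarrow> real" where
  "g_opt f \<alpha> = ratio_predictor (q_opt f \<alpha>)"


section \<open>Assumptions A and B\<close>

text \<open>\<open>distr P borel snd\<close> is \<open>p\<^sub>\<Theta>\<close>, and \<open>f u \<theta>\<close> is the conditional density of \<open>U\<close> given \<open>\<Theta>\<close>.\<close>
definition assumption_A ::
    "'w measure \<Rightarrow> ('w \<Rightarrow> real \<times> (real ^ 'd)) \<Rightarrow> (real \<times> (real ^ 'd)) measure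
      \<Rightarrow> (real \<Rightarrow> real ^ 'd \<Rightarrow> real) \<Rightarrow> bool" where
  "assumption_A M Z P f \<longleftrightarrow>
     ((\<lambda>t. tv_norm_diff (cond_exceed M Z polar t) P) \<longlongrightarrow> 0) at_top \<and>
     (\<lambda>(u, \<theta>). f u \<theta>) \<in> borel_measurable (borel \<Otimes>\<^sub>M borel) \<and>
     (\<forall>u \<theta>. 0 \<le> f u \<theta>) \<and>
     P = density (lborel \<Otimes>\<^sub>M distr P borel snd) (\<lambda>(u, \<theta>). ennreal (indicator {0..1} u * f u \<theta>)) \<and>
     (AE (u, \<theta>) in lborel \<Otimes>\<^sub>M distr P borel snd. u \<in> {0<..<1} \<and> \<theta> \<in> l1sphere \<longrightarrow> 0 < f u \<theta>)"

text \<open>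
  A sample of size \<open>k\<close> is a function on \<open>{..<k}\<close> with values in \<open>[0,1] \<times> S\<^sub>X\<close>.
\<close>
definition sample_space :: "nat \<Rightarrow> (nat \<Rightarrow> real \<times> (real ^ 'd)) measure" where
  "sample_space k = (\<Pi>\<^sub>M i\<in>{..<k}. restrict_space borel ({0..1} \<times> l1sphere))"

text \<open>
  \<open>qhat k \<alpha> z \<theta>\<close> is the estimate of \<open>q_opt f \<alpha> \<theta>\<close> from the sample \<open>z\<close> of size \<open>k\<close>. The third
  clause says that the quantile is defined on \<open>S\<close>, i.e. that \<open>(1 - u) f u \<theta>\<close> can be normalised to
  a probability density. The case \<open>k = 0\<close> covers the event that no threshold exceedance occurs.
\<close>
definition assumption_B ::
    "(real \<times> (real ^ 'd)) measure \<Rightarrow> (real \<Rightarrow> real ^ 'd \<Rightarrow> real)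
      \<Rightarrow> (nat \<Rightarrow> real \<Rightarrow> (nat \<Rightarrow> real \<times> (real ^ 'd)) \<Rightarrow> real ^ 'd \<Rightarrow> real) \<Rightarrow> bool" where
  "assumption_B P f qhat \<longleftrightarrow>
     (\<exists>S. compact S \<and> S \<subseteq> l1sphere \<and> measure (distr P borel snd) S = 1 \<and>
        (\<forall>\<theta>\<in>S. set_integrable lborel {0..1} (\<lambda>u. (1 - u) * f u \<theta>) \<and>
                 0 < (LBINT u:{0..1}. (1 - u) * f u \<theta>)) \<and>
        continuous_on ({0<..<1} \<times> S) (\<lambda>(\<alpha>, \<theta>). q_opt f \<alpha> \<theta>) \<and>
        (\<forall>k. \<forall>\<theta>\<in>l1sphere. (\<lambda>(\<alpha>, z). qhat k \<alpha> z \<theta>)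
            \<in> borel_measurable (restrict_space borel {0<..<1} \<Otimes>\<^sub>M sample_space k)) \<and>
        (\<forall>k. \<forall>\<alpha>\<in>{0<..<1}. \<forall>z\<in>space (sample_space k).
            continuous_on l1sphere (qhat k \<alpha> z) \<and> (\<forall>\<theta>\<in>l1sphere. qhat k \<alpha> z \<theta> \<in> {0<..<1})) \<and>
        (\<forall>\<alpha>\<^sub>0 \<alpha>\<^sub>1. 0 < \<alpha>\<^sub>0 \<and> \<alpha>\<^sub>0 < \<alpha>\<^sub>1 \<and> \<alpha>\<^sub>1 < 1 \<longrightarrow>
            tendsto_in_prob (\<lambda>k. \<Pi>\<^sub>M i\<in>{..<k}. P)
              (\<lambda>k z. SUP \<alpha>\<in>{\<alpha>\<^sub>0..\<alpha>\<^sub>1}. SUP \<theta>\<in>S. \<bar>qhat k \<alpha> z \<theta> - q_opt f \<alpha> \<theta>\<bar>) 0))"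


section \<open>Peaks-over-threshold predictors\<close>

text \<open>\<open>z i\<close>, \<open>i = 1..n\<close>, are the training data and \<open>t\<close> is the threshold.\<close>
definition exceedances :: "(nat \<Rightarrow> real \<times> (real ^ 'd)) \<Rightarrow> real \<Rightarrow> nat \<Rightarrow> nat set" where
  "exceedances z t n = {i \<in> {1..n}. t < tau (z i)}"

text \<open>The exceedances are passed to the estimator in the order of their occurrence.\<close>
definition pot_predictor ::
    "(nat \<Rightarrow> real \<Rightarrow> (nat \<Rightarrow> real \<times> (real ^ 'd)) \<Rightarrow> real ^ 'd \<Rightarrow> real)
      \<Rightarrow> real \<Rightarrow> (nat \<Rightarrow> real \<times> (real ^ 'd)) \<Rightarrow> real \<Rightarrow> nat \<Rightarrow> real ^ 'd \<Rightarrow> real" where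
  "pot_predictor qhat \<alpha> z t n =
     (let I = exceedances z t n;
          sample = (\<lambda>j\<in>{..<card I}. polar (z (sorted_list_of_set I ! j)))
      in ratio_predictor (qhat (card I) \<alpha> sample))"


section \<open>Conditioning on a random function\<close>

definition independent_rvs ::
    "'w measure \<Rightarrow> 'a measure \<Rightarrow> ('w \<Rightarrow> 'a) \<Rightarrow> 'b measure \<Rightarrow> ('w \<Rightarrow> 'b) \<Rightarrow> bool" where
  "independent_rvs M S \<xi> T \<eta> \<longleftrightarrow>
     \<xi> \<in> M \<rightarrow>\<^sub>M S \<and> \<eta> \<in> M \<rightarrow>\<^sub>M T \<and>
     prob_space.indep_set M (sets (vimage_algebra (space M) \<xi> S)) (sets (vimage_algebra (space M) \<eta> T))"

text \<open>
  For a random function \<open>h\<close> independent of \<open>(Y, X)\<close>, the conditional law of \<open>(Y, h(X))\<close> given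
  \<open>h\<close> at \<open>\<omega>\<close> is the law of \<open>(Y, h \<omega> (X))\<close> with the realised function \<open>h \<omega>\<close> held fixed. The lemmas
  of this section show that this is a version of the conditional law in the sense of conditional
  expectations. In the definitions below the argument \<open>g\<close> is such a realised function.
\<close>

definition tail_ratio ::
    "'w measure \<Rightarrow> ('w \<Rightarrow> real) \<Rightarrow> ('w \<Rightarrow> real ^ 'd) \<Rightarrow> (real ^ 'd \<Rightarrow> real) \<Rightarrow> real \<Rightarrow> real" where
  "tail_ratio M Y X g t = \<P>(\<omega> in M. t < g (X \<omega>)) / \<P>(\<omega> in M. t < Y \<omega>)"

definition tail_scale ::
    "'w measure \<Rightarrow> ('w \<Rightarrow> real) \<Rightarrow> ('w \<Rightarrow> real ^ 'd) \<Rightarrow> (real ^ 'd \<Rightarrow> real) \<Rightarrow> real" where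
  "tail_scale M Y X g = Lim at_top (tail_ratio M Y X g)"

lemma real_cond_exp_indep_freeze:
  assumes "prob_space M" and sub: "subalgebra M F" and Z[measurable]: "Z \<in> M \<rightarrow>\<^sub>M N"
    and ind: "prob_space.indep_set M (sets (vimage_algebra (space M) Z N)) (sets F)"
    and D: "D \<in> sets (F \<Otimes>\<^sub>M N)"
  shows "AE \<omega> in M. real_cond_exp M F (indicator {\<omega> \<in> space M. (\<omega>, Z \<omega>) \<in> D}) \<omega>
                      = \<P>(v in M. (\<omega>, Z v) \<in> D)"
proof -
  interpret prob_space M by fact
  interpret sigma_finite_subalgebra M F
    using sub by (intro finite_measure_subalgebra_is_sigma_finite)
      (auto simp: finite_measure_subalgebra_def finite_measure_subalgebra_axioms_def finite_measure_axioms)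
  have spF: "space F = space M" and setsF: "\<And>A. A \<in> sets F \<Longrightarrow> A \<in> sets M"
    using sub by (auto simp: subalgebra_def)
  let ?R = "restr_to_subalg M F" and ?L = "distr M N Z"
  have id1: "(\<lambda>\<omega>. \<omega>) \<in> M \<rightarrow>\<^sub>M F"
    by (rule measurableI) (auto simp: spF dest: setsF sets.sets_into_space)
  interpret R: prob_space ?R by (rule prob_space_restr_to_subalg[OF sub prob_space_axioms])
  interpret L: prob_space ?L by (rule prob_space_distr[OF Z])
  interpret RL: pair_prob_space ?R ?L ..
  have pm[measurable]: "(\<lambda>\<omega>. (\<omega>, Z \<omega>)) \<in> M \<rightarrow>\<^sub>M F \<Otimes>\<^sub>M N"
    using id1 by measurable
  have setsRL: "sets (?R \<Otimes>\<^sub>M ?L) = sets (F \<Otimes>\<^sub>M N)"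
    by (rule sets_pair_measure_cong) (simp_all add: sets_restr_to_subalg[OF sub])
  have law: "?R \<Otimes>\<^sub>M ?L = distr M (F \<Otimes>\<^sub>M N) (\<lambda>\<omega>. (\<omega>, Z \<omega>))"
  proof (rule pair_measure_eqI)
    show "sets (?R \<Otimes>\<^sub>M ?L) = sets (distr M (F \<Otimes>\<^sub>M N) (\<lambda>\<omega>. (\<omega>, Z \<omega>)))"
      unfolding sets_distr by (rule setsRL)
    fix A B assume A: "A \<in> sets ?R" and B: "B \<in> sets ?L"
    then have A': "A \<in> sets F" and B': "B \<in> sets N" by (auto simp: sets_restr_to_subalg[OF sub])
    have "(\<lambda>\<omega>. (\<omega>, Z \<omega>)) -` (A \<times> B) \<inter> space M = (Z -` B \<inter> space M) \<inter> A"
      using sets.sets_into_space[OF setsF[OF A']] by auto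
    moreover have "prob ((Z -` B \<inter> space M) \<inter> A) = prob (Z -` B \<inter> space M) * prob A"
      by (rule indep_setD[OF ind _ A']) (rule in_vimage_algebra[OF B'])
    ultimately show "emeasure ?R A * emeasure ?L B
        = emeasure (distr M (F \<Otimes>\<^sub>M N) (\<lambda>\<omega>. (\<omega>, Z \<omega>))) (A \<times> B)"
      using A' B' by (simp add: emeasure_distr emeasure_restr_to_subalg[OF sub] emeasure_eq_measure
          ennreal_mult'[symmetric] mult.commute)
  qed (rule R.sigma_finite_measure_axioms L.sigma_finite_measure_axioms)+
  define \<kappa> where "\<kappa> \<omega> = \<P>(v in M. (\<omega>, Z v) \<in> D)" for \<omega>
  have \<kappa>: "\<kappa> \<omega> = measure ?L (Pair \<omega> -` D)" for \<omega>
    unfolding \<kappa>_def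
    by (subst measure_distr) (use D in \<open>auto intro!: sets_Pair1 arg_cong[where f=prob]\<close>)
  have DRL: "D \<in> sets (F \<Otimes>\<^sub>M ?L)" using D by (subst sets_pair_measure_cong[OF refl sets_distr])
  have \<kappa>F[measurable]: "\<kappa> \<in> borel_measurable F"
    unfolding \<kappa>[abs_def] using L.measurable_emeasure_Pair[OF DRL]
    by (simp add: measure_def)
  have \<kappa>M[measurable]: "\<kappa> \<in> borel_measurable M"
    by (rule measurable_from_subalg[OF sub \<kappa>F])
  have E[measurable]: "{\<omega> \<in> space M. (\<omega>, Z \<omega>) \<in> D} \<in> sets M"
    using measurable_sets[OF pm D] by (simp add: vimage_def Int_def conj_commute)
  have le: "0 \<le> \<kappa> \<omega>" "\<kappa> \<omega> \<le> 1" for \<omega> by (auto simp: \<kappa>_def)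
  have int\<kappa>: "integrable M \<kappa>"
    by (rule integrable_const_bound[where B=1]) (auto simp: le)
  have "AE \<omega> in M. real_cond_exp M F (indicator {\<omega> \<in> space M. (\<omega>, Z \<omega>) \<in> D}) \<omega> = \<kappa> \<omega>"
  proof (rule real_cond_exp_charact)
    fix A assume A: "A \<in> sets F"
    have AM[measurable]: "A \<in> sets M" by (rule setsF[OF A])
    have AD: "D \<inter> (A \<times> space N) \<in> sets (F \<Otimes>\<^sub>M N)" using A D by auto
    have "ennreal (\<integral>\<omega>\<in>A. indicator {\<omega> \<in> space M. (\<omega>, Z \<omega>) \<in> D} \<omega> \<partial>M)
        = emeasure M ({\<omega> \<in> space M. (\<omega>, Z \<omega>) \<in> D} \<inter> A)"
      unfolding set_lebesgue_integral_def
      by (simp add: indicator_inter_arith[symmetric] emeasure_eq_measure Int_commute)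
    also have "{\<omega> \<in> space M. (\<omega>, Z \<omega>) \<in> D} \<inter> A = (\<lambda>\<omega>. (\<omega>, Z \<omega>)) -` (D \<inter> (A \<times> space N)) \<inter> space M"
      using measurable_space[OF Z] sets.sets_into_space[OF AM] by auto
    also have "emeasure M \<dots> = emeasure (?R \<Otimes>\<^sub>M ?L) (D \<inter> (A \<times> space N))"
      unfolding law using AD by (simp add: emeasure_distr)
    also have "\<dots> = (\<integral>\<^sup>+\<omega>. emeasure ?L (Pair \<omega> -` (D \<inter> (A \<times> space N))) \<partial>?R)"
      using AD setsRL by (intro L.emeasure_pair_measure_alt) simp
    also have "\<dots> = (\<integral>\<^sup>+\<omega>. ennreal (indicator A \<omega> * \<kappa> \<omega>) \<partial>?R)"
    proof (rule nn_integral_cong)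
      fix \<omega>
      have "Pair \<omega> -` (D \<inter> (A \<times> space N)) = (if \<omega> \<in> A then Pair \<omega> -` D else {})"
        using sets.sets_into_space[OF D] by (auto simp: space_pair_measure)
      then show "emeasure ?L (Pair \<omega> -` (D \<inter> (A \<times> space N))) = ennreal (indicator A \<omega> * \<kappa> \<omega>)"
        by (simp add: L.emeasure_eq_measure \<kappa>)
    qed
    also have "\<dots> = (\<integral>\<^sup>+\<omega>. ennreal (indicator A \<omega> * \<kappa> \<omega>) \<partial>M)"
      using A by (intro nn_integral_subalgebra2[OF sub] measurable_compose[OF _ measurable_ennreal]
          borel_measurable_times borel_measurable_indicator \<kappa>F)
    also have "\<dots> = ennreal (\<integral>\<omega>\<in>A. \<kappa> \<omega> \<partial>M)"
      unfolding set_lebesgue_integral_def real_scaleR_def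
      by (rule nn_integral_eq_integral)
        (auto simp: le intro!: integrable_real_mult_indicator integrable_const_bound[where B=1]
          split: split_indicator)
    finally show "(\<integral>\<omega>\<in>A. indicator {\<omega> \<in> space M. (\<omega>, Z \<omega>) \<in> D} \<omega> \<partial>M) = (\<integral>\<omega>\<in>A. \<kappa> \<omega> \<partial>M)"
      by (subst (asm) ennreal_inj)
        (auto simp: set_lebesgue_integral_def le intro!: integral_nonneg_AE)
  qed (auto simp: int\<kappa> intro!: integrable_real_indicator simp: emeasure_eq_measure)
  then show ?thesis by (simp add: \<kappa>_def)
qed

lemma borel_measurable_Caratheodory:
  fixes h :: "'a \<Rightarrow> real ^ 'd \<Rightarrow> real"
  assumes meas: "\<And>x. (\<lambda>\<omega>. h \<omega> x) \<in> borel_measurable N"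
    and cont: "\<And>\<omega>. \<omega> \<in> space N \<Longrightarrow> continuous_on UNIV (h \<omega>)"
  shows "(\<lambda>(\<omega>, x). h \<omega> x) \<in> borel_measurable (N \<Otimes>\<^sub>M borel)"
proof -
  define r :: "nat \<Rightarrow> real ^ 'd \<Rightarrow> int ^ 'd" where "r m x = (\<chi> i. \<lfloor>real (Suc m) * x $ i\<rfloor>)" for m x
  define s :: "nat \<Rightarrow> int ^ 'd \<Rightarrow> real ^ 'd" where "s m j = (\<chi> i. of_int (j $ i) / real (Suc m))" for m j
  have rm: "r m \<in> borel \<rightarrow>\<^sub>M count_space UNIV" for m
  proof (subst measurable_count_space_eq2_countable, intro conjI ballI)
    show "r m \<in> space borel \<rightarrow> UNIV" by simp
    fix j
    have eq: "r m -` {j} \<inter> space borel = {x. \<forall>i. \<lfloor>real (Suc m) * x $ i\<rfloor> = j $ i}"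
      by (auto simp: r_def vec_eq_iff)
    show "r m -` {j} \<inter> space borel \<in> sets borel"
      unfolding eq by measurable
  qed
  have "(\<lambda>p. h (fst p) (s m (r m (snd p)))) \<in> borel_measurable (N \<Otimes>\<^sub>M borel)" for m
    by (rule measurable_compose_countable[where f="\<lambda>j p. h (fst p) (s m j)" and g="\<lambda>p. r m (snd p)"])
      (auto intro!: measurable_compose[OF measurable_fst meas] measurable_compose[OF measurable_snd rm])
  then have "(\<lambda>p. h (fst p) (snd p)) \<in> borel_measurable (N \<Otimes>\<^sub>M borel)"
  proof (rule borel_measurable_LIMSEQ_metric)
    fix p assume p: "p \<in> space (N \<Otimes>\<^sub>M (borel :: (real ^ 'd) measure))"
    have "(\<lambda>m. s m (r m (snd p))) \<longlonglongrightarrow> snd p"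
    proof (rule vec_tendstoI)
      fix i
      have "(\<lambda>m. of_int \<lfloor>real (Suc m) * x\<rfloor> / real (Suc m)) \<longlonglongrightarrow> x" for x :: real
      proof (rule tendsto_sandwich)
        show "\<forall>\<^sub>F m in sequentially. x - 1 / real (Suc m) \<le> of_int \<lfloor>real (Suc m) * x\<rfloor> / real (Suc m)"
        proof (rule always_eventually, rule allI)
          fix m
          have "real (Suc m) * x - 1 \<le> of_int \<lfloor>real (Suc m) * x\<rfloor>" by linarith
          then have "(real (Suc m) * x - 1) / real (Suc m) \<le> of_int \<lfloor>real (Suc m) * x\<rfloor> / real (Suc m)"
            by (rule divide_right_mono) simp
          then show "x - 1 / real (Suc m) \<le> of_int \<lfloor>real (Suc m) * x\<rfloor> / real (Suc m)"
            by (simp add: diff_divide_distrib del: of_nat_Suc)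
        qed
        show "\<forall>\<^sub>F m in sequentially. of_int \<lfloor>real (Suc m) * x\<rfloor> / real (Suc m) \<le> x"
        proof (rule always_eventually, rule allI)
          fix m
          have "of_int \<lfloor>real (Suc m) * x\<rfloor> / real (Suc m) \<le> (real (Suc m) * x) / real (Suc m)"
            by (rule divide_right_mono) auto
          then show "of_int \<lfloor>real (Suc m) * x\<rfloor> / real (Suc m) \<le> x" by (simp del: of_nat_Suc)
        qed
        have "(\<lambda>m. x - 1 / real (Suc m)) \<longlonglongrightarrow> x - 0"
          by (intro tendsto_diff tendsto_const) (use LIMSEQ_inverse_real_of_nat in \<open>simp add: inverse_eq_divide\<close>)
        then show "(\<lambda>m. x - 1 / real (Suc m)) \<longlonglongrightarrow> x" by simp
      qed simp
      then show "(\<lambda>m. s m (r m (snd p)) $ i) \<longlonglongrightarrow> snd p $ i"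
        by (simp add: s_def r_def del: of_nat_Suc)
    qed
    moreover have "isCont (h (fst p)) (snd p)"
      using cont[of "fst p"] p by (auto simp: space_pair_measure continuous_on_eq_continuous_at)
    ultimately show "(\<lambda>m. h (fst p) (s m (r m (snd p)))) \<longlonglongrightarrow> h (fst p) (snd p)"
      by (rule isCont_tendsto_compose[rotated])
  qed
  then show ?thesis by (simp add: case_prod_beta')
qed

lemma cond_law_given_random_function:
  fixes h :: "'w \<Rightarrow> real ^ 'd \<Rightarrow> real" and Y :: "'w \<Rightarrow> real" and X :: "'w \<Rightarrow> real ^ 'd"
  assumes M: "prob_space M"
    and ind: "independent_rvs M borel (\<lambda>\<omega>. (Y \<omega>, X \<omega>)) (\<Pi>\<^sub>M x\<in>UNIV. borel) h"
    and cont: "\<And>\<omega>. \<omega> \<in> space M \<Longrightarrow> continuous_on UNIV (h \<omega>)"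
    and B: "B \<in> sets (borel :: (real \<times> real) measure)"
  shows "AE \<omega> in M. real_cond_exp M (vimage_algebra (space M) h (\<Pi>\<^sub>M x\<in>UNIV. borel))
                       (indicator {\<omega> \<in> space M. (Y \<omega>, h \<omega> (X \<omega>)) \<in> B}) \<omega>
                     = \<P>(v in M. (Y v, h \<omega> (X v)) \<in> B)"
proof -
  let ?F = "vimage_algebra (space M) h (\<Pi>\<^sub>M x\<in>UNIV. borel)"
  have Z: "(\<lambda>\<omega>. (Y \<omega>, X \<omega>)) \<in> M \<rightarrow>\<^sub>M borel" and h: "h \<in> M \<rightarrow>\<^sub>M (\<Pi>\<^sub>M x\<in>UNIV. borel)"
    and i: "prob_space.indep_set M (sets (vimage_algebra (space M) (\<lambda>\<omega>. (Y \<omega>, X \<omega>)) borel)) (sets ?F)"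
    using ind by (auto simp: independent_rvs_def)
  have sub: "subalgebra M ?F"
    using h by (auto simp: subalgebra_def sets_vimage_algebra2 measurable_space dest: measurable_sets)
  have hF: "h \<in> ?F \<rightarrow>\<^sub>M (\<Pi>\<^sub>M x\<in>UNIV. borel)"
    using h by (intro measurable_vimage_algebra1) (auto dest: measurable_space)
  have "(\<lambda>\<omega>. h \<omega> x) \<in> borel_measurable ?F" for x
    using measurable_compose[OF hF measurable_component_singleton[of x UNIV "\<lambda>_. borel"]] by simp
  then have hx: "(\<lambda>(\<omega>, x). h \<omega> x) \<in> borel_measurable (?F \<Otimes>\<^sub>M borel)"
    by (rule borel_measurable_Caratheodory) (simp add: cont)
  let ?D = "{p \<in> space (?F \<Otimes>\<^sub>M (borel :: (real \<times> (real ^ 'd)) measure)).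
      (fst (snd p), h (fst p) (snd (snd p))) \<in> B}"
  have "(\<lambda>p. (fst (snd p), h (fst p) (snd (snd p))))
      \<in> (?F \<Otimes>\<^sub>M (borel :: (real \<times> (real ^ 'd)) measure)) \<rightarrow>\<^sub>M (borel \<Otimes>\<^sub>M borel)"
  proof (rule measurable_Pair)
    have fs: "fst \<in> borel_measurable (borel :: (real \<times> (real ^ 'd)) measure)"
      and sn: "snd \<in> (borel :: (real \<times> (real ^ 'd)) measure) \<rightarrow>\<^sub>M borel"
      by (auto intro!: borel_measurable_continuous_onI continuous_intros)
    show "(\<lambda>p. fst (snd p)) \<in> borel_measurable (?F \<Otimes>\<^sub>M (borel :: (real \<times> (real ^ 'd)) measure))"
      by (rule measurable_compose[OF measurable_snd fs])
    have "(\<lambda>p. (fst p, snd (snd p))) \<in> ?F \<Otimes>\<^sub>M (borel :: (real \<times> (real ^ 'd)) measure) \<rightarrow>\<^sub>M ?F \<Otimes>\<^sub>M borel"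
      by (rule measurable_Pair[OF measurable_fst measurable_compose[OF measurable_snd sn]])
    from measurable_compose[OF this hx]
    show "(\<lambda>p. h (fst p) (snd (snd p)))
        \<in> borel_measurable (?F \<Otimes>\<^sub>M (borel :: (real \<times> (real ^ 'd)) measure))"
      by simp
  qed
  then have "(\<lambda>p. (fst (snd p), h (fst p) (snd (snd p)))) -` B
      \<inter> space (?F \<Otimes>\<^sub>M (borel :: (real \<times> (real ^ 'd)) measure)) \<in> sets (?F \<Otimes>\<^sub>M borel)"
    by (rule measurable_sets) (unfold borel_prod, rule B)
  also have "(\<lambda>p. (fst (snd p), h (fst p) (snd (snd p)))) -` B
      \<inter> space (?F \<Otimes>\<^sub>M (borel :: (real \<times> (real ^ 'd)) measure)) = ?D" by auto
  finally have D: "?D \<in> sets (?F \<Otimes>\<^sub>M borel)" .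
  have "{\<omega> \<in> space M. (\<omega>, (Y \<omega>, X \<omega>)) \<in> ?D} = {\<omega> \<in> space M. (Y \<omega>, h \<omega> (X \<omega>)) \<in> B}"
    by (auto simp: space_pair_measure)
  moreover have "\<P>(v in M. (\<omega>, (Y v, X v)) \<in> ?D) = \<P>(v in M. (Y v, h \<omega> (X v)) \<in> B)"
    if "\<omega> \<in> space M" for \<omega>
    using that by (auto simp: space_pair_measure)
  ultimately show ?thesis
    using real_cond_exp_indep_freeze[OF M sub Z i D] by auto
qed

end

theory Submission
  imports Defs
begin

text \<open>
  Write \<open>R = \<tau>(Y,X)\<close> and \<open>V\<close> for the polar coordinates. For bounded measurable \<open>\<psi>\<close>,
  total variation convergence of the law of \<open>V\<close> given \<open>R > r\<close> gives
  \<open>P(R \<psi>(V) > t) / P(R > t) \<longlongrightarrow> E[\<psi>(U,\<Theta>)]\<close>. Taking for \<open>R \<psi>(V)\<close> the variables \<open>Y\<close>,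
  \<open>g(X)\<close> and \<open>min Y (g(X)/c)\<close> identifies the tail scale of \<open>g\<close> as \<open>C(g)/E[U]\<close> and the
  tail dependence coefficient as \<open>\<Lambda>(g/c)\<close>.

  The optimal predictor maximises, for each direction \<open>\<theta>\<close>, the concave function
  \<open>y \<mapsto> E[min U ((1-U) y) | \<theta>] - (1-\<alpha>) y E[1-U | \<theta>]\<close>. Hence
  \<open>\<Lambda>(h) \<le> \<Lambda>(g) + (1-\<alpha>) (C(h)/E[U] - 1)\<close> for every competitor \<open>h\<close>.

  Given the set of exceedance indices, the exceedance sample is iid from \<open>P\<^sub>t\<close>, so its law is within
  (number of exceedances) \<open>\<times>\<close> (total variation distance of \<open>P\<^sub>t\<close> and \<open>P\<^sub>\<infinity>\<close>) of that of an iid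
  sample from \<open>P\<^sub>\<infinity>\<close>. Averaging turns the first factor into \<open>n P(R > t\<^sub>n)\<close>; the bias condition
  thus transfers the consistency of the quantile estimator to the exceedances, uniformly over
  directions, and \<open>C\<close> and \<open>\<Lambda>\<close> are Lipschitz in the uniform norm on the support of \<open>\<Theta>\<close>.
\<close>

section \<open>Regularly varying tails\<close>

text \<open>The estimator is evaluated at a random level that depends on the same data as the
  sample, and the sample size is random too. Uniformity in the level over a compact interval around
  \<open>\<alpha>_star\<close> turns the error into an event about the sample alone, and splitting
  over the finitely many index sets fixes the sample size. Suprema over levels and directions may
  fail to be measurable, so such events are enclosed in measurable sets of the same outer measure
  before laws are compared.

  Quantiles enter twice. In the tail dependence coefficient the quantiles of Y and g(X) are compared
  without continuity of their laws: regular variation makes atoms negligible relative to the tail,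
  and index one makes the quantile of g(X) asymptotically c times that of Y. In the predictor, 1 -
  \<alpha> is the Lagrange multiplier of the constraint C(h) = E[U], which is why one quantile level
  serves all directions. The map q / (1 - q) is Lipschitz only away from q = 1; compactness of
  \<open>S\<close> keeps the optimal q away from it.\<close>

locale pareto_tail =
  fixes F :: "real \<Rightarrow> real"
  assumes anti: "x \<le> y \<Longrightarrow> F y \<le> F x"
    and pos: "0 < F x"
    and ratio: "0 < s \<Longrightarrow> ((\<lambda>r. F (s * r) / F r) \<longlongrightarrow> 1 / s) at_top"

text \<open>Monotonicity fills the gaps between the scales \<open>a n\<close>: every large r lies
  within a factor close to 1 of \<open>a n\<close> for n about 1 / F r. Neither monotonicity nor
  divergence of \<open>a\<close> is assumed, so positivity of F and its decay to 0 have to be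
  derived first.\<close>

lemma pareto_tailI:
  fixes F :: "real \<Rightarrow> real" and a :: "nat \<Rightarrow> real"
  assumes anti: "\<And>x y. x \<le> y \<Longrightarrow> F y \<le> F x" and nonneg: "\<And>x. 0 \<le> F x"
    and a: "\<And>n. 0 < a n"
    and seq: "\<And>s. 0 < s \<Longrightarrow> (\<lambda>n. real n * F (s * a n)) \<longlonglongrightarrow> 1 / s"
  shows "pareto_tail F"
proof
  have F0: "(\<lambda>n. F (s * a n)) \<longlonglongrightarrow> 0" if "0 < s" for s
  proof -
    have "(\<lambda>n. real n * F (s * a n) * (1 / real n)) \<longlonglongrightarrow> 1 / s * 0"
      by (intro tendsto_mult seq that lim_1_over_n)
    then have "(\<lambda>n. real n * F (s * a n) * (1 / real n)) \<longlonglongrightarrow> 0" by simp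
    then show ?thesis
      by (rule Lim_transform_eventually) (rule eventually_sequentiallyI[of 1], simp)
  qed
  have Fpos: "\<forall>\<^sub>F n in sequentially. 0 < F (s * a n)" if "0 < s" for s
  proof -
    have "\<forall>\<^sub>F n in sequentially. 0 < real n * F (s * a n)"
      using order_tendstoD(1)[OF seq[OF that], of 0] that by simp
    then show ?thesis
      by eventually_elim (use nonneg in \<open>auto simp: zero_less_mult_iff\<close>)
  qed
  show pos: "0 < F x" for x
  proof (rule ccontr)
    assume "\<not> 0 < F x"
    then have z: "F (max x 1) = 0"
      using nonneg[of "max x 1"] anti[of x "max x 1"] by simp
    \<comment> \<open>A zero of F at b = max x 1 forces s * a n < b eventually for every s > 0, as F
      is positive there; s = b / y then gives a n < y. So a n would tend to 0, F would vanish on all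
      positive arguments, and n F(a n) could not tend to 1.\<close>
    have a0: "\<forall>\<^sub>F n in sequentially. a n < y" if y: "0 < y" for y
    proof -
      let ?s = "max x 1 / y"
      have s: "0 < ?s" using y by simp
      from Fpos[OF s] show ?thesis
      proof eventually_elim
        case (elim n)
        show ?case
        proof (rule ccontr)
          assume "\<not> a n < y"
          then have "?s * y \<le> ?s * a n" using s by (intro mult_left_mono) auto
          with y have "max x 1 \<le> ?s * a n" by simp
          from anti[OF this] z elim show False by simp
        qed
      qed
    qed
    have zero: "F y = 0" if y: "0 < y" for y
    proof -
      have "\<forall>\<^sub>F n in sequentially. F y \<le> F (1 * a n)"
        using a0[OF y] by eventually_elim (auto intro: anti)
      from tendsto_le[OF _ F0 tendsto_const this] have "F y \<le> 0" by simp
      then show ?thesis using nonneg[of y] by simp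
    qed
    have "(\<lambda>n. real n * F (1 * a n)) \<longlonglongrightarrow> 0"
      using a by (simp add: zero)
    from LIMSEQ_unique[OF this seq] show False by simp
  qed
  have lim: "(F \<longlongrightarrow> 0) at_top"
  proof (rule order_tendstoI)
    fix e :: real assume "0 < e"
    then have "\<forall>\<^sub>F n in sequentially. F (1 * a n) < e" using order_tendstoD(2)[OF F0[of 1]] by simp
    then obtain n where "F (a n) < e" by (auto simp: eventually_sequentially)
    then show "\<forall>\<^sub>F x in at_top. F x < e"
      using anti[of "a n"] by (auto simp: eventually_at_top_linorder intro: le_less_trans)
  qed (auto intro!: always_eventually intro: less_trans[OF _ pos])
  fix s :: real assume s: "0 < s"
  \<comment> \<open>The index whose scale matches r: as n F(a n) tends to 1, F(a n) is about 1 / n,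
    which is about F r for n = \<open>N r\<close>.\<close>
  define N where "N r = nat \<lfloor>1 / F r\<rfloor>" for r
  have N: "real (N r) \<le> 1 / F r" "1 / F r < real (N r) + 1" for r
    using pos[of r] unfolding N_def by (auto simp: of_nat_nat)
  have Nlim: "filterlim N sequentially at_top"
  proof -
    have "filterlim (\<lambda>r. inverse (F r)) at_top at_top"
      by (rule filterlim_inverse_at_top[OF lim]) (simp add: pos)
    then show ?thesis unfolding N_def
      by (intro filterlim_compose[OF filterlim_nat_sequentially]
          filterlim_compose[OF filterlim_floor_sequentially]) (simp add: inverse_eq_divide)
  qed
  have upper: "\<forall>\<^sub>F r in at_top. F (s * r) / F r < b" if b: "1 / s < b" for b
  proof -
    have "((\<lambda>d. 1 / (s * (1 - d))) \<longlongrightarrow> 1 / (s * (1 - 0))) (at_right 0)"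
      using s by (intro tendsto_intros) auto
    then have "\<forall>\<^sub>F d in at_right 0. 1 / (s * (1 - d)) < b"
      using b by (auto dest: order_tendstoD(2))
    moreover have "\<forall>\<^sub>F d in at_right 0. d \<in> {0<..<1::real}"
      by (rule eventually_at_right_real) simp
    ultimately have "\<forall>\<^sub>F d in at_right 0. d \<in> {0<..<1} \<and> 1 / (s * (1 - d)) < b"
      by eventually_elim auto
    then obtain d where d: "0 < d" "d < 1" "1 / (s * (1 - d)) < b"
      by (auto dest!: eventually_happens simp: trivial_limit_at_right_real)
    \<comment> \<open>The limit is 1 / (1 - d) > 1. Together with N(r) F(r) \<le> 1 this yields F r
      < F((1 - d) a_N), hence (1 - d) a_N < r by monotonicity.\<close>
    have 1: "\<forall>\<^sub>F n in sequentially. 1 < real n * F ((1 - d) * a n)"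
      using d by (intro order_tendstoD(1)[OF seq]) (auto simp: field_simps)
    \<comment> \<open>The factor n + 1 stems from 1 / F r < N(r) + 1; the extra summand vanishes by
      \<open>F0\<close>.\<close>
    have 2: "(\<lambda>n. (real n + 1) * F (s * (1 - d) * a n)) \<longlonglongrightarrow> 1 / (s * (1 - d)) + 0"
      unfolding distrib_right mult_1_left using d s
      by (intro tendsto_add seq F0) auto
    have "\<forall>\<^sub>F n in sequentially. (real n + 1) * F (s * (1 - d) * a n) < b"
      using d by (intro order_tendstoD(2)[OF 2]) auto
    with 1 have "\<forall>\<^sub>F n in sequentially. 1 < real n * F ((1 - d) * a n)
        \<and> (real n + 1) * F (s * (1 - d) * a n) < b" by eventually_elim auto
    from eventually_compose_filterlim[OF this Nlim] show ?thesis
    proof eventually_elim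
      case (elim r)
      have "real (N r) * F r \<le> 1" using N(1)[of r] pos[of r] by (simp add: field_simps)
      with elim have "real (N r) * F r < real (N r) * F ((1 - d) * a (N r))" by linarith
      then have "F r < F ((1 - d) * a (N r))" by (simp add: mult_less_cancel_left)
      then have "(1 - d) * a (N r) < r" using anti[of r "(1 - d) * a (N r)"] by linarith
      then have "F (s * r) \<le> F (s * (1 - d) * a (N r))" using s by (intro anti) (simp add: mult.assoc)
      then have "F (s * r) * (1 / F r) \<le> F (s * (1 - d) * a (N r)) * (real (N r) + 1)"
        using N(2)[of r] pos by (intro mult_mono) (auto simp: less_imp_le)
      with elim show ?case by (simp add: mult.commute)
    qed
  qed
  have lower: "\<forall>\<^sub>F r in at_top. b < F (s * r) / F r" if b: "b < 1 / s" for b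
  proof -
    have "((\<lambda>d. 1 / (s * (1 + d))) \<longlongrightarrow> 1 / (s * (1 + 0))) (at_right 0)"
      using s by (intro tendsto_intros) auto
    then have "\<forall>\<^sub>F d in at_right 0. b < 1 / (s * (1 + d))"
      using b by (auto dest: order_tendstoD(1))
    moreover have "\<forall>\<^sub>F d in at_right 0. d \<in> {0<..<1::real}"
      by (rule eventually_at_right_real) simp
    ultimately have "\<forall>\<^sub>F d in at_right 0. d \<in> {0<..<1} \<and> b < 1 / (s * (1 + d))"
      by eventually_elim auto
    then obtain d where d: "0 < d" "d < 1" "b < 1 / (s * (1 + d))"
      by (auto dest!: eventually_happens simp: trivial_limit_at_right_real)
    \<comment> \<open>The roles of n and n + 1 are exchanged against the upper bound: now (N(r) + 1)
      F(r) > 1 locates r from above, and N(r) \<le> 1 / F r bounds the quotient from below.\<close>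
    have L: "(\<lambda>n. (real n + 1) * F ((1 + d) * a n)) \<longlonglongrightarrow> 1 / (1 + d) + 0"
      unfolding distrib_right[of _ _ "F _"] mult_1_left using d
      by (intro tendsto_add seq F0) auto
    have 1: "\<forall>\<^sub>F n in sequentially. (real n + 1) * F ((1 + d) * a n) < 1"
      by (rule order_tendstoD(2)[OF L]) (use d in auto)
    have "\<forall>\<^sub>F n in sequentially. b < real n * F (s * (1 + d) * a n)"
      using d s by (intro order_tendstoD(1)[OF seq]) auto
    with 1 have "\<forall>\<^sub>F n in sequentially. (real n + 1) * F ((1 + d) * a n) < 1
        \<and> b < real n * F (s * (1 + d) * a n)" by eventually_elim auto
    from eventually_compose_filterlim[OF this Nlim] show ?thesis
    proof eventually_elim
      case (elim r)
      have "1 < (real (N r) + 1) * F r" using N(2)[of r] pos[of r] by (simp add: field_simps)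
      with elim have "(real (N r) + 1) * F ((1 + d) * a (N r)) < (real (N r) + 1) * F r" by linarith
      then have "F ((1 + d) * a (N r)) < F r" by (simp add: mult_less_cancel_left)
      then have "r < (1 + d) * a (N r)" using anti[of "(1 + d) * a (N r)" r] by linarith
      then have "F (s * (1 + d) * a (N r)) \<le> F (s * r)" using s by (intro anti) (simp add: mult.assoc)
      then have "F (s * (1 + d) * a (N r)) * real (N r) \<le> F (s * r) * (1 / F r)"
        using N(1)[of r] pos by (intro mult_mono) (auto simp: less_imp_le)
      with elim show ?case by (simp add: mult.commute)
    qed
  qed
  show "((\<lambda>r. F (s * r) / F r) \<longlongrightarrow> 1 / s) at_top"
    by (rule order_tendstoI) (use lower upper in auto)
qed (rule anti)


section \<open>Left quantiles\<close>

context real_distribution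
begin

text \<open>\<open>Inf\<close> carries information only for sets bounded below; the bound comes from
  the limit 0 of the cdf at minus infinity and 0 < p.\<close>

lemma cdf_less_left_quantile:
  assumes p: "0 < p" and x: "x < left_quantile M p"
  shows "cdf M x < p"
proof -
  have "\<forall>\<^sub>F x in at_bot. cdf M x < p" using order_tendstoD(2)[OF cdf_lim_at_bot p] .
  then obtain b where "\<And>x. x \<le> b \<Longrightarrow> cdf M x < p" by (auto simp: eventually_at_bot_linorder)
  then have "bdd_below {x. p \<le> cdf M x}"
    by (intro bdd_belowI[of _ b]) (metis linorder_not_less mem_Collect_eq nle_le)
  then show ?thesis
    using x cInf_lower[of x "{x. p \<le> cdf M x}"]
    by (force simp: left_quantile_def not_less[symmetric])
qed

text \<open>Right continuity of the cdf makes the infimum attained; p < 1 makes the set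
  nonempty.\<close>

lemma le_cdf_left_quantile:
  assumes p: "0 < p" "p < 1"
  shows "p \<le> cdf M (left_quantile M p)"
proof (rule tendsto_lowerbound)
  let ?q = "left_quantile M p"
  show "(cdf M \<longlongrightarrow> cdf M ?q) (at_right ?q)"
    using cdf_is_right_cont[of ?q] by (simp add: continuous_within)
  have "\<forall>\<^sub>F x in at_top. p < cdf M x" using order_tendstoD(1)[OF cdf_lim_at_top_prob p(2)] .
  then obtain x where "p < cdf M x" by (auto simp: eventually_at_top_linorder)
  then have ne: "{x. p \<le> cdf M x} \<noteq> {}" by (auto intro: less_imp_le)
  have "p \<le> cdf M x" if qx: "?q < x" for x
  proof -
    obtain y where "p \<le> cdf M y" "y < x"
      using cInf_lessD[OF ne qx[unfolded left_quantile_def]] by auto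
    then show ?thesis using cdf_nondecreasing[of y x] by simp
  qed
  then show "\<forall>\<^sub>F x in at_right ?q. p \<le> cdf M x"
    by (auto simp: eventually_at_right_field intro!: exI[of _ "?q + 1"])
qed simp

lemma cdf_left_quantile:
  assumes p: "0 < p" "p < 1" and cont: "isCont (cdf M) (left_quantile M p)"
  shows "cdf M (left_quantile M p) = p"
proof (rule antisym)
  let ?q = "left_quantile M p"
  show "cdf M ?q \<le> p"
  proof (rule tendsto_upperbound)
    show "(cdf M \<longlongrightarrow> cdf M ?q) (at_left ?q)"
      using cont by (auto simp: isCont_def intro: tendsto_within_subset)
    show "\<forall>\<^sub>F x in at_left ?q. cdf M x \<le> p"
      using eventually_at_left_real[of "?q - 1" ?q]
      by (auto elim!: eventually_mono intro!: less_imp_le cdf_less_left_quantile p)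
  qed simp
qed (rule le_cdf_left_quantile[OF p])

end


section \<open>Products, quantiles and tail dependence under a tail of index one\<close>

context pareto_tail
begin

lemma tail_scaled:
  assumes "((\<lambda>r. G r / F r) \<longlongrightarrow> l) at_top" "0 < s"
  shows "((\<lambda>r. G (s * r) / F r) \<longlongrightarrow> l / s) at_top"
proof -
  have "((\<lambda>r. G (s * r) / F (s * r) * (F (s * r) / F r)) \<longlongrightarrow> l * (1 / s)) at_top"
    by (intro tendsto_mult ratio assms filterlim_compose[OF assms(1)]
        filterlim_tendsto_pos_mult_at_top[OF tendsto_const] filterlim_ident)
  moreover have "F x \<noteq> 0" for x using pos[of x] by simp
  ultimately show ?thesis by simp
qed

text \<open>
  Only convergence \<open>P(V \<in> B | R > r) \<longlongrightarrow> Q(B)\<close> on all measurable sets is used, so \<open>\<psi>\<close> need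
  not be continuous: it is sandwiched between step functions.
\<close>
lemma tail_of_product:
  fixes R :: "'w \<Rightarrow> real" and V :: "'w \<Rightarrow> 'v" and \<psi> :: "'v \<Rightarrow> real"
  assumes M: "prob_space M" and Q: "prob_space Q" and sets_Q: "sets Q = sets N"
    and R[measurable]: "R \<in> borel_measurable M" and R0: "\<And>\<omega>. \<omega> \<in> space M \<Longrightarrow> 0 \<le> R \<omega>"
    and V[measurable]: "V \<in> M \<rightarrow>\<^sub>M N"
    and conv: "\<And>B. B \<in> sets N \<Longrightarrow>
        ((\<lambda>r. \<P>(\<omega> in M. r < R \<omega> \<and> V \<omega> \<in> B) / F r) \<longlongrightarrow> measure Q B) at_top"
    and \<psi>[measurable]: "\<psi> \<in> borel_measurable N"
    and \<psi>V: "\<And>\<omega>. \<omega> \<in> space M \<Longrightarrow> 0 \<le> \<psi> (V \<omega>) \<and> \<psi> (V \<omega>) \<le> K"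
    and \<psi>Q: "AE v in Q. 0 \<le> \<psi> v \<and> \<psi> v \<le> K"
  shows "((\<lambda>t. \<P>(\<omega> in M. t < R \<omega> * \<psi> (V \<omega>)) / F t) \<longlongrightarrow> (\<integral>v. \<psi> v \<partial>Q)) at_top"
proof -
  interpret M: prob_space M by fact
  interpret Q: prob_space Q by fact
  have spQ: "space Q = space N" using sets_Q by (rule sets_eq_imp_space_eq)
  note [measurable_cong] = sets_Q
  \<comment> \<open>For s > 0 the level rescales the argument by 1 / s; for s = 0 the event is empty
    as soon as t is positive.\<close>
  have step: "((\<lambda>t. \<P>(\<omega> in M. t < R \<omega> * s \<and> V \<omega> \<in> B) / F t) \<longlongrightarrow> s * measure Q B) at_top"
    if B: "B \<in> sets N" and s: "0 \<le> s" for s B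
  proof (cases "s = 0")
    case True
    have "\<forall>\<^sub>F t in at_top. 0 = \<P>(\<omega> in M. t < R \<omega> * s \<and> V \<omega> \<in> B) / F t"
      using eventually_gt_at_top[of 0] by eventually_elim (simp add: True)
    then show ?thesis by (rule Lim_transform_eventually[OF _ , rotated]) (simp add: True)
  next
    case False
    with s have s: "0 < s" by simp
    have "((\<lambda>r. \<P>(\<omega> in M. (1 / s) * r < R \<omega> \<and> V \<omega> \<in> B) / F r) \<longlongrightarrow> measure Q B / (1 / s)) at_top"
      by (rule tail_scaled[OF conv[OF B]]) (use s in simp)
    with s show ?thesis by (simp add: field_simps)
  qed
  \<comment> \<open>Level sets of \<open>\<psi>\<close> at mesh 1 / m. Since R is nonnegative, on
    each of them R \<psi>(V) lies between two constant multiples of R.\<close>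
  define B where "B m j = {v \<in> space N. real j / real m \<le> \<psi> v \<and> \<psi> v < (real j + 1) / real m}"
    for m j :: nat
  have B[measurable]: "B m j \<in> sets N" for m j unfolding B_def by measurable
  define J where "J m = {..nat \<lceil>real m * K\<rceil>}" for m :: nat
  have uniq: "real j / real m \<le> x \<and> x < (real j + 1) / real m \<longleftrightarrow> j = nat \<lfloor>real m * x\<rfloor>"
    if "0 < m" "0 \<le> x" for m j :: nat and x :: real
  proof -
    have "real j / real m \<le> x \<and> x < (real j + 1) / real m
        \<longleftrightarrow> real j \<le> real m * x \<and> real m * x < real j + 1"
      using that by (simp add: field_simps)
    also have "\<dots> \<longleftrightarrow> \<lfloor>real m * x\<rfloor> = int j" by (auto simp: floor_eq_iff)
    also have "\<dots> \<longleftrightarrow> j = nat \<lfloor>real m * x\<rfloor>"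
      using that by (subst eq_nat_nat_iff[symmetric]) auto
    finally show ?thesis .
  qed
  have inJ: "nat \<lfloor>real m * x\<rfloor> \<in> J m" if "0 \<le> x" "x \<le> K" for m and x :: real
  proof -
    have "real m * x \<le> real m * K" using that by (intro mult_left_mono) auto
    then have "\<lfloor>real m * x\<rfloor> \<le> \<lceil>real m * K\<rceil>" by linarith
    then show ?thesis unfolding J_def by (auto intro: nat_mono)
  qed
  have low: "(\<Sum>j\<in>J m. (real j / real m) * indicator (B m j) v) \<le> \<psi> v"
    and upp: "\<psi> v \<le> (\<Sum>j\<in>J m. ((real j + 1) / real m) * indicator (B m j) v)"
    and one: "(\<Sum>j\<in>J m. indicator (B m j) v :: real) = 1"
    if m: "0 < m" and v: "v \<in> space N" "0 \<le> \<psi> v" "\<psi> v \<le> K" for m :: nat and v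
  proof -
    let ?j = "nat \<lfloor>real m * \<psi> v\<rfloor>"
    have ind: "indicator (B m j) v = (if j = ?j then 1 else 0 :: real)" for j
      using v uniq[OF m v(2), of j] by (auto simp: B_def indicator_def)
    have fin: "finite (J m)" by (simp add: J_def)
    have j: "?j \<in> J m" by (rule inJ) (use v in auto)
    have S: "(\<Sum>j\<in>J m. f j * indicator (B m j) v) = f ?j" for f :: "nat \<Rightarrow> real"
      unfolding ind using fin j by (simp add: sum.delta if_distrib[of "\<lambda>x. f _ * x"] cong: if_cong)
    show "(\<Sum>j\<in>J m. (real j / real m) * indicator (B m j) v) \<le> \<psi> v"
      "\<psi> v \<le> (\<Sum>j\<in>J m. ((real j + 1) / real m) * indicator (B m j) v)"
      unfolding S using uniq[OF m v(2), of ?j] by auto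
    show "(\<Sum>j\<in>J m. indicator (B m j) v :: real) = 1"
      using S[of "\<lambda>_. 1"] by simp
  qed
  have AEspace: "AE v in Q. v \<in> space N" using spQ by (metis AE_space)
  have int\<psi>: "integrable Q \<psi>"
    using \<psi>Q by (intro Q.integrable_const_bound[where B=K]) auto
  have int_step: "integrable Q (\<lambda>v. \<Sum>j\<in>J m. f j * indicator (B m j) v)"
    and lint_step: "(\<integral>v. (\<Sum>j\<in>J m. f j * indicator (B m j) v) \<partial>Q) = (\<Sum>j\<in>J m. f j * measure Q (B m j))"
    for f :: "nat \<Rightarrow> real" and m
    using spQ sets.sets_into_space[OF B, of m]
    by (auto simp: Q.emeasure_eq_measure less_top[symmetric] Int_absorb2
        intro!: Bochner_Integration.integrable_sum integrable_real_indicator)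
  let ?I = "\<integral>v. \<psi> v \<partial>Q"
  have lowI: "?I - 1 / real m \<le> (\<Sum>j\<in>J m. (real j / real m) * measure Q (B m j))"
    and uppI: "(\<Sum>j\<in>J m. ((real j + 1) / real m) * measure Q (B m j)) \<le> ?I + 1 / real m"
    if m: "0 < m" for m :: nat
  proof -
    \<comment> \<open>The upper and lower sums differ by the mesh times the total mass of the cells,
      and that mass is 1 because almost every point lies in exactly one cell.\<close>
    have diff: "(\<Sum>j\<in>J m. ((real j + 1) / real m) * measure Q (B m j))
        = (\<Sum>j\<in>J m. (real j / real m) * measure Q (B m j)) + 1 / real m * (\<Sum>j\<in>J m. measure Q (B m j))"
      by (simp add: sum_distrib_left sum.distrib[symmetric] add_divide_distrib distrib_right)
    have "(\<integral>v. (\<Sum>j\<in>J m. 1 * indicator (B m j) v) \<partial>Q) = (\<Sum>j\<in>J m. 1 * measure Q (B m j))"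
      by (rule lint_step)
    moreover have "(\<integral>v. (\<Sum>j\<in>J m. 1 * indicator (B m j) v) \<partial>Q) = (\<integral>v. (1::real) \<partial>Q)"
    proof (rule integral_cong_AE)
      show "AE v in Q. (\<Sum>j\<in>J m. 1 * indicator (B m j) v) = (1 :: real)"
        using \<psi>Q AEspace by eventually_elim (simp add: one[OF m])
    qed (use borel_measurable_integrable[OF int_step] in auto)
    ultimately have S: "(\<Sum>j\<in>J m. measure Q (B m j)) = 1" by (simp add: Q.prob_space)
    have "(\<Sum>j\<in>J m. (real j / real m) * measure Q (B m j)) \<le> ?I"
      unfolding lint_step[symmetric]
      by (rule integral_mono_AE[OF int_step int\<psi>]) (use \<psi>Q AEspace low[OF m] in auto)
    moreover have "?I \<le> (\<Sum>j\<in>J m. ((real j + 1) / real m) * measure Q (B m j))"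
      unfolding lint_step[symmetric]
      by (rule integral_mono_AE[OF int\<psi> int_step]) (use \<psi>Q AEspace upp[OF m] in auto)
    ultimately show "?I - 1 / real m \<le> (\<Sum>j\<in>J m. (real j / real m) * measure Q (B m j))"
      "(\<Sum>j\<in>J m. ((real j + 1) / real m) * measure Q (B m j)) \<le> ?I + 1 / real m"
      using diff S by auto
  qed
  let ?P = "\<lambda>m t f. \<Sum>j\<in>J m. \<P>(\<omega> in M. t < R \<omega> * f j \<and> V \<omega> \<in> B m j) / F t"
  have sumlim: "((\<lambda>t. ?P m t f) \<longlongrightarrow> (\<Sum>j\<in>J m. f j * measure Q (B m j))) at_top"
    if "\<And>j. 0 \<le> f j" for m and f :: "nat \<Rightarrow> real"
    by (intro tendsto_sum step B that)
  \<comment> \<open>V lies in one cell only, so a sum over cells is the probability of a single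
    union, which can be compared with the event for \<open>\<psi>\<close> by inclusion.\<close>
  have disj: "disjoint_family_on (\<lambda>j. {\<omega>\<in>space M. t < R \<omega> * f j \<and> V \<omega> \<in> B m j}) (J m)"
    if m: "0 < m" for m t and f :: "nat \<Rightarrow> real"
  proof -
    have "V \<omega> \<in> B m i \<Longrightarrow> V \<omega> \<in> B m j \<Longrightarrow> \<omega> \<in> space M \<Longrightarrow> i = j" for i j \<omega>
      using uniq[OF m, of "\<psi> (V \<omega>)" i] uniq[OF m, of "\<psi> (V \<omega>)" j] \<psi>V[of \<omega>] by (auto simp: B_def)
    then show ?thesis by (auto simp: disjoint_family_on_def)
  qed
  have Psum: "?P m t f = M.prob (\<Union>j\<in>J m. {\<omega>\<in>space M. t < R \<omega> * f j \<and> V \<omega> \<in> B m j}) / F t"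
    if m: "0 < m" for m t and f :: "nat \<Rightarrow> real"
    unfolding sum_divide_distrib[symmetric]
    by (subst M.finite_measure_finite_Union) (use disj[OF m] in \<open>auto simp: J_def\<close>)
  have lowP: "?P m t (\<lambda>j. real j / real m) \<le> \<P>(\<omega> in M. t < R \<omega> * \<psi> (V \<omega>)) / F t"
    and uppP: "\<P>(\<omega> in M. t < R \<omega> * \<psi> (V \<omega>)) / F t \<le> ?P m t (\<lambda>j. (real j + 1) / real m)"
    if m: "0 < m" for m t
  proof -
    have cover: "\<exists>j\<in>J m. V \<omega> \<in> B m j" if \<omega>: "\<omega> \<in> space M" for \<omega>
      using uniq[OF m, of "\<psi> (V \<omega>)" "nat \<lfloor>real m * \<psi> (V \<omega>)\<rfloor>"] inJ[of "\<psi> (V \<omega>)" m] \<psi>V[OF \<omega>]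
        measurable_space[OF V \<omega>]
      by (intro bexI[of _ "nat \<lfloor>real m * \<psi> (V \<omega>)\<rfloor>"]) (auto simp: B_def simp del: of_nat_nat)
    have le1: "R \<omega> * (real j / real m) \<le> R \<omega> * \<psi> (V \<omega>)"
      and le2: "R \<omega> * \<psi> (V \<omega>) \<le> R \<omega> * ((real j + 1) / real m)"
      if "\<omega> \<in> space M" "V \<omega> \<in> B m j" for \<omega> j
      using that R0[of \<omega>] by (auto simp: B_def simp del: times_divide_eq_right intro!: mult_left_mono)
    show "?P m t (\<lambda>j. real j / real m) \<le> \<P>(\<omega> in M. t < R \<omega> * \<psi> (V \<omega>)) / F t"
      unfolding Psum[OF m] using le1
      by (intro divide_right_mono M.finite_measure_mono)
        (auto simp: less_imp_le[OF pos] intro: less_le_trans)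
    show "\<P>(\<omega> in M. t < R \<omega> * \<psi> (V \<omega>)) / F t \<le> ?P m t (\<lambda>j. (real j + 1) / real m)"
      unfolding Psum[OF m]
    proof (intro divide_right_mono M.finite_measure_mono)
      show "{\<omega> \<in> space M. t < R \<omega> * \<psi> (V \<omega>)}
          \<subseteq> (\<Union>j\<in>J m. {\<omega> \<in> space M. t < R \<omega> * ((real j + 1) / real m) \<and> V \<omega> \<in> B m j})"
      proof
        fix \<omega> assume "\<omega> \<in> {\<omega> \<in> space M. t < R \<omega> * \<psi> (V \<omega>)}"
        then have \<omega>: "\<omega> \<in> space M" and t: "t < R \<omega> * \<psi> (V \<omega>)" by auto
        obtain j where j: "j \<in> J m" "V \<omega> \<in> B m j" using cover[OF \<omega>] by auto
        from less_le_trans[OF t le2[OF \<omega> j(2)]] \<omega> j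
        show "\<omega> \<in> (\<Union>j\<in>J m. {\<omega> \<in> space M. t < R \<omega> * ((real j + 1) / real m) \<and> V \<omega> \<in> B m j})"
          by auto
      qed
    qed (auto simp: J_def less_imp_le[OF pos])
  qed
  show ?thesis
  proof (rule order_tendstoI)
    fix b assume b: "b < ?I"
    then obtain m where "inverse (real (Suc m)) < ?I - b" using reals_Archimedean[of "?I - b"] by auto
    then have m: "0 < Suc m" "1 / real (Suc m) < ?I - b" by (auto simp: inverse_eq_divide)
    have "b < (\<Sum>j\<in>J (Suc m). (real j / real (Suc m)) * measure Q (B (Suc m) j))"
      using lowI[OF m(1)] m(2) by linarith
    then have "\<forall>\<^sub>F t in at_top. b < ?P (Suc m) t (\<lambda>j. real j / real (Suc m))"
      by (intro order_tendstoD(1)[OF sumlim]) auto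
    then show "\<forall>\<^sub>F t in at_top. b < \<P>(\<omega> in M. t < R \<omega> * \<psi> (V \<omega>)) / F t"
      by eventually_elim (rule less_le_trans[OF _ lowP[OF m(1)]])
  next
    fix b assume b: "?I < b"
    then obtain m where "inverse (real (Suc m)) < b - ?I" using reals_Archimedean[of "b - ?I"] by auto
    then have m: "0 < Suc m" "1 / real (Suc m) < b - ?I" by (auto simp: inverse_eq_divide)
    have "(\<Sum>j\<in>J (Suc m). ((real j + 1) / real (Suc m)) * measure Q (B (Suc m) j)) < b"
      using uppI[OF m(1)] m(2) by linarith
    then have "\<forall>\<^sub>F t in at_top. ?P (Suc m) t (\<lambda>j. (real j + 1) / real (Suc m)) < b"
      by (intro order_tendstoD(2)[OF sumlim]) auto
    then show "\<forall>\<^sub>F t in at_top. \<P>(\<omega> in M. t < R \<omega> * \<psi> (V \<omega>)) / F t < b"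
      by eventually_elim (rule le_less_trans[OF uppP[OF m(1)]])
  qed
qed

text \<open>F is merely monotone and cannot be inverted. Instead F(r) is compared with F((1 - d) s)
  and F((1 + d) s), whose ratios to F(s) tend to values on either side of 1.\<close>

lemma scale_comparison:
  assumes s: "filterlim s at_top G" and conv: "((\<lambda>p. F (r p) / F (s p)) \<longlongrightarrow> 1) G"
    and d: "0 < d" "d < 1"
  shows "\<forall>\<^sub>F p in G. (1 - d) * s p < r p \<and> r p < (1 + d) * s p"
proof -
  have 1: "((\<lambda>p. F ((1 - d) * s p) / F (s p)) \<longlongrightarrow> 1 / (1 - d)) G"
    by (rule filterlim_compose[OF ratio s]) (use d in auto)
  have 2: "((\<lambda>p. F ((1 + d) * s p) / F (s p)) \<longlongrightarrow> 1 / (1 + d)) G"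
    by (rule filterlim_compose[OF ratio s]) (use d in auto)
  from tendsto_diff[OF 1 conv] have "\<forall>\<^sub>F p in G. 0 < F ((1 - d) * s p) / F (s p) - F (r p) / F (s p)"
    by (rule order_tendstoD) (use d in \<open>simp add: field_simps\<close>)
  moreover from tendsto_diff[OF conv 2] have "\<forall>\<^sub>F p in G. 0 < F (r p) / F (s p) - F ((1 + d) * s p) / F (s p)"
    by (rule order_tendstoD) (use d in \<open>simp add: field_simps\<close>)
  ultimately show ?thesis
  proof eventually_elim
    case (elim p)
    from elim have "F (r p) < F ((1 - d) * s p)" "F ((1 + d) * s p) < F (r p)"
      using pos[of "s p"] by (auto simp: diff_divide_distrib[symmetric] zero_less_divide_iff)
    then show ?case using anti[of "r p" "(1 - d) * s p"] anti[of "(1 + d) * s p" "r p"] by linarith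
  qed
qed

text \<open>The upper bound for the exceedance probability is immediate from p \<le> cdf at the
  quantile. For the lower bound an atom at q p is absorbed by stepping back to (1 - d) q p, where
  the tail already exceeds 1 - p; regular variation shows that this step changes the tail only by
  the factor 1 / (1 - d) in the limit.\<close>

lemma left_quantile_tail:
  assumes M: "prob_space M" and \<xi>[measurable]: "\<xi> \<in> borel_measurable M" and a: "0 < a"
    and tail: "((\<lambda>r. \<P>(\<omega> in M. r < \<xi> \<omega>) / F r) \<longlongrightarrow> a) at_top"
  defines "q \<equiv> left_quantile (distr M borel \<xi>)"
  shows "filterlim q at_top (at_left 1)"
    and "((\<lambda>p. \<P>(\<omega> in M. q p < \<xi> \<omega>) / (1 - p)) \<longlongrightarrow> 1) (at_left 1)"
proof -
  interpret prob_space M by fact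
  let ?\<mu> = "distr M borel \<xi>"
  interpret D: real_distribution ?\<mu> by simp
  let ?G = "\<lambda>x. \<P>(\<omega> in M. x < \<xi> \<omega>)"
  have cdf: "cdf ?\<mu> x = 1 - ?G x" for x
  proof -
    have "cdf ?\<mu> x = \<P>(\<omega> in M. \<xi> \<omega> \<le> x)"
      by (simp add: cdf_def measure_distr vimage_def Int_def conj_commute)
    also have "\<dots> = 1 - \<P>(\<omega> in M. \<not> \<xi> \<omega> \<le> x)"
      using prob_neg[of "\<lambda>\<omega>. \<xi> \<omega> \<le> x"] by simp
    finally show ?thesis by (simp add: not_le)
  qed
  have Gpos: "0 < ?G x" for x
  proof -
    have "\<forall>\<^sub>F r in at_top. 0 < ?G r / F r" using order_tendstoD(1)[OF tail a] .
    then have "\<forall>\<^sub>F r in at_top. 0 < ?G r \<and> x \<le> r"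
      using eventually_ge_at_top[of x] by eventually_elim (use pos in \<open>auto simp: zero_less_divide_iff\<close>)
    then obtain r where r: "0 < ?G r" "x \<le> r" by (auto simp: eventually_at_top_linorder)
    have "?G r \<le> ?G x" using r by (intro finite_measure_mono) auto
    with r show ?thesis by simp
  qed
  have below: "cdf ?\<mu> x < p" if "0 < p" "x < q p" for x p
    using D.cdf_less_left_quantile that by (simp add: q_def)
  have at: "p \<le> cdf ?\<mu> (q p)" if "0 < p" "p < 1" for p
    using D.le_cdf_left_quantile that by (simp add: q_def)
  have p01: "\<forall>\<^sub>F p in at_left 1. 0 < p \<and> p < (1::real)"
    using eventually_at_left_real[of 0 1] by (auto elim!: eventually_mono)
  show qlim: "filterlim q at_top (at_left 1)"
    unfolding filterlim_at_top
  proof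
    fix b
    have "cdf ?\<mu> b < 1" using Gpos[of b] cdf by simp
    then have "\<forall>\<^sub>F p in at_left 1. cdf ?\<mu> b < p \<and> p < 1"
      using eventually_at_left_real[of "cdf ?\<mu> b" 1] by (auto elim!: eventually_mono)
    with p01 show "\<forall>\<^sub>F p in at_left 1. b \<le> q p"
    proof eventually_elim
      case (elim p)
      then have "cdf ?\<mu> b < cdf ?\<mu> (q p)" using at[of p] by linarith
      then show ?case using D.cdf_nondecreasing[of "q p" b] by linarith
    qed
  qed
  show "((\<lambda>p. ?G (q p) / (1 - p)) \<longlongrightarrow> 1) (at_left 1)"
  proof (rule order_tendstoI)
    fix b :: real assume "1 < b"
    from p01 show "\<forall>\<^sub>F p in at_left 1. ?G (q p) / (1 - p) < b"
    proof eventually_elim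
      case (elim p)
      have "?G (q p) / (1 - p) \<le> 1" using at[of p] cdf[of "q p"] elim by (simp add: field_simps)
      with \<open>1 < b\<close> show ?case by simp
    qed
  next
    fix b :: real assume "b < 1"
    \<comment> \<open>1 - d is the midpoint of 1 and max b 0, hence above b; the maximum with 0
      keeps d below 1 for negative b.\<close>
    define d where "d = (1 - max b 0) / 2"
    have d: "0 < d" "d < 1" "b < 1 - d" using \<open>b < 1\<close> by (auto simp: d_def field_simps max_def)
    have "((\<lambda>p. (?G (1 * q p) / F (q p)) / (?G ((1 - d) * q p) / F (q p))) \<longlongrightarrow> (a / 1) / (a / (1 - d))) (at_left 1)"
      using d a by (intro tendsto_divide filterlim_compose[OF tail_scaled[OF tail] qlim]) auto
    then have "((\<lambda>p. ?G (q p) / ?G ((1 - d) * q p)) \<longlongrightarrow> 1 - d) (at_left 1)"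
      using a pos by (simp add: less_imp_neq[symmetric])
    then have "\<forall>\<^sub>F p in at_left 1. b < ?G (q p) / ?G ((1 - d) * q p)"
      by (rule order_tendstoD) (rule d)
    with p01 filterlim_at_top_dense[THEN iffD1, OF qlim, rule_format, of 0]
    show "\<forall>\<^sub>F p in at_left 1. b < ?G (q p) / (1 - p)"
    proof eventually_elim
      case (elim p)
      have "(1 - d) * q p < q p" using elim d by (simp add: algebra_simps)
      then have "1 - p < ?G ((1 - d) * q p)" using below[of p "(1 - d) * q p"] cdf elim by simp
      then have "?G (q p) / ?G ((1 - d) * q p) \<le> ?G (q p) / (1 - p)"
        using elim by (intro divide_left_mono) (auto simp: Gpos)
      with elim show ?case by simp
    qed
  qed
qed

text \<open>Both quantiles have exceedance probability asymptotic to 1 - p, so the quantile of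
  \<open>\<eta>\<close> is asymptotic to c times that of \<open>\<xi>\<close>, and the joint event
  is controlled by \<open>joint\<close> along the single scale given by the quantile of
  \<open>\<xi>\<close>.\<close>

lemma has_tail_dependenceI:
  assumes M: "prob_space M" and [measurable]: "\<xi> \<in> borel_measurable M" "\<eta> \<in> borel_measurable M"
    and a: "0 < a" and c: "0 < c"
    and tail\<xi>: "((\<lambda>r. \<P>(\<omega> in M. r < \<xi> \<omega>) / F r) \<longlongrightarrow> a) at_top"
    and tail\<eta>: "((\<lambda>r. \<P>(\<omega> in M. r < \<eta> \<omega>) / F r) \<longlongrightarrow> c * a) at_top"
    and joint: "((\<lambda>r. \<P>(\<omega> in M. r < \<xi> \<omega> \<and> c * r < \<eta> \<omega>) / F r) \<longlongrightarrow> l) at_top"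
  shows "has_tail_dependence M \<xi> \<eta> (l / a)"
proof -
  interpret prob_space M by fact
  define s where "s = left_quantile (distr M borel \<xi>)"
  define r where "r p = left_quantile (distr M borel \<eta>) p" for p
  let ?G = "\<lambda>x. \<P>(\<omega> in M. x < \<xi> \<omega>)" and ?H = "\<lambda>x. \<P>(\<omega> in M. x < \<eta> \<omega>)"
  let ?L = "at_left (1::real)"
  let ?J = "\<lambda>x. \<P>(\<omega> in M. x < \<xi> \<omega> \<and> c * x < \<eta> \<omega>)"
  note F0 = less_imp_neq[OF pos, symmetric]
  have ca: "0 < c * a" using a c by simp
  have s: "filterlim s at_top ?L" "((\<lambda>p. ?G (s p) / (1 - p)) \<longlongrightarrow> 1) ?L"
    unfolding s_def by (rule left_quantile_tail[OF M _ a tail\<xi>], simp)+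
  have r: "filterlim r at_top ?L" "((\<lambda>p. ?H (r p) / (1 - p)) \<longlongrightarrow> 1) ?L"
    unfolding r_def by (rule left_quantile_tail[OF M _ ca tail\<eta>], simp)+
  have HG: "((\<lambda>p. ?H (r p) / ?G (s p)) \<longlongrightarrow> 1) ?L"
  proof -
    have "((\<lambda>p. (?H (r p) / (1 - p)) / (?G (s p) / (1 - p))) \<longlongrightarrow> 1 / 1) ?L"
      by (intro tendsto_divide s r) simp
    then have "((\<lambda>p. (?H (r p) / (1 - p)) / (?G (s p) / (1 - p))) \<longlongrightarrow> 1) ?L" by simp
    moreover have "\<forall>\<^sub>F p in ?L. (?H (r p) / (1 - p)) / (?G (s p) / (1 - p)) = ?H (r p) / ?G (s p)"
      using eventually_at_left_real[of 0 "1::real", OF zero_less_one] by eventually_elim simp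
    ultimately show ?thesis by (rule Lim_transform_eventually)
  qed
  have GF: "((\<lambda>p. ?G (s p) / F (s p)) \<longlongrightarrow> a) ?L" by (rule filterlim_compose[OF tail\<xi> s(1)])
  have HF: "((\<lambda>p. ?H (r p) / F (s p)) \<longlongrightarrow> a) ?L"
  proof -
    have "((\<lambda>p. (?H (r p) / ?G (s p)) * (?G (s p) / F (s p))) \<longlongrightarrow> 1 * a) ?L"
      by (intro tendsto_mult HG GF)
    then have "((\<lambda>p. (?H (r p) / ?G (s p)) * (?G (s p) / F (s p))) \<longlongrightarrow> a) ?L" by simp
    moreover have "\<forall>\<^sub>F p in ?L. (?H (r p) / ?G (s p)) * (?G (s p) / F (s p)) = ?H (r p) / F (s p)"
      using order_tendstoD(1)[OF GF a] by eventually_elim auto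
    ultimately show ?thesis by (rule Lim_transform_eventually)
  qed
  have rc: "filterlim (\<lambda>p. r p / c) at_top ?L"
    using filterlim_tendsto_pos_mult_at_top[OF tendsto_const[of "1 / c"] _ r(1)] c by simp
  \<comment> \<open>Written at c (r p / c), the tail of \<open>\<eta>\<close> is asymptotic to a F(r
    p / c). Comparison with \<open>HF\<close> then puts r p / c and s p on the same scale.\<close>
  have HF': "((\<lambda>p. ?H (c * (r p / c)) / F (r p / c)) \<longlongrightarrow> c * a / c) ?L"
    by (rule filterlim_compose[OF tail_scaled[OF tail\<eta> c] rc])
  have "((\<lambda>p. (?H (r p) / F (s p)) / (?H (c * (r p / c)) / F (r p / c))) \<longlongrightarrow> a / (c * a / c)) ?L"
    by (intro tendsto_divide HF HF') (use a c in auto)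
  then have "((\<lambda>p. (?H (r p) / F (s p)) / (?H (c * (r p / c)) / F (r p / c))) \<longlongrightarrow> 1) ?L"
    using a c by simp
  moreover have "\<forall>\<^sub>F p in ?L. (?H (r p) / F (s p)) / (?H (c * (r p / c)) / F (r p / c)) = F (r p / c) / F (s p)"
    using order_tendstoD(1)[OF HF a] by eventually_elim (use c in auto)
  ultimately have FF: "((\<lambda>p. F (r p / c) / F (s p)) \<longlongrightarrow> 1) ?L" by (rule Lim_transform_eventually)
  have J0: "0 \<le> l"
    by (rule tendsto_lowerbound[OF joint]) (auto simp: less_imp_le[OF pos])
  have Jd: "((\<lambda>p. (?J (k * s p) / F (s p)) / (?H (r p) / F (s p))) \<longlongrightarrow> l / k / a) ?L" if "0 < k" for k
    by (intro tendsto_divide HF filterlim_compose[OF tail_scaled[OF joint] s(1)]) (use a that in auto)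
  have Jd: "((\<lambda>p. ?J (k * s p) / ?H (r p)) \<longlongrightarrow> l / k / a) ?L" if "0 < k" for k
    using Jd[OF that] by (simp add: F0)
  let ?C = "\<lambda>p. \<P>(\<omega> in M. s p < \<xi> \<omega> \<and> r p < \<eta> \<omega>) / ?H (r p)"
  \<comment> \<open>Since r p lies between c (1 - d) s p and c (1 + d) s p, the event with two
    different thresholds is squeezed between joint events at the scales (1 + d) s p and (1 - d) s
    p.\<close>
  have bounds: "\<forall>\<^sub>F p in ?L. ?J ((1 + d) * s p) / ?H (r p) \<le> ?C p \<and> ?C p \<le> ?J ((1 - d) * s p) / ?H (r p)"
    if d: "0 < d" "d < 1" for d
    using scale_comparison[OF s(1) FF d] filterlim_at_top_dense[THEN iffD1, OF s(1), rule_format, of 0]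
  proof eventually_elim
    case (elim p)
    have 1: "(1 - d) * s p < s p" "s p < (1 + d) * s p" using elim d by (auto simp: algebra_simps)
    have 2: "c * ((1 - d) * s p) < r p" "r p < c * ((1 + d) * s p)" using elim c by (auto simp: field_simps)
    show ?case
      by (intro conjI divide_right_mono finite_measure_mono) (use 1 2 in auto)
  qed
  have "(?C \<longlongrightarrow> l / a) ?L"
  proof (rule order_tendstoI)
    fix b assume b: "b < l / a"
    have "((\<lambda>d. l / (1 + d) / a) \<longlongrightarrow> l / (1 + 0) / a) (at_right 0)" by (intro tendsto_intros) (use a in auto)
    then have "\<forall>\<^sub>F d in at_right 0. b < l / (1 + d) / a" by (rule order_tendstoD) (use b in simp)
    moreover have "\<forall>\<^sub>F d in at_right 0. d \<in> {0<..<1::real}" by (rule eventually_at_right_real) simp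
    ultimately have "\<forall>\<^sub>F d in at_right 0. d \<in> {0<..<1} \<and> b < l / (1 + d) / a" by eventually_elim auto
    then obtain d where d: "0 < d" "d < 1" "b < l / (1 + d) / a"
      by (auto dest!: eventually_happens simp: trivial_limit_at_right_real)
    have "\<forall>\<^sub>F p in ?L. b < ?J ((1 + d) * s p) / ?H (r p)"
      by (rule order_tendstoD(1)[OF Jd]) (use d in auto)
    with bounds[OF d(1,2)] show "\<forall>\<^sub>F p in ?L. b < ?C p" by eventually_elim auto
  next
    fix b assume b: "l / a < b"
    have "((\<lambda>d. l / (1 - d) / a) \<longlongrightarrow> l / (1 - 0) / a) (at_right 0)" by (intro tendsto_intros) (use a in auto)
    then have "\<forall>\<^sub>F d in at_right 0. l / (1 - d) / a < b" by (rule order_tendstoD) (use b in simp)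
    moreover have "\<forall>\<^sub>F d in at_right 0. d \<in> {0<..<1::real}" by (rule eventually_at_right_real) simp
    ultimately have "\<forall>\<^sub>F d in at_right 0. d \<in> {0<..<1} \<and> l / (1 - d) / a < b" by eventually_elim auto
    then obtain d where d: "0 < d" "d < 1" "l / (1 - d) / a < b"
      by (auto dest!: eventually_happens simp: trivial_limit_at_right_real)
    have "\<forall>\<^sub>F p in ?L. ?J ((1 - d) * s p) / ?H (r p) < b"
      by (rule order_tendstoD(2)[OF Jd]) (use d in auto)
    with bounds[OF d(1,2)] show "\<forall>\<^sub>F p in ?L. ?C p < b" by eventually_elim auto
  qed
  then show ?thesis
    by (simp add: has_tail_dependence_def cond_prob_def s_def r_def)
qed

end


section \<open>The l1 geometry\<close>

lemma l1norm_nonneg: "0 \<le> l1norm x"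
  by (simp add: l1norm_def sum_nonneg)

lemma l1norm_eq_0_iff: "l1norm x = 0 \<longleftrightarrow> x = 0"
  by (simp add: l1norm_def sum_nonneg_eq_0_iff vec_eq_iff)

lemma l1norm_scaleR: "l1norm (r *\<^sub>R x) = \<bar>r\<bar> * l1norm x"
  by (simp add: l1norm_def abs_mult sum_distrib_left)

lemma continuous_on_l1norm [continuous_intros]:
  "continuous_on A f \<Longrightarrow> continuous_on A (\<lambda>x. l1norm (f x))"
  unfolding l1norm_def by (intro continuous_intros)

lemma borel_measurable_l1norm [measurable]: "l1norm \<in> borel_measurable borel"
  by (intro borel_measurable_continuous_onI continuous_intros)

lemma compact_l1sphere: "compact (l1sphere :: (real ^ 'd) set)"
  unfolding compact_eq_bounded_closed
proof
  have "norm x \<le> 1" if "x \<in> l1sphere" for x :: "real ^ 'd"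
    using norm_le_l1_cart[of x] that by (simp add: l1sphere_def l1norm_def)
  then show "bounded (l1sphere :: (real ^ 'd) set)" by (auto intro: boundedI)
  show "closed (l1sphere :: (real ^ 'd) set)"
    unfolding l1sphere_def by (intro closed_Collect_eq continuous_intros)
qed

lemma sets_l1sphere [measurable]: "(l1sphere :: (real ^ 'd) set) \<in> sets borel"
  by (intro borel_closed compact_imp_closed compact_l1sphere)

lemma l1dir_in_l1sphere: "(l1dir x :: real ^ 'd) \<in> l1sphere"
proof (cases "x = 0")
  case True
  have "axis undefined 1 \<in> (l1sphere :: (real ^ 'd) set)"
    by (simp add: l1sphere_def l1norm_def axis_def if_distrib[of abs] cong: if_cong)
  with True show ?thesis by (auto simp: l1dir_def intro: someI)
next
  case False
  then show ?thesis
    by (simp add: l1dir_def l1sphere_def l1norm_scaleR l1norm_nonneg l1norm_eq_0_iff)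
qed

lemma l1dir_l1sphere: "x \<in> l1sphere \<Longrightarrow> l1dir x = x"
  by (auto simp: l1dir_def l1sphere_def l1norm_def)

lemma scaleR_l1norm_l1dir: "l1norm x *\<^sub>R l1dir x = x"
  using l1norm_eq_0_iff[of x] by (auto simp: l1dir_def l1norm_def)

lemma borel_measurable_l1dir [measurable]: "(l1dir :: real ^ 'd \<Rightarrow> real ^ 'd) \<in> borel_measurable borel"
  unfolding l1dir_def[abs_def] by measurable

lemma borel_measurable_fst_snd [measurable]:
  "fst \<in> (borel :: ('a::second_countable_topology \<times> 'b::second_countable_topology) measure) \<rightarrow>\<^sub>M borel"
  "snd \<in> (borel :: ('a \<times> 'b) measure) \<rightarrow>\<^sub>M borel"
  by (auto intro!: borel_measurable_continuous_onI continuous_intros)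

lemma borel_measurable_tau [measurable]: "tau \<in> borel_measurable borel"
  unfolding tau_def[abs_def] by measurable

lemma borel_measurable_polar [measurable]: "polar \<in> borel \<rightarrow>\<^sub>M borel"
  unfolding polar_def[abs_def] by measurable

lemma polar_mem:
  assumes "0 \<le> fst z"
  shows "polar z \<in> {0..1} \<times> l1sphere"
  using assms l1norm_nonneg[of "snd z"]
  by (auto simp: polar_def tau_def l1dir_in_l1sphere divide_le_eq_1)

definition cont_homogeneous :: "(real ^ 'd \<Rightarrow> real) \<Rightarrow> bool" where
  "cont_homogeneous g \<longleftrightarrow> continuous_on UNIV g \<and> (\<forall>x. 0 \<le> g x) \<and> (\<forall>r>0. \<forall>x. g (r *\<^sub>R x) = r * g x)"

text \<open>At the origin g 0 = 2 g 0 forces g 0 = 0, so the arbitrary direction assigned to 0 is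
  harmless.\<close>

lemma cont_homogeneous_polar:
  assumes "cont_homogeneous g"
  shows "g x = l1norm x * g (l1dir x)"
proof (cases "x = 0")
  case True
  have "g (2 *\<^sub>R 0) = 2 * g 0" using assms unfolding cont_homogeneous_def by (metis zero_less_numeral)
  with True show ?thesis by (simp add: l1norm_def)
next
  case False
  then have "0 < l1norm x" using l1norm_nonneg[of x] l1norm_eq_0_iff[of x] by linarith
  then show ?thesis
    using assms scaleR_l1norm_l1dir[of x] unfolding cont_homogeneous_def by metis
qed

lemma cont_homogeneous_measurable: "cont_homogeneous g \<Longrightarrow> g \<in> borel_measurable borel"
  by (auto simp: cont_homogeneous_def intro: borel_measurable_continuous_onI)

lemma cont_homogeneous_bounded:
  fixes g :: "real ^ 'd \<Rightarrow> real"
  assumes "cont_homogeneous g"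
  obtains K where "0 < K" "\<And>\<theta>. \<theta> \<in> l1sphere \<Longrightarrow> g \<theta> \<le> K"
proof -
  have "compact (g ` l1sphere)"
    using assms by (auto simp: cont_homogeneous_def intro!: compact_continuous_image compact_l1sphere
        elim: continuous_on_subset)
  then obtain K where "\<And>y. y \<in> g ` l1sphere \<Longrightarrow> \<bar>y\<bar> \<le> K"
    using compact_imp_bounded by (force simp: bounded_iff)
  then show ?thesis by (intro that[of "max K 1"]) (auto simp: le_max_iff_disj abs_le_iff)
qed

text \<open>A real supremum dominates its members only when the family is bounded; here every
  difference of probabilities is at most 1.\<close>

lemma tv_norm_diff_ge:
  assumes "prob_space \<mu>" "prob_space \<nu>" "B \<in> sets \<mu>"
  shows "\<bar>measure \<mu> B - measure \<nu> B\<bar> \<le> tv_norm_diff \<mu> \<nu>"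
proof -
  interpret \<mu>: prob_space \<mu> by fact
  interpret \<nu>: prob_space \<nu> by fact
  have "\<bar>measure \<mu> A - measure \<nu> A\<bar> \<le> 1" for A
    using \<mu>.prob_le_1[of A] \<nu>.prob_le_1[of A] measure_nonneg[of \<mu> A] measure_nonneg[of \<nu> A]
    by linarith
  then show ?thesis unfolding tv_norm_diff_def
    by (intro cSUP_upper assms bdd_aboveI2[where M=1])
qed


section \<open>The regular variation model\<close>

locale rv_model = prob_space M for M :: "'w measure" +
  fixes Y :: "'w \<Rightarrow> real" and X :: "'w \<Rightarrow> real ^ 'd" and P :: "(real \<times> (real ^ 'd)) measure"
    and f :: "real \<Rightarrow> real ^ 'd \<Rightarrow> real"
  assumes YX [measurable]: "Y \<in> borel_measurable M" "X \<in> borel_measurable M"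
    and Y_nonneg: "\<omega> \<in> space M \<Longrightarrow> 0 \<le> Y \<omega>"
    and rv: "jointly_regularly_varying M (\<lambda>\<omega>. (Y \<omega>, X \<omega>)) P"
    and assm_A: "assumption_A M (\<lambda>\<omega>. (Y \<omega>, X \<omega>)) P f"
begin

abbreviation "R \<omega> \<equiv> tau (Y \<omega>, X \<omega>)"
abbreviation "V \<omega> \<equiv> polar (Y \<omega>, X \<omega>)"
abbreviation "F r \<equiv> \<P>(\<omega> in M. r < R \<omega>)"
abbreviation "P_exc r \<equiv> cond_exceed M (\<lambda>\<omega>. (Y \<omega>, X \<omega>)) polar r"
definition "EU = (\<integral>(u, \<theta>). u \<partial>P)"

lemma R_nonneg: "\<omega> \<in> space M \<Longrightarrow> 0 \<le> R \<omega>"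
  using l1norm_nonneg[of "X \<omega>"] Y_nonneg[of \<omega>] by (simp add: tau_def)

lemma R_measurable [measurable]: "R \<in> borel_measurable M"
  by measurable

lemma V_measurable [measurable]: "V \<in> M \<rightarrow>\<^sub>M borel"
  by measurable

lemma V_mem: "\<omega> \<in> space M \<Longrightarrow> V \<omega> \<in> {0..1} \<times> l1sphere"
  by (rule polar_mem) (simp add: Y_nonneg)

text \<open>If R vanishes then so does Y, as both summands of R are nonnegative; the value given to
  the quotient by division by zero is thus irrelevant.\<close>

lemma R_fst_V: "\<omega> \<in> space M \<Longrightarrow> R \<omega> * fst (V \<omega>) = Y \<omega>"
  using l1norm_nonneg[of "X \<omega>"] Y_nonneg[of \<omega>] by (auto simp: polar_def tau_def)

text \<open>R (1 - U) is the norm of X, and homogeneity turns norm times value in the direction into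
  g(X), also when X = 0.\<close>

lemma R_snd_V: "\<omega> \<in> space M \<Longrightarrow> cont_homogeneous g \<Longrightarrow> R \<omega> * ((1 - fst (V \<omega>)) * g (snd (V \<omega>))) = g (X \<omega>)"
proof -
  assume \<omega>: "\<omega> \<in> space M" and g: "cont_homogeneous g"
  have "R \<omega> * (1 - fst (V \<omega>)) = l1norm (X \<omega>)"
    using R_fst_V[OF \<omega>] by (simp add: right_diff_distrib) (simp add: tau_def)
  moreover have "snd (V \<omega>) = l1dir (X \<omega>)" by (simp add: polar_def)
  ultimately show ?thesis
    using cont_homogeneous_polar[OF g, of "X \<omega>"] by (simp add: mult.assoc[symmetric])
qed

lemma F_tail: "pareto_tail F"
proof -
  obtain a :: "nat \<Rightarrow> real" where "\<And>n. 0 < a n"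
    "\<And>s. 0 < s \<Longrightarrow> (\<lambda>n. real n * F (s * a n)) \<longlonglongrightarrow> 1 / s"
    using rv unfolding jointly_regularly_varying_def by auto
  then show ?thesis
    by (intro pareto_tailI[of F a]) (auto intro!: finite_measure_mono)
qed

sublocale F: pareto_tail F by (rule F_tail)

lemma P_prob: "prob_space P" and P_sets [measurable_cong]: "sets P = sets borel"
  and P_AE: "AE z in P. fst z \<in> {0..1} \<and> snd z \<in> l1sphere"
  using rv unfolding jointly_regularly_varying_def by (auto simp: case_prod_beta')

sublocale P: prob_space P by (rule P_prob)

lemma P_space [simp]: "space P = UNIV"
  using sets_eq_imp_space_eq[OF P_sets] by simp

lemma P_prob_UNIV [simp]: "measure P UNIV = 1"
  using P.prob_space by simp

lemma integrable_fst_P: "integrable P fst"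
  using P_AE by (intro P.integrable_const_bound[where B=1]) auto

lemma EU_pos: "0 < EU"
proof -
  have "0 \<le> EU" unfolding EU_def case_prod_beta' by (rule integral_nonneg_AE) (use P_AE in auto)
  moreover have "EU \<noteq> 0"
  proof
    assume "EU = 0"
    then have "AE z in P. fst z = 0"
      using integral_nonneg_eq_0_iff_AE[OF integrable_fst_P] P_AE
      by (auto simp: EU_def case_prod_beta' elim: AE_mp)
    then have "\<P>(z in P. fst z = 0) = 1" by (subst P.prob_Collect_eq_1) auto
    then show False using rv unfolding jointly_regularly_varying_def by (simp add: case_prod_beta')
  qed
  ultimately show ?thesis by simp
qed

lemma P_exc_measure:
  assumes [measurable]: "B \<in> sets borel"
  shows "measure (P_exc r) B = \<P>(\<omega> in M. r < R \<omega> \<and> V \<omega> \<in> B) / F r"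
proof -
  have "measure (P_exc r) B = measure (uniform_measure M {\<omega> \<in> space M. r < R \<omega>}) (V -` B \<inter> space M)"
    unfolding cond_exceed_def by (subst measure_distr) auto
  also have "\<dots> = \<P>(\<omega> in M. r < R \<omega> \<and> V \<omega> \<in> B) / F r"
    using F.pos[of r]
    by (subst measure_uniform_measure) (auto simp: emeasure_eq_measure intro!: arg_cong2[where f="(/)"] arg_cong[where f=prob])
  finally show ?thesis .
qed

lemma P_exc_sets [simp, measurable_cong]: "sets (P_exc r) = sets borel"
  by (simp add: cond_exceed_def)

lemma P_exc_prob: "prob_space (P_exc r)"
  unfolding cond_exceed_def
  by (intro prob_space.prob_space_distr prob_space_uniform_measure)
    (use F.pos[of r] in \<open>auto simp: emeasure_eq_measure\<close>)

lemma tv_lim: "((\<lambda>r. tv_norm_diff (P_exc r) P) \<longlongrightarrow> 0) at_top"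
  using assm_A by (simp add: assumption_A_def)

lemma tv_ge: "B \<in> sets borel \<Longrightarrow> \<bar>measure (P_exc r) B - measure P B\<bar> \<le> tv_norm_diff (P_exc r) P"
  by (intro tv_norm_diff_ge P_exc_prob P_prob) simp

lemma polar_conv:
  assumes B: "B \<in> sets borel"
  shows "((\<lambda>r. \<P>(\<omega> in M. r < R \<omega> \<and> V \<omega> \<in> B) / F r) \<longlongrightarrow> measure P B) at_top"
proof -
  have "((\<lambda>r. measure (P_exc r) B - measure P B) \<longlongrightarrow> 0) at_top"
    by (rule tendsto_0_le[OF tv_lim, where K=1]) (auto intro!: always_eventually intro: order_trans[OF tv_ge[OF B] abs_ge_self])
  then show ?thesis unfolding P_exc_measure[OF B] by (rule LIM_zero_cancel)
qed

section \<open>Tails of Y, of g(X) and of both jointly\<close>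

lemma tail_of_polar:
  assumes [measurable]: "\<psi> \<in> borel_measurable borel"
    and bnd: "\<And>z. z \<in> {0..1} \<times> l1sphere \<Longrightarrow> 0 \<le> \<psi> z \<and> \<psi> z \<le> K"
  shows "((\<lambda>t. \<P>(\<omega> in M. t < R \<omega> * \<psi> (V \<omega>)) / F t) \<longlongrightarrow> (\<integral>z. \<psi> z \<partial>P)) at_top"
  by (rule F.tail_of_product[where N=borel and K=K])
    (use P_AE bnd V_mem in \<open>auto simp: R_nonneg polar_conv prob_space_axioms P_prob P_sets mem_Times_iff
      intro!: bnd\<close>)

lemma tail_Y: "((\<lambda>t. \<P>(\<omega> in M. t < Y \<omega>) / F t) \<longlongrightarrow> EU) at_top"
proof -
  have "((\<lambda>t. \<P>(\<omega> in M. t < R \<omega> * fst (V \<omega>)) / F t) \<longlongrightarrow> (\<integral>z. fst z \<partial>P)) at_top"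
    by (rule tail_of_polar[where K=1]) auto
  then show ?thesis by (simp add: R_fst_V EU_def case_prod_beta' cong: conj_cong)
qed

lemma tail_g:
  assumes g: "cont_homogeneous g"
  shows "((\<lambda>t. \<P>(\<omega> in M. t < g (X \<omega>)) / F t) \<longlongrightarrow> C_fun P g) at_top"
proof -
  note [measurable] = cont_homogeneous_measurable[OF g]
  obtain K where K: "0 < K" "\<And>\<theta>. \<theta> \<in> l1sphere \<Longrightarrow> g \<theta> \<le> K" using cont_homogeneous_bounded[OF g] by blast
  have "((\<lambda>t. \<P>(\<omega> in M. t < R \<omega> * ((1 - fst (V \<omega>)) * g (snd (V \<omega>)))) / F t)
      \<longlongrightarrow> (\<integral>z. (1 - fst z) * g (snd z) \<partial>P)) at_top"
  proof (rule tail_of_polar[where K="1 * K" and \<psi>="\<lambda>z. (1 - fst z) * g (snd z)"])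
    fix z :: "real \<times> (real ^ 'd)" assume z: "z \<in> {0..1} \<times> l1sphere"
    then have "0 \<le> g (snd z)" using g by (simp add: cont_homogeneous_def)
    moreover have "(1 - fst z) * g (snd z) \<le> 1 * K"
      using z K by (intro mult_mono) (auto simp: calculation)
    ultimately show "0 \<le> (1 - fst z) * g (snd z) \<and> (1 - fst z) * g (snd z) \<le> 1 * K"
      using z by auto
  qed measurable
  then show ?thesis by (simp add: R_snd_V[OF _ g] C_fun_def case_prod_beta' cong: conj_cong)
qed

lemma tail_joint:
  assumes g: "cont_homogeneous g" and c: "0 < c"
  shows "((\<lambda>t. \<P>(\<omega> in M. t < Y \<omega> \<and> c * t < g (X \<omega>)) / F t)
      \<longlongrightarrow> EU * Lambda_fun P (\<lambda>x. g x / c)) at_top"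
proof -
  note [measurable] = cont_homogeneous_measurable[OF g]
  let ?\<psi> = "\<lambda>z. min (fst z) ((1 - fst z) * (g (snd z) / c))"
  have "((\<lambda>t. \<P>(\<omega> in M. t < R \<omega> * ?\<psi> (V \<omega>)) / F t) \<longlongrightarrow> (\<integral>z. ?\<psi> z \<partial>P)) at_top"
    by (rule tail_of_polar[where K=1 and \<psi>="?\<psi>"])
      (use g c in \<open>auto simp: cont_homogeneous_def intro: min.coboundedI1\<close>)
  moreover have "t < R \<omega> * ?\<psi> (V \<omega>) \<longleftrightarrow> t < Y \<omega> \<and> c * t < g (X \<omega>)" if \<omega>: "\<omega> \<in> space M" for t \<omega>
  proof -
    have "R \<omega> * ?\<psi> (V \<omega>) = min (Y \<omega>) (g (X \<omega>) / c)"
      using R_snd_V[OF \<omega> g] R_fst_V[OF \<omega>] by (simp add: min_mult_distrib_left R_nonneg[OF \<omega>])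
    then show ?thesis using c by (auto simp: field_simps)
  qed
  moreover have "(\<integral>z. ?\<psi> z \<partial>P) = EU * Lambda_fun P (\<lambda>x. g x / c)"
    using EU_pos by (simp add: Lambda_fun_def EU_def case_prod_beta')
  ultimately show ?thesis by (simp cong: conj_cong)
qed

lemma tail_ratio_lim:
  assumes g: "cont_homogeneous g"
  shows "(tail_ratio M Y X g \<longlongrightarrow> C_fun P g / EU) at_top"
proof -
  have "((\<lambda>t. (\<P>(\<omega> in M. t < g (X \<omega>)) / F t) / (\<P>(\<omega> in M. t < Y \<omega>) / F t)) \<longlongrightarrow> C_fun P g / EU) at_top"
    by (intro tendsto_divide tail_g g tail_Y) (use EU_pos in simp)
  moreover have "F t \<noteq> 0" for t using F.pos[of t] by simp
  ultimately show ?thesis by (simp add: tail_ratio_def[abs_def])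
qed

text \<open>\<open>Lim\<close> has a meaning only through an existing limit, which
  \<open>tail_ratio_lim\<close> supplies.\<close>

lemma tail_scale_eq: "cont_homogeneous g \<Longrightarrow> tail_scale M Y X g = C_fun P g / EU"
  unfolding tail_scale_def by (intro tendsto_Lim tail_ratio_lim) auto

lemma tail_dependence:
  assumes g: "cont_homogeneous g" and c: "c = tail_scale M Y X g" "0 < c"
  shows "has_tail_dependence M Y (\<lambda>\<omega>. g (X \<omega>)) (Lambda_fun P (\<lambda>x. g x / c))"
    and "((\<lambda>s. \<P>(\<omega> in M. c * s < g (X \<omega>) \<bar> s < Y \<omega>)) \<longlongrightarrow> Lambda_fun P (\<lambda>x. g x / c)) at_top"
proof -
  note [measurable] = cont_homogeneous_measurable[OF g]
  \<comment> \<open>This puts the tail constant of g(X) into the form c * a, with a =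
    \<open>EU\<close>, that \<open>has_tail_dependenceI\<close> expects.\<close>
  have C: "C_fun P g = c * EU" using c tail_scale_eq[OF g] EU_pos by simp
  have "has_tail_dependence M Y (\<lambda>\<omega>. g (X \<omega>)) (EU * Lambda_fun P (\<lambda>x. g x / c) / EU)"
    by (rule F.has_tail_dependenceI[OF prob_space_axioms _ _ EU_pos c(2) tail_Y _ tail_joint[OF g c(2)]])
      (use tail_g[OF g] C in auto)
  then show "has_tail_dependence M Y (\<lambda>\<omega>. g (X \<omega>)) (Lambda_fun P (\<lambda>x. g x / c))"
    using EU_pos by simp
  have "((\<lambda>t. (\<P>(\<omega> in M. t < Y \<omega> \<and> c * t < g (X \<omega>)) / F t) / (\<P>(\<omega> in M. t < Y \<omega>) / F t))
      \<longlongrightarrow> EU * Lambda_fun P (\<lambda>x. g x / c) / EU) at_top"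
    by (intro tendsto_divide tail_joint g c tail_Y) (use EU_pos in simp)
  moreover have "F t \<noteq> 0" for t using F.pos[of t] by simp
  ultimately show "((\<lambda>s. \<P>(\<omega> in M. c * s < g (X \<omega>) \<bar> s < Y \<omega>)) \<longlongrightarrow> Lambda_fun P (\<lambda>x. g x / c)) at_top"
    using EU_pos by (simp add: cond_prob_def conj_commute)
qed

end


section \<open>Optimality of the quantile predictor\<close>

text \<open>A law with a density has no atoms, so its cdf takes exactly the value \<alpha> at the
  quantile. Concentration on [0, 1] makes the cdf 0 at 0 and 1 at 1, which places q strictly inside.
  The last claim is stated for the unnormalised density and as a nonnegative integral, ready to be
  integrated over directions.\<close>

lemma left_quantile_density:
  fixes h :: "real \<Rightarrow> real"
  assumes h[measurable]: "h \<in> borel_measurable borel" and h0: "\<And>u. u \<in> {0..1} \<Longrightarrow> 0 \<le> h u"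
    and int: "set_integrable lborel {0..1} h" and pos: "0 < (LBINT u:{0..1}. h u)"
    and \<alpha>: "0 < \<alpha>" "\<alpha> < 1"
  defines "q \<equiv> left_quantile (density lborel (\<lambda>u. ennreal (indicator {0..1} u * h u / (LBINT v:{0..1}. h v)))) \<alpha>"
  shows "0 < q" "q < 1"
    and "(\<integral>\<^sup>+u. ennreal (indicator {0..1} u * h u) * indicator {q<..} u \<partial>lborel)
      = ennreal (1 - \<alpha>) * (\<integral>\<^sup>+u. ennreal (indicator {0..1} u * h u) \<partial>lborel)"
proof -
  let ?D = "LBINT v:{0..1}. h v"
  define k where "k u = indicator {0..1} u * h u / ?D" for u
  define \<mu> where "\<mu> = density lborel (\<lambda>u. ennreal (k u))"
  have q: "q = left_quantile \<mu> \<alpha>" by (simp add: q_def \<mu>_def k_def)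
  have [measurable]: "k \<in> borel_measurable borel" unfolding k_def[abs_def] by measurable
  have k0: "0 \<le> k u" for u using h0[of u] pos by (auto simp: k_def indicator_def)
  have hk: "ennreal (indicator {0..1} u * h u) = ennreal ?D * ennreal (k u)" for u
    using k0[of u] pos by (simp add: ennreal_mult[symmetric] k_def)
  have D: "(\<integral>\<^sup>+u. ennreal (indicator {0..1} u * h u) \<partial>lborel) = ennreal ?D"
    using int unfolding set_integrable_def set_lebesgue_integral_def real_scaleR_def
    by (rule nn_integral_eq_integral) (use h0 in \<open>auto simp: indicator_def\<close>)
  then have "ennreal ?D * (\<integral>\<^sup>+u. ennreal (k u) \<partial>lborel) = ennreal ?D * 1"
    unfolding hk by (subst (asm) nn_integral_cmult) auto
  then have tot: "(\<integral>\<^sup>+u. ennreal (k u) \<partial>lborel) = 1"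
    using pos by (subst (asm) ennreal_mult_cancel_left) auto
  interpret \<mu>: prob_space \<mu>
    by (rule prob_spaceI) (simp add: \<mu>_def emeasure_density tot)
  interpret \<mu>: real_distribution \<mu>
    by (simp add: real_distribution_def real_distribution_axioms_def \<mu>.prob_space_axioms) (simp add: \<mu>_def)
  have "isCont (cdf \<mu>) x" for x
  proof -
    have "emeasure \<mu> {x} = 0"
      unfolding \<mu>_def by (subst emeasure_density) (auto simp: nn_integral_0_iff_AE intro!: AE_I[of _ _ "{x}"] split: split_indicator)
    then show ?thesis by (simp add: \<mu>.isCont_cdf measure_def)
  qed
  then have cdfq: "cdf \<mu> q = \<alpha>" unfolding q by (intro \<mu>.cdf_left_quantile \<alpha>)
  have "emeasure \<mu> {..0} = 0"
    unfolding \<mu>_def by (subst emeasure_density)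
      (auto simp: nn_integral_0_iff_AE k_def intro!: AE_I[of _ _ "{0}"] split: split_indicator)
  then have c0: "cdf \<mu> 0 = 0" by (simp add: cdf_def measure_def)
  have "emeasure \<mu> {1<..} = 0"
    unfolding \<mu>_def by (subst emeasure_density)
      (auto simp: nn_integral_0_iff_AE k_def intro!: AE_I2 split: split_indicator)
  moreover have compl: "measure \<mu> {x<..} = 1 - cdf \<mu> x" for x
    using \<mu>.prob_compl[of "{..x}"] by (simp add: cdf_def Compl_eq_Diff_UNIV[symmetric] Compl_atMost)
  ultimately have c1: "cdf \<mu> 1 = 1" using compl[of 1] by (simp add: measure_def)
  show "0 < q" using \<mu>.cdf_nondecreasing[of q 0] c0 cdfq \<alpha> by (auto intro: ccontr simp: not_less)
  show "q < 1" using \<mu>.cdf_nondecreasing[of 1 q] c1 cdfq \<alpha> by (auto intro: ccontr simp: not_less)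
  have "(\<integral>\<^sup>+u. ennreal (k u) * indicator {q<..} u \<partial>lborel) = emeasure \<mu> {q<..}"
    unfolding \<mu>_def by (subst emeasure_density) auto
  also have "\<dots> = ennreal (1 - \<alpha>)" using compl[of q] cdfq by (simp add: \<mu>.emeasure_eq_measure)
  finally show "(\<integral>\<^sup>+u. ennreal (indicator {0..1} u * h u) * indicator {q<..} u \<partial>lborel)
      = ennreal (1 - \<alpha>) * (\<integral>\<^sup>+u. ennreal (indicator {0..1} u * h u) \<partial>lborel)"
    unfolding D unfolding hk mult.assoc by (subst nn_integral_cmult) (auto simp: mult.commute)
qed

locale opt_model = rv_model M Y X P f
  for M :: "'w measure" and Y :: "'w \<Rightarrow> real" and X :: "'w \<Rightarrow> real ^ 'd"
    and P :: "(real \<times> (real ^ 'd)) measure" and f :: "real \<Rightarrow> real ^ 'd \<Rightarrow> real" +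
  fixes S :: "(real ^ 'd) set" and a :: real
  assumes S_compact: "compact S" and S_sub: "S \<subseteq> l1sphere" and S_full: "measure (distr P borel snd) S = 1"
    and S_int: "\<theta> \<in> S \<Longrightarrow> set_integrable lborel {0..1} (\<lambda>u. (1 - u) * f u \<theta>)"
    and S_pos: "\<theta> \<in> S \<Longrightarrow> 0 < (LBINT u:{0..1}. (1 - u) * f u \<theta>)"
    and a: "0 < a" "a < 1"
    and C_opt: "C_fun P (g_opt f a) = (\<integral>(u, \<theta>). u \<partial>P)"
begin

abbreviation "g \<equiv> g_opt f a"

lemma S_sets [measurable]: "S \<in> sets borel"
  using S_compact by (intro borel_closed compact_imp_closed)

lemma P_AE_S: "AE z in P. fst z \<in> {0..1} \<and> snd z \<in> S"
proof -
  have "\<P>(z in P. snd z \<in> S) = 1"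
    using S_full by (subst (asm) measure_distr) (auto simp: vimage_def)
  then have "AE z in P. snd z \<in> S" by (subst (asm) P.prob_Collect_eq_1) auto
  with P_AE show ?thesis by auto
qed

lemma f_measurable: "(\<lambda>(u, \<theta>). f u \<theta>) \<in> borel_measurable (borel \<Otimes>\<^sub>M borel)"
  and f_nonneg: "0 \<le> f u \<theta>"
  and P_density: "P = density (lborel \<Otimes>\<^sub>M distr P borel snd) (\<lambda>(u, \<theta>). ennreal (indicator {0..1} u * f u \<theta>))"
  using assm_A by (auto simp: assumption_A_def)

lemma f_section_measurable: "(\<lambda>u. f u \<theta>) \<in> borel_measurable borel"
  using measurable_compose[OF measurable_Pair2'[of \<theta> borel borel] f_measurable] by simp

lemma q_opt_range:
  assumes "\<theta> \<in> S" "0 < b" "b < 1"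
  shows "0 < q_opt f b \<theta>" "q_opt f b \<theta> < 1"
proof -
  note [measurable] = f_section_measurable
  note * = left_quantile_density[of "\<lambda>u. (1 - u) * f u \<theta>" b, OF _ _ S_int[OF assms(1)] S_pos[OF assms(1)] assms(2,3)]
  show "0 < q_opt f b \<theta>" "q_opt f b \<theta> < 1"
    unfolding q_opt_def by (rule *; simp add: f_nonneg)+
qed

lemma g_opt_eq: "\<theta> \<in> S \<Longrightarrow> g_opt f b \<theta> = q_opt f b \<theta> / (1 - q_opt f b \<theta>)"
  using S_sub l1dir_l1sphere[of \<theta>]
  by (auto simp: g_opt_def ratio_predictor_def l1sphere_def l1norm_def)

lemma g_nonneg: "\<theta> \<in> S \<Longrightarrow> 0 \<le> g \<theta>"
  using q_opt_range[of \<theta> a] a by (simp add: g_opt_eq)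

text \<open>
  Measurability of the optimal predictor is not assumed, but a non-integrable integrand would
  give \<open>C_fun P g = 0\<close>.
\<close>
lemma g_integrable: "integrable P (\<lambda>z. (1 - fst z) * g (snd z))"
  using C_opt EU_pos not_integrable_integral_eq[of P "\<lambda>z. (1 - fst z) * g (snd z)"]
  by (auto simp: C_fun_def EU_def case_prod_beta')

text \<open>An integrable function is measurable; on the section u = 0 the weight 1 - u equals 1 and
  leaves g itself.\<close>

lemma g_measurable [measurable]: "g \<in> borel_measurable borel"
proof -
  have "(\<lambda>z. (1 - fst z) * g (snd z)) \<in> borel_measurable borel"
    using borel_measurable_integrable[OF g_integrable] by simp
  from measurable_compose[OF _ this, of "\<lambda>\<theta>. (0, \<theta>)" borel] show ?thesis by simp
qed

lemma C_opt': "(\<integral>z. (1 - fst z) * g (snd z) \<partial>P) = EU"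
  using C_opt by (simp add: C_fun_def EU_def case_prod_beta')

lemma nn_integral_P:
  assumes [measurable]: "\<phi> \<in> borel_measurable (borel :: (real \<times> (real ^ 'd)) measure)"
  shows "(\<integral>\<^sup>+z. \<phi> z \<partial>P)
    = (\<integral>\<^sup>+\<theta>. (\<integral>\<^sup>+u. ennreal (indicator {0..1} u * f u \<theta>) * \<phi> (u, \<theta>) \<partial>lborel) \<partial>distr P borel snd)"
proof -
  let ?p = "distr P borel snd"
  interpret p: prob_space ?p by (rule P.prob_space_distr) measurable
  interpret lp: pair_sigma_finite lborel ?p ..
  note [measurable] = f_measurable
  have [measurable]: "\<phi> \<in> borel_measurable (borel \<Otimes>\<^sub>M borel)" by (simp add: borel_prod)
  have [measurable]: "(\<lambda>z. ennreal (indicator {0..1} (fst z) * f (fst z) (snd z)))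
      \<in> borel_measurable (borel \<Otimes>\<^sub>M borel)"
    using f_measurable by (simp add: case_prod_beta')
  have "(\<integral>\<^sup>+z. \<phi> z \<partial>P) = (\<integral>\<^sup>+z. ennreal (indicator {0..1} (fst z) * f (fst z) (snd z)) * \<phi> z \<partial>(lborel \<Otimes>\<^sub>M ?p))"
    by (subst P_density, subst nn_integral_density) (simp_all add: case_prod_beta')
  also have "\<dots> = (\<integral>\<^sup>+\<theta>. (\<integral>\<^sup>+u. ennreal (indicator {0..1} u * f u \<theta>) * \<phi> (u, \<theta>) \<partial>lborel) \<partial>?p)"
    by (subst lp.nn_integral_snd[symmetric]) simp_all
  finally show ?thesis .
qed

text \<open>
  Given \<open>\<Theta> = \<theta>\<close>, the slope of \<open>y \<mapsto> E[min U ((1 - U) y)]\<close> at \<open>y = g \<theta>\<close> is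
  \<open>E[(1 - U) 1(U > q \<theta>)]\<close>, which is \<open>1 - a\<close> times \<open>E[1 - U]\<close> as \<open>q \<theta>\<close> is an \<open>a\<close>-quantile.
\<close>
lemma weighted_exceedance:
  assumes h[measurable]: "h \<in> borel_measurable borel" and h0: "\<And>\<theta>. \<theta> \<in> S \<Longrightarrow> 0 \<le> h \<theta>"
    and int: "integrable P (\<lambda>z. (1 - fst z) * h (snd z))"
  shows "(\<integral>z. (1 - fst z) * h (snd z) * indicator {z. (1 - fst z) * g (snd z) < fst z} z \<partial>P)
      = (1 - a) * (\<integral>z. (1 - fst z) * h (snd z) \<partial>P)"
proof -
  let ?A = "{z. (1 - fst z) * g (snd z) < fst z}"
  note [measurable] = f_section_measurable
  have p_S: "AE \<theta> in distr P borel snd. \<theta> \<in> S"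
    by (subst AE_distr_iff) (use P_AE_S in auto)
  have inner: "(\<integral>\<^sup>+u. ennreal (indicator {0..1} u * f u \<theta>) * (ennreal ((1 - u) * h \<theta>) * indicator ?A (u, \<theta>)) \<partial>lborel)
      = ennreal (1 - a) * (\<integral>\<^sup>+u. ennreal (indicator {0..1} u * f u \<theta>) * ennreal ((1 - u) * h \<theta>) \<partial>lborel)"
    if \<theta>: "\<theta> \<in> S" for \<theta>
  proof -
    let ?q = "q_opt f a \<theta>" and ?k = "\<lambda>u. ennreal (indicator {0..1} u * ((1 - u) * f u \<theta>))"
    \<comment> \<open>With g = q / (1 - q), the region where u exceeds (1 - u) g is cut off exactly
      at the quantile q.\<close>
    have "(1 - u) * g \<theta> < u \<longleftrightarrow> ?q < u" for u
    proof -
      have "(1 - u) * g \<theta> < u \<longleftrightarrow> (1 - u) * ?q < u * (1 - ?q)"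
        using q_opt_range[OF \<theta> a] by (simp add: g_opt_eq[OF \<theta>] pos_divide_less_eq)
      then show ?thesis by (simp add: algebra_simps)
    qed
    then have "indicator ?A (u, \<theta>) = (indicator {?q<..} u :: ennreal)" for u
      by (simp add: indicator_def)
    moreover have k: "ennreal (indicator {0..1} u * f u \<theta>) * ennreal ((1 - u) * h \<theta>) = ennreal (h \<theta>) * ?k u" for u
      using h0[OF \<theta>] f_nonneg[of u \<theta>] by (auto simp: ennreal_mult[symmetric] indicator_def mult_ac)
    moreover have "(\<integral>\<^sup>+u. ?k u * indicator {?q<..} u \<partial>lborel) = ennreal (1 - a) * (\<integral>\<^sup>+u. ?k u \<partial>lborel)"
      unfolding q_opt_def
      by (rule left_quantile_density(3)[OF _ _ S_int[OF \<theta>] S_pos[OF \<theta>] a]) (auto simp: f_nonneg)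
    ultimately show ?thesis
      by (simp add: mult.assoc[symmetric] nn_integral_cmult) (simp add: mult_ac nn_integral_cmult)
  qed
  have Am[measurable]: "?A \<in> sets borel" by measurable
  have "(\<integral>\<^sup>+z. ennreal ((1 - fst z) * h (snd z)) * indicator ?A z \<partial>P)
      = (\<integral>\<^sup>+\<theta>. ennreal (1 - a) * (\<integral>\<^sup>+u. ennreal (indicator {0..1} u * f u \<theta>) * ennreal ((1 - u) * h \<theta>) \<partial>lborel)
          \<partial>distr P borel snd)"
  proof (subst nn_integral_P)
    show "(\<lambda>z. ennreal ((1 - fst z) * h (snd z)) * indicator ?A z) \<in> borel_measurable borel" by measurable
  qed (intro nn_integral_cong_AE, use p_S in eventually_elim, simp add: inner)
  also have "\<dots> = ennreal (1 - a) * (\<integral>\<^sup>+z. ennreal ((1 - fst z) * h (snd z)) \<partial>P)"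
  proof -
    have "(\<lambda>\<theta>. \<integral>\<^sup>+u. ennreal (indicator {0..1} u * f u \<theta>) * ennreal ((1 - u) * h \<theta>) \<partial>lborel) \<in> borel_measurable borel"
    proof (rule lborel.borel_measurable_nn_integral)
      have [measurable]: "(\<lambda>z. f (snd z) (fst z)) \<in> borel_measurable (borel \<Otimes>\<^sub>M borel)"
        using measurable_compose[OF measurable_pair_swap' f_measurable] by (simp add: case_prod_beta')
      show "(\<lambda>(\<theta>, u). ennreal (indicator {0..1} u * f u \<theta>) * ennreal ((1 - u) * h \<theta>))
          \<in> borel_measurable (borel \<Otimes>\<^sub>M lborel)"
        unfolding case_prod_beta' by measurable
    qed
    then show ?thesis
      by (subst nn_integral_cmult) (auto simp: nn_integral_P)
  qed
  finally have eq: "(\<integral>\<^sup>+z. ennreal ((1 - fst z) * h (snd z)) * indicator ?A z \<partial>P)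
      = ennreal (1 - a) * (\<integral>\<^sup>+z. ennreal ((1 - fst z) * h (snd z)) \<partial>P)" .
  have nn: "AE z in P. 0 \<le> (1 - fst z) * h (snd z)"
    using P_AE_S by eventually_elim (auto intro!: mult_nonneg_nonneg h0)
  then have nn2: "AE z in P. 0 \<le> (1 - fst z) * h (snd z) * indicator ?A z"
    by eventually_elim (simp add: indicator_def)
  have int2: "integrable P (\<lambda>z. (1 - fst z) * h (snd z) * indicator ?A z)"
    by (rule integrable_real_mult_indicator[OF _ int]) simp
  have "ennreal (\<integral>z. (1 - fst z) * h (snd z) * indicator ?A z \<partial>P)
      = (\<integral>\<^sup>+z. ennreal ((1 - fst z) * h (snd z) * indicator ?A z) \<partial>P)"
    by (rule nn_integral_eq_integral[OF int2 nn2, symmetric])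
  also have "\<dots> = (\<integral>\<^sup>+z. ennreal ((1 - fst z) * h (snd z)) * indicator ?A z \<partial>P)"
    by (intro nn_integral_cong) (auto simp: indicator_def)
  also have "\<dots> = ennreal ((1 - a) * (\<integral>z. (1 - fst z) * h (snd z) \<partial>P))"
    unfolding eq using a nn by (simp add: nn_integral_eq_integral[OF int nn] ennreal_mult[symmetric] integral_nonneg_AE)
  finally show ?thesis
    using a nn nn2
    by (subst (asm) ennreal_inj) (auto intro!: integral_nonneg_AE mult_nonneg_nonneg)
qed

text \<open>The minimum is dominated by U, which is at most 1, so h may be unbounded.\<close>

lemma integrable_min:
  assumes h[measurable]: "h \<in> borel_measurable borel" and h0: "\<And>\<theta>. \<theta> \<in> S \<Longrightarrow> 0 \<le> h \<theta>"
  shows "integrable P (\<lambda>z. min (fst z) ((1 - fst z) * h (snd z)))"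
proof (rule P.integrable_const_bound[where B=1])
  show "AE z in P. norm (min (fst z) ((1 - fst z) * h (snd z))) \<le> 1"
    using P_AE_S
  proof eventually_elim
    case (elim z)
    then have "0 \<le> (1 - fst z) * h (snd z)" using h0 by auto
    with elim show ?case by (auto simp: min_def)
  qed
qed measurable

section \<open>Comparison inequalities for the scale and precision functionals\<close>

lemma integrable_homogeneous:
  assumes h: "cont_homogeneous h"
  shows "integrable P (\<lambda>z. (1 - fst z) * h (snd z))"
proof -
  note [measurable] = cont_homogeneous_measurable[OF h]
  obtain K where K: "0 < K" "\<And>\<theta>. \<theta> \<in> l1sphere \<Longrightarrow> h \<theta> \<le> K" using cont_homogeneous_bounded[OF h] by blast
  have h0: "0 \<le> h x" for x using h by (simp add: cont_homogeneous_def)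
  show ?thesis
  proof (rule P.integrable_const_bound[where B="1 * K"])
    show "AE z in P. norm ((1 - fst z) * h (snd z)) \<le> 1 * K"
      using P_AE
    proof eventually_elim
      case (elim z)
      then show ?case unfolding norm_mult using K h0[of "snd z"] by (intro mult_mono) auto
    qed
  qed measurable
qed

lemma Lambda_fun_eq: "EU * Lambda_fun P h = (\<integral>z. min (fst z) ((1 - fst z) * h (snd z)) \<partial>P)"
  using EU_pos by (simp add: Lambda_fun_def EU_def case_prod_beta')

lemma C_fun_eq: "C_fun P h = (\<integral>z. (1 - fst z) * h (snd z) \<partial>P)"
  by (simp add: C_fun_def case_prod_beta')

text \<open>The concavity argument in pointwise form: the tangent to min u w at w = (1 - u) g bounds
  the value at (1 - u) h. The slope is the indicator of \<open>?A\<close>; on integration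
  \<open>weighted_exceedance\<close> replaces it by 1 - a, and C(g) = E[U] evaluates the term from
  g.\<close>

lemma Lambda_le:
  assumes h: "cont_homogeneous h"
  shows "Lambda_fun P h \<le> Lambda_fun P g + (1 - a) * (C_fun P h / EU - 1)"
proof -
  let ?A = "{z. (1 - fst z) * g (snd z) < fst z}"
  note [measurable] = cont_homogeneous_measurable[OF h]
  have h0: "0 \<le> h x" for x using h by (simp add: cont_homogeneous_def)
  note inth = integrable_homogeneous[OF h]
  have Am[measurable]: "?A \<in> sets borel" by measurable
  have ind: "integrable P (\<lambda>z. \<phi> z * indicator ?A z)" if "integrable P \<phi>" for \<phi> :: "_ \<Rightarrow> real"
    by (rule integrable_real_mult_indicator[OF _ that]) simp
  have "(\<integral>z. min (fst z) ((1 - fst z) * h (snd z)) \<partial>P)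
      \<le> (\<integral>z. min (fst z) ((1 - fst z) * g (snd z)) + ((1 - fst z) * h (snd z) * indicator ?A z
          - (1 - fst z) * g (snd z) * indicator ?A z) \<partial>P)"
  proof (rule integral_mono_AE)
    \<comment> \<open>On \<open>?A\<close> the first minimum on the right is (1 - u) g, so the right
      side is (1 - u) h; off \<open>?A\<close> the right side is u.\<close>
    show "AE z in P. min (fst z) ((1 - fst z) * h (snd z))
        \<le> min (fst z) ((1 - fst z) * g (snd z)) + ((1 - fst z) * h (snd z) * indicator ?A z
          - (1 - fst z) * g (snd z) * indicator ?A z)"
      by (rule AE_I2) (auto simp: indicator_def)
  qed (intro Bochner_Integration.integrable_add Bochner_Integration.integrable_diff ind inth g_integrable
      integrable_min h0 g_nonneg; simp)+
  also have "\<dots> = (\<integral>z. min (fst z) ((1 - fst z) * g (snd z)) \<partial>P) + ((1 - a) * C_fun P h - (1 - a) * EU)"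
    using ind[OF inth] ind[OF g_integrable] integrable_min[of g] g_nonneg
      weighted_exceedance[of h] weighted_exceedance[of g] inth g_integrable h0 C_opt'
    by (simp add: C_fun_eq)
  finally have "EU * Lambda_fun P h \<le> EU * Lambda_fun P g + (1 - a) * (C_fun P h - EU)"
    by (simp add: Lambda_fun_eq algebra_simps)
  then have bound: "EU * Lambda_fun P h \<le> EU * Lambda_fun P g + (1 - a) * (EU * y - EU)"
    if "C_fun P h = EU * y" for y using that by simp
  define y where "y = C_fun P h / EU"
  have "C_fun P h = EU * y" using EU_pos by (simp add: y_def)
  from bound[OF this] have "EU * Lambda_fun P h \<le> EU * (Lambda_fun P g + (1 - a) * (y - 1))"
    by (simp add: algebra_simps)
  then show ?thesis using EU_pos unfolding y_def by simp
qed

text \<open>The weight 1 - u lies in [0, 1] and the minimum with u is 1-Lipschitz, so a uniform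
  error e on \<open>S\<close> costs at most e in either integral. Division by \<open>EU\<close>
  together with C(g) = E[U] gives both bounds.\<close>

lemma functionals_close:
  assumes h: "cont_homogeneous h" and close: "\<And>\<theta>. \<theta> \<in> S \<Longrightarrow> \<bar>h \<theta> - g \<theta>\<bar> \<le> e" and e: "0 \<le> e"
  shows "\<bar>C_fun P h / EU - 1\<bar> \<le> e / EU" "\<bar>Lambda_fun P h - Lambda_fun P g\<bar> \<le> e / EU"
proof -
  note [measurable] = cont_homogeneous_measurable[OF h]
  have h0: "0 \<le> h x" for x using h by (simp add: cont_homogeneous_def)
  have pw: "AE z in P. \<bar>(1 - fst z) * h (snd z) - (1 - fst z) * g (snd z)\<bar> \<le> e"
    using P_AE_S
  proof eventually_elim
    case (elim z)
    have "\<bar>1 - fst z\<bar> * \<bar>h (snd z) - g (snd z)\<bar> \<le> 1 * e"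
      using elim e by (intro mult_mono close) auto
    then show ?case by (simp add: abs_mult[symmetric] right_diff_distrib)
  qed
  have bd: "\<bar>(\<integral>z. \<phi> z \<partial>P) - (\<integral>z. \<psi> z \<partial>P)\<bar> \<le> e"
    if "integrable P \<phi>" "integrable P \<psi>" "AE z in P. \<bar>\<phi> z - \<psi> z\<bar> \<le> e" for \<phi> \<psi> :: "_ \<Rightarrow> real"
  proof -
    have "\<bar>(\<integral>z. \<phi> z \<partial>P) - (\<integral>z. \<psi> z \<partial>P)\<bar> = \<bar>\<integral>z. \<phi> z - \<psi> z \<partial>P\<bar>" using that by simp
    also have "\<dots> \<le> (\<integral>z. \<bar>\<phi> z - \<psi> z\<bar> \<partial>P)" by (rule integral_abs_bound)
    also have "\<dots> \<le> (\<integral>z. e \<partial>P)" using that by (intro integral_mono_AE) auto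
    finally show ?thesis by (simp add: P.prob_space)
  qed
  have "\<bar>C_fun P h - EU\<bar> \<le> e"
    using bd[OF integrable_homogeneous[OF h] g_integrable pw] C_opt' by (simp add: C_fun_eq)
  moreover have "C_fun P h / EU - 1 = (C_fun P h - EU) / EU" using EU_pos by (simp add: diff_divide_distrib)
  ultimately show "\<bar>C_fun P h / EU - 1\<bar> \<le> e / EU" using EU_pos by (simp add: divide_right_mono)
  have "AE z in P. \<bar>min (fst z) ((1 - fst z) * h (snd z)) - min (fst z) ((1 - fst z) * g (snd z))\<bar> \<le> e"
    using pw by eventually_elim linarith
  with bd[OF integrable_min[of h] integrable_min[of g]] h0 g_nonneg
  have "\<bar>EU * Lambda_fun P h - EU * Lambda_fun P g\<bar> \<le> e" by (simp add: Lambda_fun_eq)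
  then show "\<bar>Lambda_fun P h - Lambda_fun P g\<bar> \<le> e / EU"
    using EU_pos by (simp add: right_diff_distrib[symmetric] abs_mult pos_le_divide_eq mult.commute)
qed

text \<open>With w = (1 - u) h the integrands differ by at most w |c - 1| / c, and the mean of w is
  C(h) = c E[U]. The factor c cancels, so the bound does not depend on the size of h.\<close>

lemma Lambda_rescaled:
  assumes h: "cont_homogeneous h" and c: "c = C_fun P h / EU" "0 < c"
  shows "\<bar>Lambda_fun P (\<lambda>x. h x / c) - Lambda_fun P h\<bar> \<le> \<bar>c - 1\<bar>"
proof -
  note [measurable] = cont_homogeneous_measurable[OF h]
  have h0: "0 \<le> h x" for x using h by (simp add: cont_homogeneous_def)
  have i1: "integrable P (\<lambda>z. min (fst z) ((1 - fst z) * (h (snd z) / c)))"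
    and i2: "integrable P (\<lambda>z. min (fst z) ((1 - fst z) * h (snd z)))"
    using c(2) h0 integrable_min[of "\<lambda>x. h x / c"] integrable_min[of h] by auto
  note inth = integrable_homogeneous[OF h]
  have "\<bar>(\<integral>z. min (fst z) ((1 - fst z) * (h (snd z) / c)) \<partial>P) - (\<integral>z. min (fst z) ((1 - fst z) * h (snd z)) \<partial>P)\<bar>
      = \<bar>\<integral>z. min (fst z) ((1 - fst z) * (h (snd z) / c)) - min (fst z) ((1 - fst z) * h (snd z)) \<partial>P\<bar>"
    using i1 i2 by simp
  also have "\<dots> \<le> (\<integral>z. \<bar>min (fst z) ((1 - fst z) * (h (snd z) / c)) - min (fst z) ((1 - fst z) * h (snd z))\<bar> \<partial>P)"
    by (rule integral_abs_bound)
  also have "\<dots> \<le> (\<integral>z. (1 - fst z) * h (snd z) * (\<bar>c - 1\<bar> / c) \<partial>P)"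
  proof (rule integral_mono_AE)
    show "AE z in P. \<bar>min (fst z) ((1 - fst z) * (h (snd z) / c)) - min (fst z) ((1 - fst z) * h (snd z))\<bar>
        \<le> (1 - fst z) * h (snd z) * (\<bar>c - 1\<bar> / c)"
      using P_AE
    proof eventually_elim
      case (elim z)
      let ?w = "(1 - fst z) * h (snd z)"
      have "\<bar>min (fst z) (?w / c) - min (fst z) ?w\<bar> \<le> \<bar>?w / c - ?w\<bar>" by linarith
      also have "?w / c - ?w = ?w * ((1 - c) / c)" using c(2) by (simp add: field_simps)
      also have "\<bar>\<dots>\<bar> = \<bar>?w\<bar> * (\<bar>c - 1\<bar> / c)" using c(2) by (simp only: abs_mult abs_divide) (simp add: abs_minus_commute)
      also have "\<bar>?w\<bar> = ?w" using elim h0[of "snd z"] by simp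
      finally show ?case by simp
    qed
  qed (use i1 i2 inth in auto)
  also have "\<dots> = EU * \<bar>c - 1\<bar>"
  proof -
    have "C_fun P h = c * EU" using c(1) EU_pos by simp
    then show ?thesis using c(2) by (simp add: C_fun_eq[symmetric])
  qed
  finally have "\<bar>EU * Lambda_fun P (\<lambda>x. h x / c) - EU * Lambda_fun P h\<bar> \<le> EU * \<bar>c - 1\<bar>"
    by (simp add: Lambda_fun_eq)
  then show ?thesis using EU_pos by (simp add: right_diff_distrib[symmetric] abs_mult)
qed

end


section \<open>Laws of exceedance samples\<close>

lemma nn_integral_indicator_vimage:
  assumes "F -` A \<inter> space M \<in> sets M"
  shows "(\<integral>\<^sup>+y. indicator A (F y) \<partial>M) = emeasure M (F -` A \<inter> space M)"
  by (subst nn_integral_indicator[OF assms, symmetric]) (auto intro!: nn_integral_cong simp: indicator_def)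

text \<open>Coordinates are exchanged one at a time, each at cost \<open>\<delta>\<close>: the new
  coordinate with the others fixed, then the remaining ones by induction on sections.\<close>

lemma emeasure_PiM_le:
  fixes \<mu> \<nu> :: "'a measure" and \<delta> :: ennreal and I :: "'i set"
  assumes \<mu>: "prob_space \<mu>" and \<nu>: "prob_space \<nu>" and sets: "sets \<mu> = sets \<nu>"
    and tv: "\<And>A. A \<in> sets \<nu> \<Longrightarrow> emeasure \<mu> A \<le> emeasure \<nu> A + \<delta>"
    and I: "finite I" and A: "A \<in> sets (PiM I (\<lambda>_. \<nu>))"
  shows "emeasure (PiM I (\<lambda>_. \<mu>)) A \<le> emeasure (PiM I (\<lambda>_. \<nu>)) A + of_nat (card I) * \<delta>"
  using I A
proof (induction I arbitrary: A rule: finite_induct)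
  case empty
  then show ?case by (simp add: PiM_empty)
next
  case (insert i I)
  \<comment> \<open>The hybrid family: \<open>\<nu>\<close> already at the new coordinate i, still
    \<open>\<mu>\<close> at the old ones.\<close>
  define \<rho> where "\<rho> j = (if j = i then \<nu> else \<mu>)" for j
  have \<rho>: "prob_space (\<rho> j)" "sets (\<rho> j) = sets \<nu>" for j
    using \<mu> \<nu> sets by (auto simp: \<rho>_def)
  interpret \<nu>: prob_space \<nu> by fact
  interpret P\<mu>: product_prob_space "\<lambda>_. \<mu>" UNIV
    by (simp add: product_prob_space_def product_prob_space_axioms_def product_sigma_finite_def \<mu> prob_space_imp_sigma_finite)
  interpret P\<nu>: product_prob_space "\<lambda>_. \<nu>" UNIV
    by (simp add: product_prob_space_def product_prob_space_axioms_def product_sigma_finite_def \<nu> prob_space_imp_sigma_finite)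
  interpret P\<rho>: product_prob_space \<rho> UNIV
    by (simp add: product_prob_space_def product_prob_space_axioms_def product_sigma_finite_def \<rho> prob_space_imp_sigma_finite)
  have PI: "PiM I \<rho> = PiM I (\<lambda>_. \<mu>)"
    using insert by (intro PiM_cong) (auto simp: \<rho>_def)
  have sI: "sets (PiM J \<rho>) = sets (PiM J (\<lambda>_. \<nu>))" "sets (PiM J (\<lambda>_. \<mu>)) = sets (PiM J (\<lambda>_. \<nu>))" for J
    using \<rho> sets by (auto intro!: sets_PiM_cong)
  have A\<mu>: "A \<in> sets (PiM (insert i I) (\<lambda>_. \<mu>))" and A\<rho>: "A \<in> sets (PiM (insert i I) \<rho>)"
    using insert.prems sI by auto
  have spI: "space (PiM I (\<lambda>_. \<mu>)) = space (PiM I (\<lambda>_. \<nu>))" by (rule sets_eq_imp_space_eq[OF sI(2)])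
  have sp: "space \<mu> = space \<nu>" by (rule sets_eq_imp_space_eq[OF sets])
  have upd1: "(\<lambda>y. x(i := y)) -` A \<inter> space \<nu> \<in> sets \<nu>" if "x \<in> space (PiM I (\<lambda>_. \<nu>))" for x
  proof (rule measurable_sets[OF _ insert.prems])
    show "(\<lambda>y. x(i := y)) \<in> \<nu> \<rightarrow>\<^sub>M PiM (insert i I) (\<lambda>_. \<nu>)"
      by (rule measurable_fun_upd[where J=I]) (use that in auto)
  qed
  have upd2: "(\<lambda>x. x(i := y)) -` A \<inter> space (PiM I (\<lambda>_. \<nu>)) \<in> sets (PiM I (\<lambda>_. \<nu>))" if "y \<in> space \<nu>" for y
  proof (rule measurable_sets[OF _ insert.prems])
    show "(\<lambda>x. x(i := y)) \<in> PiM I (\<lambda>_. \<nu>) \<rightarrow>\<^sub>M PiM (insert i I) (\<lambda>_. \<nu>)"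
      by (rule measurable_fun_upd[where J=I]) (use that in auto)
  qed
  have "emeasure (PiM (insert i I) (\<lambda>_. \<mu>)) A = (\<integral>\<^sup>+x. (\<integral>\<^sup>+y. indicator A (x(i := y)) \<partial>\<mu>) \<partial>PiM I (\<lambda>_. \<mu>))"
    using A\<mu> by (subst P\<mu>.product_nn_integral_insert[symmetric]) (auto simp: insert)
  also have "\<dots> \<le> (\<integral>\<^sup>+x. (\<integral>\<^sup>+y. indicator A (x(i := y)) \<partial>\<nu>) + \<delta> \<partial>PiM I (\<lambda>_. \<mu>))"
  proof (rule nn_integral_mono)
    fix x assume "x \<in> space (PiM I (\<lambda>_. \<mu>))"
    then have x: "(\<lambda>y. x(i := y)) -` A \<inter> space \<nu> \<in> sets \<nu>" using upd1 spI by auto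
    then show "(\<integral>\<^sup>+y. indicator A (x(i := y)) \<partial>\<mu>) \<le> (\<integral>\<^sup>+y. indicator A (x(i := y)) \<partial>\<nu>) + \<delta>"
      using tv[OF x] sets sp nn_integral_indicator_vimage[of "\<lambda>y. x(i := y)" A \<mu>]
        nn_integral_indicator_vimage[of "\<lambda>y. x(i := y)" A \<nu>] by simp
  qed
  also have "\<dots> = (\<integral>\<^sup>+x. (\<integral>\<^sup>+y. indicator A (x(i := y)) \<partial>\<rho> i) + \<delta> \<partial>PiM I \<rho>)"
    by (simp add: PI) (simp add: \<rho>_def)
  also have "\<dots> = (\<integral>\<^sup>+x. (\<integral>\<^sup>+y. indicator A (x(i := y)) \<partial>\<rho> i) \<partial>PiM I \<rho>) + \<delta>"
  proof (subst nn_integral_add)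
    interpret PI: prob_space "PiM I \<rho>" by (rule prob_space_PiM) (rule \<rho>)
    show "(\<integral>\<^sup>+x. (\<integral>\<^sup>+y. indicator A (x(i := y)) \<partial>\<rho> i) \<partial>PiM I \<rho>) + (\<integral>\<^sup>+x. \<delta> \<partial>PiM I \<rho>)
        = (\<integral>\<^sup>+x. (\<integral>\<^sup>+y. indicator A (x(i := y)) \<partial>\<rho> i) \<partial>PiM I \<rho>) + \<delta>"
      by (simp add: PI.emeasure_space_1)
    interpret \<rho>i: sigma_finite_measure "\<rho> i" by (rule P\<rho>.sigma_finite_measures)
    show "(\<lambda>x. \<integral>\<^sup>+y. indicator A (x(i := y)) \<partial>\<rho> i) \<in> borel_measurable (PiM I \<rho>)"
      using A\<rho> by measurable
  qed simp
  \<comment> \<open>Both iterated integrals equal the measure of A under the hybrid product; the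
    exchanged order makes the coordinates in I innermost, where the induction hypothesis applies to
    sections.\<close>
  also have "(\<integral>\<^sup>+x. (\<integral>\<^sup>+y. indicator A (x(i := y)) \<partial>\<rho> i) \<partial>PiM I \<rho>)
      = (\<integral>\<^sup>+y. (\<integral>\<^sup>+x. indicator A (x(i := y)) \<partial>PiM I \<rho>) \<partial>\<rho> i)"
    using A\<rho> insert(1,2)
    by (subst P\<rho>.product_nn_integral_insert[symmetric], simp, simp, simp)
      (subst P\<rho>.product_nn_integral_insert_rev, auto)
  also have "\<dots> = (\<integral>\<^sup>+y. (\<integral>\<^sup>+x. indicator A (x(i := y)) \<partial>PiM I (\<lambda>_. \<mu>)) \<partial>\<nu>)"
    by (simp add: PI) (simp add: \<rho>_def)
  also have "\<dots> \<le> (\<integral>\<^sup>+y. (\<integral>\<^sup>+x. indicator A (x(i := y)) \<partial>PiM I (\<lambda>_. \<nu>)) + of_nat (card I) * \<delta> \<partial>\<nu>)"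
  proof (rule nn_integral_mono)
    fix y assume "y \<in> space \<nu>"
    note y = upd2[OF this]
    show "(\<integral>\<^sup>+x. indicator A (x(i := y)) \<partial>PiM I (\<lambda>_. \<mu>))
        \<le> (\<integral>\<^sup>+x. indicator A (x(i := y)) \<partial>PiM I (\<lambda>_. \<nu>)) + of_nat (card I) * \<delta>"
      using y insert.IH[OF y] sI(2)[of I] spI
        nn_integral_indicator_vimage[of "\<lambda>x. x(i := y)" A "PiM I (\<lambda>_. \<mu>)"]
        nn_integral_indicator_vimage[of "\<lambda>x. x(i := y)" A "PiM I (\<lambda>_. \<nu>)"] by simp
  qed
  also have "\<dots> = (\<integral>\<^sup>+y. (\<integral>\<^sup>+x. indicator A (x(i := y)) \<partial>PiM I (\<lambda>_. \<nu>)) \<partial>\<nu>) + of_nat (card I) * \<delta>"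
  proof (subst nn_integral_add)
    show "(\<integral>\<^sup>+y. (\<integral>\<^sup>+x. indicator A (x(i := y)) \<partial>PiM I (\<lambda>_. \<nu>)) \<partial>\<nu>) + (\<integral>\<^sup>+y. of_nat (card I) * \<delta> \<partial>\<nu>)
        = (\<integral>\<^sup>+y. (\<integral>\<^sup>+x. indicator A (x(i := y)) \<partial>PiM I (\<lambda>_. \<nu>)) \<partial>\<nu>) + of_nat (card I) * \<delta>"
      by (simp add: \<nu>.emeasure_space_1)
    interpret PI: prob_space "PiM I (\<lambda>_. \<nu>)" by (rule prob_space_PiM) (rule \<nu>)
    show "(\<lambda>y. \<integral>\<^sup>+x. indicator A (x(i := y)) \<partial>PiM I (\<lambda>_. \<nu>)) \<in> borel_measurable \<nu>"
      using insert.prems by measurable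
  qed simp
  also have "(\<integral>\<^sup>+y. (\<integral>\<^sup>+x. indicator A (x(i := y)) \<partial>PiM I (\<lambda>_. \<nu>)) \<partial>\<nu>) = emeasure (PiM (insert i I) (\<lambda>_. \<nu>)) A"
    using insert.prems insert(1,2)
    by (subst P\<nu>.product_nn_integral_insert_rev[symmetric]) auto
  finally show ?case
    using insert(1,2) by (simp add: distrib_right add_ac)
qed

context prob_space
begin

text \<open>On rectangles the event splits into requirements on single variables, so independence
  factors it into non-exceedances outside I and, for each j, an exceedance probability times a
  \<open>\<nu>\<close>-probability. Rectangles determine the product measure. The product form of
  the claim also covers index sets of probability zero.\<close>

lemma exceedance_law:
  fixes s :: "nat \<Rightarrow> 'i" and Z :: "'i \<Rightarrow> 'a \<Rightarrow> 'z"
  assumes ind: "indep_vars (\<lambda>_. N) Z J" and J: "finite J" "J \<noteq> {}"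
    and E[measurable]: "E \<in> sets N" and \<phi>[measurable]: "\<phi> \<in> N \<rightarrow>\<^sub>M L"
    and \<nu>: "prob_space \<nu>" "sets \<nu> = sets L"
    and cond: "\<And>i A. i \<in> J \<Longrightarrow> A \<in> sets L \<Longrightarrow>
        \<P>(\<omega> in M. Z i \<omega> \<in> E \<and> \<phi> (Z i \<omega>) \<in> A) = \<P>(\<omega> in M. Z i \<omega> \<in> E) * measure \<nu> A"
    and I: "I \<subseteq> J" and s: "bij_betw s {..<k} I"
    and B: "B \<in> sets (\<Pi>\<^sub>M j\<in>{..<k}. L)"
  shows "\<P>(\<omega> in M. {i\<in>J. Z i \<omega> \<in> E} = I \<and> (\<lambda>j\<in>{..<k}. \<phi> (Z (s j) \<omega>)) \<in> B)
      = \<P>(\<omega> in M. {i\<in>J. Z i \<omega> \<in> E} = I) * measure (\<Pi>\<^sub>M j\<in>{..<k}. \<nu>) B"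
proof -
  interpret \<nu>: prob_space \<nu> by fact
  have Z[measurable]: "Z i \<in> M \<rightarrow>\<^sub>M N" if "i \<in> J" for i using ind that by (auto simp: indep_vars_def)
  have sJ[simp]: "s j \<in> J" if "j < k" for j using s I that by (auto simp: bij_betw_def)
  let ?X = "{\<omega>\<in>space M. {i\<in>J. Z i \<omega> \<in> E} = I}"
  let ?V = "\<lambda>\<omega>. \<lambda>j\<in>{..<k}. \<phi> (Z (s j) \<omega>)"
  have Collect_Int: "{\<omega>\<in>space M. p \<omega>} \<inter> {\<omega>\<in>space M. q \<omega>} = {\<omega>\<in>space M. p \<omega> \<and> q \<omega>}" for p q by auto
  have X_alt: "?X = {\<omega>\<in>space M. \<forall>i\<in>J. (Z i \<omega> \<in> E) = (i \<in> I)}" using I by auto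
  have X[measurable]: "?X \<in> sets M" unfolding X_alt using J by measurable
  have V[measurable]: "?V \<in> M \<rightarrow>\<^sub>M (\<Pi>\<^sub>M j\<in>{..<k}. L)"
    by (rule measurable_restrict) (auto intro!: measurable_compose[OF Z \<phi>])
  have rect: "\<P>(\<omega> in M. {i\<in>J. Z i \<omega> \<in> E} = I \<and> (\<forall>j<k. \<phi> (Z (s j) \<omega>) \<in> A j))
      = (\<Prod>i\<in>J - I. \<P>(\<omega> in M. Z i \<omega> \<notin> E)) * (\<Prod>j<k. \<P>(\<omega> in M. Z (s j) \<omega> \<in> E) * measure \<nu> (A j))"
    if A: "\<And>j. j < k \<Longrightarrow> A j \<in> sets L" for A
  proof -
    \<comment> \<open>Everything required of Z i alone. For i in I exactly one j satisfies s j = i,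
      so only one set A j is involved.\<close>
    define W where "W i = (if i \<in> I then {z\<in>space N. z \<in> E \<and> (\<forall>j\<in>{..<k}. s j = i \<longrightarrow> \<phi> z \<in> A j)} else space N - E)" for i
    have W: "W i \<in> sets N" for i
    proof -
      have "{z\<in>space N. \<phi> z \<in> A j} \<in> sets N" if "j \<in> {..<k}" for j
        using measurable_sets[OF \<phi> A[of j]] that by (simp add: vimage_def Int_def conj_commute)
      then have "{z\<in>space N. \<forall>j\<in>{..<k}. s j = i \<longrightarrow> \<phi> z \<in> A j} \<in> sets N"
        by (intro sets.sets_Collect_finite_All sets.sets_Collect_imp) auto
      then have "E \<inter> {z\<in>space N. \<forall>j\<in>{..<k}. s j = i \<longrightarrow> \<phi> z \<in> A j} \<in> sets N" by auto
      also have "E \<inter> {z\<in>space N. \<forall>j\<in>{..<k}. s j = i \<longrightarrow> \<phi> z \<in> A j}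
          = {z\<in>space N. z \<in> E \<and> (\<forall>j\<in>{..<k}. s j = i \<longrightarrow> \<phi> z \<in> A j)}" by auto
      finally show ?thesis by (simp add: W_def)
    qed
    have "{\<omega>\<in>space M. {i\<in>J. Z i \<omega> \<in> E} = I \<and> (\<forall>j<k. \<phi> (Z (s j) \<omega>) \<in> A j)} = (\<Inter>i\<in>J. Z i -` W i \<inter> space M)"
    proof (intro set_eqI iffI)
      fix \<omega> assume "\<omega> \<in> {\<omega>\<in>space M. {i\<in>J. Z i \<omega> \<in> E} = I \<and> (\<forall>j<k. \<phi> (Z (s j) \<omega>) \<in> A j)}"
      then show "\<omega> \<in> (\<Inter>i\<in>J. Z i -` W i \<inter> space M)"
        using measurable_space[OF Z] by (auto simp: W_def)
    next
      fix \<omega> assume *: "\<omega> \<in> (\<Inter>i\<in>J. Z i -` W i \<inter> space M)"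
      with J have \<omega>: "\<omega> \<in> space M" by auto
      have "(Z i \<omega> \<in> E) = (i \<in> I)" if "i \<in> J" for i using * that by (auto simp: W_def split: if_splits)
      moreover have "\<phi> (Z (s j) \<omega>) \<in> A j" if "j < k" for j
      proof -
        have "Z (s j) \<omega> \<in> W (s j)" using * sJ[OF that] by blast
        moreover have "s j \<in> I" using s that by (auto simp: bij_betw_def)
        ultimately show ?thesis using that by (auto simp: W_def)
      qed
      ultimately show "\<omega> \<in> {\<omega>\<in>space M. {i\<in>J. Z i \<omega> \<in> E} = I \<and> (\<forall>j<k. \<phi> (Z (s j) \<omega>) \<in> A j)}"
        using I \<omega> by auto
    qed
    then have "\<P>(\<omega> in M. {i\<in>J. Z i \<omega> \<in> E} = I \<and> (\<forall>j<k. \<phi> (Z (s j) \<omega>) \<in> A j))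
        = (\<Prod>i\<in>J. prob (Z i -` W i \<inter> space M))"
      using indep_varsD_finite[OF ind J(2,1) W] by simp
    also have "\<dots> = (\<Prod>i\<in>J - I. prob (Z i -` W i \<inter> space M)) * (\<Prod>i\<in>I. prob (Z i -` W i \<inter> space M))"
      using I J by (intro prod.subset_diff) auto
    also have "(\<Prod>i\<in>I. prob (Z i -` W i \<inter> space M)) = (\<Prod>j<k. prob (Z (s j) -` W (s j) \<inter> space M))"
      by (rule prod.reindex_bij_betw[OF s, symmetric])
    also have "\<dots> = (\<Prod>j<k. \<P>(\<omega> in M. Z (s j) \<omega> \<in> E) * measure \<nu> (A j))"
    proof (rule prod.cong[OF refl])
      fix j assume j: "j \<in> {..<k}"
      have "s j' = s j \<longleftrightarrow> j' = j" if "j' < k" for j'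
        using s that j by (auto simp: bij_betw_def inj_on_def)
      moreover have "s j \<in> I" using s j by (auto simp: bij_betw_def)
      ultimately have "Z (s j) -` W (s j) \<inter> space M = {\<omega>\<in>space M. Z (s j) \<omega> \<in> E \<and> \<phi> (Z (s j) \<omega>) \<in> A j}"
        using measurable_space[OF Z[OF sJ[of j]]] j by (auto simp: W_def)
      then show "prob (Z (s j) -` W (s j) \<inter> space M) = \<P>(\<omega> in M. Z (s j) \<omega> \<in> E) * measure \<nu> (A j)"
        using cond[of "s j" "A j"] A j by simp
    qed
    also have "(\<Prod>i\<in>J - I. prob (Z i -` W i \<inter> space M)) = (\<Prod>i\<in>J - I. \<P>(\<omega> in M. Z i \<omega> \<notin> E))"
      by (intro prod.cong refl arg_cong[where f=prob]) (use measurable_space[OF Z] in \<open>auto simp: W_def\<close>)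
    finally show ?thesis .
  qed
  have pX: "prob ?X = (\<Prod>i\<in>J - I. \<P>(\<omega> in M. Z i \<omega> \<notin> E)) * (\<Prod>j<k. \<P>(\<omega> in M. Z (s j) \<omega> \<in> E))"
  proof -
    have "space L = space \<nu>" using \<nu>(2) by (rule sets_eq_imp_space_eq[symmetric])
    then have "measure \<nu> (space L) = 1" by (simp add: \<nu>.prob_space)
    moreover have "{\<omega>\<in>space M. {i\<in>J. Z i \<omega> \<in> E} = I \<and> (\<forall>j<k. \<phi> (Z (s j) \<omega>) \<in> space L)} = ?X"
      using measurable_space[OF measurable_compose[OF Z \<phi>], OF sJ] by auto
    ultimately show ?thesis using rect[of "\<lambda>_. space L"] by simp
  qed
  show ?thesis
  \<comment> \<open>Conditioning on \<open>?X\<close> is possible only if it has positive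
    probability; otherwise both sides are 0.\<close>
  proof (cases "prob ?X = 0")
    case True
    moreover have "\<P>(\<omega> in M. {i\<in>J. Z i \<omega> \<in> E} = I \<and> ?V \<omega> \<in> B) \<le> prob ?X"
      by (rule finite_measure_mono) auto
    ultimately show ?thesis using measure_nonneg[of M] by (simp add: order_antisym)
  next
    case False
    let ?M = "uniform_measure M ?X"
    interpret P\<nu>: product_prob_space "\<lambda>_. \<nu>" "UNIV :: nat set"
      by (simp add: product_prob_space_def product_prob_space_axioms_def product_sigma_finite_def \<nu> prob_space_imp_sigma_finite)
    have law: "distr ?M (\<Pi>\<^sub>M j\<in>{..<k}. L) ?V = (\<Pi>\<^sub>M j\<in>{..<k}. \<nu>)"
    proof (rule P\<nu>.PiM_eqI)
      show "sets (distr ?M (\<Pi>\<^sub>M j\<in>{..<k}. L) ?V) = sets (\<Pi>\<^sub>M j\<in>{..<k}. \<nu>)"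
        using \<nu>(2) by (auto intro!: sets_PiM_cong)
      fix A assume "\<And>i. i \<in> {..<k} \<Longrightarrow> A i \<in> sets \<nu>"
      then have A: "\<And>j. j < k \<Longrightarrow> A j \<in> sets L" using \<nu>(2) by auto
      define W where "W = {\<omega>\<in>space M. \<forall>j<k. \<phi> (Z (s j) \<omega>) \<in> A j}"
      have PiE: "Pi\<^sub>E {..<k} A \<in> sets (\<Pi>\<^sub>M j\<in>{..<k}. L)"
        using A by (intro sets_PiM_I_finite) auto
      have VW: "?V -` Pi\<^sub>E {..<k} A \<inter> space M = W"
        unfolding W_def by (rule set_eqI) (simp add: PiE_iff Ball_def conj_commute)
      have W: "W \<in> sets M" unfolding VW[symmetric] by (rule measurable_sets[OF V PiE])
      have XW: "?X \<inter> W = {\<omega>\<in>space M. {i\<in>J. Z i \<omega> \<in> E} = I \<and> (\<forall>j<k. \<phi> (Z (s j) \<omega>) \<in> A j)}"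
        unfolding W_def by (rule Collect_Int)
      have quot: "prob (?X \<inter> W) / prob ?X = (\<Prod>j<k. measure \<nu> (A j))"
      proof -
        have "prob (?X \<inter> W) = prob ?X * (\<Prod>j<k. measure \<nu> (A j))"
          using rect[of A, OF A] unfolding XW pX by (simp add: prod.distrib mult.assoc)
        then show ?thesis using False by simp
      qed
      have "emeasure (distr ?M (\<Pi>\<^sub>M j\<in>{..<k}. L) ?V) (Pi\<^sub>E {..<k} A) = emeasure ?M W"
        using V PiE VW by (subst emeasure_distr) simp_all
      also have "\<dots> = emeasure M (?X \<inter> W) / emeasure M ?X"
        using X W by (rule emeasure_uniform_measure)
      also have "\<dots> = ennreal (prob (?X \<inter> W) / prob ?X)"
        unfolding emeasure_eq_measure
        by (rule divide_ennreal) (use False in \<open>simp_all add: zero_less_measure_iff\<close>)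
      also have "\<dots> = (\<Prod>j\<in>{..<k}. emeasure \<nu> (A j))"
        unfolding quot by (simp add: \<nu>.emeasure_eq_measure prod_ennreal)
      finally show "emeasure (distr ?M (\<Pi>\<^sub>M j\<in>{..<k}. L) ?V) (Pi\<^sub>E {..<k} A) = (\<Prod>j\<in>{..<k}. emeasure \<nu> (A j))" .
    qed simp
    have "measure (\<Pi>\<^sub>M j\<in>{..<k}. \<nu>) B = measure ?M (?V -` B \<inter> space ?M)"
      unfolding law[symmetric] by (rule measure_distr[OF _ B]) (use V in simp)
    also have "space ?M = space M" by simp
    also have "?V -` B \<inter> space M = {\<omega>\<in>space M. ?V \<omega> \<in> B}" by (rule set_eqI) (simp add: conj_commute)
    finally have "measure (\<Pi>\<^sub>M j\<in>{..<k}. \<nu>) B = measure ?M {\<omega>\<in>space M. ?V \<omega> \<in> B}" .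
    moreover have "measure ?M {\<omega>\<in>space M. ?V \<omega> \<in> B} = prob (?X \<inter> {\<omega>\<in>space M. ?V \<omega> \<in> B}) / prob ?X"
      using False measurable_sets[OF V B]
      by (intro measure_uniform_measure) (simp_all add: emeasure_eq_measure vimage_def Int_def conj_commute)
    ultimately show ?thesis using False unfolding Collect_Int by simp
  qed
qed

text \<open>The three terms are the probability of B under Q for samples of size at least m, the
  probability of fewer than m exceedances, and the replacement cost \<open>\<delta>\<close> per
  exceedance, averaged to the mean number of exceedances times \<open>\<delta>\<close>. B may depend
  on the sample size since the sum runs over the possible index sets.\<close>

lemma exceedance_sample_bound:
  fixes Z :: "nat \<Rightarrow> 'a \<Rightarrow> 'z"
  assumes ind: "indep_vars (\<lambda>_. N) Z J" and J: "finite J" "J \<noteq> {}"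
    and E[measurable]: "E \<in> sets N" and \<phi>[measurable]: "\<phi> \<in> N \<rightarrow>\<^sub>M L"
    and \<nu>: "prob_space \<nu>" "sets \<nu> = sets L" and Q: "prob_space Q" "sets Q = sets L"
    and p: "\<And>i. i \<in> J \<Longrightarrow> \<P>(\<omega> in M. Z i \<omega> \<in> E) = p"
    and cond: "\<And>i A. i \<in> J \<Longrightarrow> A \<in> sets L \<Longrightarrow>
        \<P>(\<omega> in M. Z i \<omega> \<in> E \<and> \<phi> (Z i \<omega>) \<in> A) = p * measure \<nu> A"
    and tv: "\<And>A. A \<in> sets L \<Longrightarrow> \<bar>measure \<nu> A - measure Q A\<bar> \<le> \<delta>"
    and B: "\<And>k. B k \<in> sets (\<Pi>\<^sub>M j\<in>{..<k}. L)"
    and e: "0 \<le> e" "\<And>k. m \<le> k \<Longrightarrow> measure (\<Pi>\<^sub>M j\<in>{..<k}. Q) (B k) \<le> e"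
  defines "I \<equiv> \<lambda>\<omega>. {i\<in>J. Z i \<omega> \<in> E}"
  defines "Bad \<equiv> {\<omega>\<in>space M. (\<lambda>j\<in>{..<card (I \<omega>)}. \<phi> (Z (sorted_list_of_set (I \<omega>) ! j) \<omega>)) \<in> B (card (I \<omega>))}"
  shows "Bad \<in> sets M"
    and "prob Bad \<le> e + (1 - \<P>(\<omega> in M. m \<le> card (I \<omega>))) + real (card J) * p * \<delta>"
proof -
  interpret \<nu>: prob_space \<nu> by fact
  interpret Q: prob_space Q by fact
  have Z[measurable]: "Z i \<in> M \<rightarrow>\<^sub>M N" if "i \<in> J" for i using ind that by (auto simp: indep_vars_def)
  define s where "s K j = sorted_list_of_set K ! j" for K :: "nat set" and j
  define X where "X K = {\<omega>\<in>space M. I \<omega> = K}" for K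
  define D where "D K = {\<omega>\<in>space M. I \<omega> = K \<and> (\<lambda>j\<in>{..<card K}. \<phi> (Z (s K j) \<omega>)) \<in> B (card K)}" for K
  have bij: "bij_betw (s K) {..<card K} K" if "K \<subseteq> J" for K
    using finite_subset[OF that J(1)] unfolding s_def
    by (intro bij_betw_nth) auto
  have X[measurable]: "X K \<in> sets M" if "K \<subseteq> J" for K
  proof -
    have "X K = {\<omega>\<in>space M. \<forall>i\<in>J. (Z i \<omega> \<in> E) = (i \<in> K)}" using that by (auto simp: X_def I_def)
    also have "\<dots> \<in> sets M" using J by measurable
    finally show ?thesis .
  qed
  have D: "D K \<in> sets M" if K: "K \<subseteq> J" for K
  proof -
    have "(\<lambda>\<omega>. \<lambda>j\<in>{..<card K}. \<phi> (Z (s K j) \<omega>)) \<in> M \<rightarrow>\<^sub>M (\<Pi>\<^sub>M j\<in>{..<card K}. L)"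
      by (rule measurable_restrict)
        (use bij[OF K] K in \<open>auto simp: bij_betw_def intro!: measurable_compose[OF Z \<phi>]\<close>)
    from measurable_sets[OF this B] have "X K \<inter> ((\<lambda>\<omega>. \<lambda>j\<in>{..<card K}. \<phi> (Z (s K j) \<omega>)) -` B (card K) \<inter> space M) \<in> sets M"
      using X[OF K] by auto
    also have "X K \<inter> ((\<lambda>\<omega>. \<lambda>j\<in>{..<card K}. \<phi> (Z (s K j) \<omega>)) -` B (card K) \<inter> space M) = D K"
      by (auto simp: X_def D_def)
    finally show ?thesis .
  qed
  have I_sub: "I \<omega> \<in> Pow J" for \<omega> by (auto simp: I_def)
  have Bad_eq: "Bad = (\<Union>K\<in>Pow J. D K)"
    using I_sub unfolding Bad_def D_def s_def by auto
  show "Bad \<in> sets M" unfolding Bad_eq using J D by (intro sets.finite_UN) auto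
  have sumX: "(\<Sum>K\<in>Pow J. prob (X K \<inter> W)) = prob W" if W: "W \<in> sets M" for W
  proof -
    have "(\<Union>K\<in>Pow J. X K \<inter> W) = W"
      using sets.sets_into_space[OF W] I_sub by (auto simp: X_def)
    moreover have "prob (\<Union>K\<in>Pow J. X K \<inter> W) = (\<Sum>K\<in>Pow J. prob (X K \<inter> W))"
      using J X W by (intro finite_measure_finite_Union) (auto simp: disjoint_family_on_def X_def)
    ultimately show ?thesis by simp
  qed
  have \<delta>: "0 \<le> \<delta>" using tv[of "{}"] by simp
  define b where "b k = measure (\<Pi>\<^sub>M j\<in>{..<k}. Q) (B k)" for k
  have \<nu>b: "measure (\<Pi>\<^sub>M j\<in>{..<k}. \<nu>) (B k) \<le> b k + real k * \<delta>" for k :: nat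
  proof -
    interpret P\<nu>: prob_space "\<Pi>\<^sub>M j\<in>{..<k}. \<nu>" by (intro prob_space_PiM \<nu>)
    interpret PQ: prob_space "\<Pi>\<^sub>M j\<in>{..<k}. Q" by (intro prob_space_PiM Q)
    have BQ: "B k \<in> sets (\<Pi>\<^sub>M j\<in>{..<k}. Q)"
      using B[of k] sets_PiM_cong[OF refl Q(2), of "{..<k}"] by simp
    have "emeasure (\<Pi>\<^sub>M j\<in>{..<k}. \<nu>) (B k) \<le> emeasure (\<Pi>\<^sub>M j\<in>{..<k}. Q) (B k) + of_nat (card {..<k}) * ennreal \<delta>"
    proof (rule emeasure_PiM_le[OF \<nu>(1) Q(1) _ _ _ BQ])
      fix A assume "A \<in> sets Q"
      then have "measure \<nu> A \<le> measure Q A + \<delta>" using tv[of A] Q(2) by auto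
      then show "emeasure \<nu> A \<le> emeasure Q A + ennreal \<delta>"
        using \<delta> by (simp add: \<nu>.emeasure_eq_measure Q.emeasure_eq_measure ennreal_plus[symmetric] del: ennreal_plus)
    qed (use \<nu>(2) Q(2) in auto)
    then have "ennreal (measure (\<Pi>\<^sub>M j\<in>{..<k}. \<nu>) (B k)) \<le> ennreal (b k + real k * \<delta>)"
      using \<delta> by (simp add: P\<nu>.emeasure_eq_measure PQ.emeasure_eq_measure b_def ennreal_of_nat_eq_real_of_nat
          ennreal_mult)
    then show ?thesis using \<delta> by (subst (asm) ennreal_le_iff) (auto simp: b_def)
  qed
  \<comment> \<open>Small samples carry no information about B, so the trivial bound 1 is used below
    m.\<close>
  have b1: "b k \<le> e + (if k < m then 1 else 0)" for k
  proof (cases "k < m")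
    case True
    interpret PQ: prob_space "\<Pi>\<^sub>M j\<in>{..<k}. Q" by (intro prob_space_PiM Q)
    show ?thesis using True e(1) by (auto simp: b_def intro: order_trans[OF PQ.prob_le_1])
  qed (use e in \<open>auto simp: b_def\<close>)
  have DX: "prob (D K) \<le> prob (X K) * (e + (if card K < m then 1 else 0) + real (card K) * \<delta>)" if K: "K \<subseteq> J" for K
  proof -
    have "prob (D K) = prob (X K) * measure (\<Pi>\<^sub>M j\<in>{..<card K}. \<nu>) (B (card K))"
      unfolding D_def X_def I_def
      by (rule exceedance_law[OF ind J E \<phi> \<nu> _ K bij[OF K] B]) (use p cond in auto)
    also have "\<dots> \<le> prob (X K) * (e + (if card K < m then 1 else 0) + real (card K) * \<delta>)"
      using \<nu>b[of "card K"] b1[of "card K"] by (intro mult_left_mono) auto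
    finally show ?thesis .
  qed
  have "prob Bad = (\<Sum>K\<in>Pow J. prob (D K))"
    unfolding Bad_eq using J D by (intro finite_measure_finite_Union) (auto simp: disjoint_family_on_def D_def)
  also have "\<dots> \<le> (\<Sum>K\<in>Pow J. prob (X K) * (e + (if card K < m then 1 else 0) + real (card K) * \<delta>))"
    by (intro sum_mono DX) auto
  also have "\<dots> = e * (\<Sum>K\<in>Pow J. prob (X K)) + (\<Sum>K\<in>Pow J. prob (X K) * (if card K < m then 1 else 0))
      + \<delta> * (\<Sum>K\<in>Pow J. prob (X K) * real (card K))"
    by (simp add: distrib_left sum.distrib sum_distrib_left mult_ac)
  also have "(\<Sum>K\<in>Pow J. prob (X K)) = 1"
  proof -
    have "(\<Sum>K\<in>Pow J. prob (X K)) = (\<Sum>K\<in>Pow J. prob (X K \<inter> space M))"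
      using sets.sets_into_space[OF X] by (intro sum.cong refl) (simp add: Int_absorb2)
    also have "\<dots> = prob (space M)" by (rule sumX) auto
    finally show ?thesis by (simp only: prob_space)
  qed
  also have "(\<Sum>K\<in>Pow J. prob (X K) * (if card K < m then 1 else 0)) = 1 - \<P>(\<omega> in M. m \<le> card (I \<omega>))"
  proof -
    let ?W = "{\<omega>\<in>space M. m \<le> card (I \<omega>)}"
    have "?W = (\<Union>K\<in>{K\<in>Pow J. m \<le> card K}. X K)" using I_sub by (auto simp: X_def)
    also have "\<dots> \<in> sets M" using J X by (intro sets.finite_UN) auto
    finally have W: "?W \<in> sets M" .
    have "(\<Sum>K\<in>Pow J. prob (X K) * (if card K < m then 1 else 0)) = (\<Sum>K\<in>Pow J. prob (X K \<inter> (space M - ?W)))"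
    proof (intro sum.cong refl)
      fix K
      have "X K \<inter> (space M - ?W) = (if card K < m then X K else {})" by (auto simp: X_def)
      then show "prob (X K) * (if card K < m then 1 else 0) = prob (X K \<inter> (space M - ?W))" by simp
    qed
    also have "\<dots> = 1 - prob ?W" using W by (simp add: sumX prob_compl)
    finally show ?thesis .
  qed
  \<comment> \<open>The mean number of exceedances: \<open>card K\<close> is a sum of indicators
    over J, and the two sums are exchanged.\<close>
  also have "(\<Sum>K\<in>Pow J. prob (X K) * real (card K)) = real (card J) * p"
  proof -
    let ?W = "\<lambda>i. {\<omega>\<in>space M. Z i \<omega> \<in> E}"
    have "(\<Sum>K\<in>Pow J. prob (X K) * real (card K)) = (\<Sum>K\<in>Pow J. \<Sum>i\<in>J. prob (X K \<inter> ?W i))"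
    proof (intro sum.cong refl)
      fix K assume K: "K \<in> Pow J"
      have "(\<Sum>i\<in>J. prob (X K \<inter> ?W i)) = (\<Sum>i\<in>J. if i \<in> K then prob (X K) else 0)"
      proof (intro sum.cong refl)
        fix i assume "i \<in> J"
        then have "X K \<inter> ?W i = (if i \<in> K then X K else {})" by (auto simp: X_def I_def)
        then show "prob (X K \<inter> ?W i) = (if i \<in> K then prob (X K) else 0)" by simp
      qed
      also have "\<dots> = (\<Sum>i\<in>J \<inter> K. prob (X K))" by (rule sum.inter_restrict[OF J(1), symmetric])
      also have "\<dots> = prob (X K) * real (card K)" using K by (simp add: Int_absorb1)
      finally show "prob (X K) * real (card K) = (\<Sum>i\<in>J. prob (X K \<inter> ?W i))" by simp
    qed
    also have "\<dots> = (\<Sum>i\<in>J. \<Sum>K\<in>Pow J. prob (X K \<inter> ?W i))" by (rule sum.swap)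
    also have "\<dots> = (\<Sum>i\<in>J. p)"
    proof (intro sum.cong refl)
      fix i assume i: "i \<in> J"
      have "?W i \<in> sets M" using Z[OF i] by measurable
      then show "(\<Sum>K\<in>Pow J. prob (X K \<inter> ?W i)) = p" by (simp add: sumX p[OF i])
    qed
    finally show ?thesis by simp
  qed
  finally show "prob Bad \<le> e + (1 - \<P>(\<omega> in M. m \<le> card (I \<omega>))) + real (card J) * p * \<delta>"
    by (simp add: mult_ac)
qed

end


section \<open>Peaks-over-threshold predictors\<close>

text \<open>Measurable hulls of the same outer measure reduce the claim to subadditivity of the
  measure.\<close>

lemma outer_measure_of_Un:
  assumes "A \<subseteq> space M" "B \<subseteq> space M"
  shows "outer_measure_of M (A \<union> B) \<le> outer_measure_of M A + outer_measure_of M B"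
proof -
  obtain A' B' where *: "A' \<in> sets M" "A \<subseteq> A'" "outer_measure_of M A = emeasure M A'"
    "B' \<in> sets M" "B \<subseteq> B'" "outer_measure_of M B = emeasure M B'"
    using outer_measure_of_attain assms by meson
  have "outer_measure_of M (A \<union> B) \<le> outer_measure_of M (A' \<union> B')"
    using * by (intro outer_measure_of_mono) auto
  also have "\<dots> = emeasure M (A' \<union> B')" using * by simp
  also have "\<dots> \<le> emeasure M A' + emeasure M B'" using * by (intro emeasure_subadditive)
  finally show ?thesis using * by simp
qed

lemma tendsto_0_le_ennreal:
  fixes f :: "nat \<Rightarrow> ennreal"
  assumes "g \<longlonglongrightarrow> 0" "\<forall>\<^sub>F n in sequentially. f n \<le> g n"
  shows "f \<longlonglongrightarrow> 0"
  by (rule tendsto_sandwich[OF _ assms(2) tendsto_const assms(1)]) simp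

lemma ratio_predictor_alt:
  "ratio_predictor q x = l1norm x * (q (l1dir x) / (1 - q (l1dir x)))"
  by (simp add: ratio_predictor_def l1norm_def)

text \<open>The direction is not continuous at 0. There continuity comes from the bound K times the
  norm, with K a bound of q / (1 - q) on the compact sphere; elsewhere it comes from
  composition.\<close>

lemma cont_homogeneous_ratio_predictor:
  fixes q :: "real ^ 'd \<Rightarrow> real"
  assumes cont: "continuous_on l1sphere q" and range: "\<And>\<theta>. \<theta> \<in> l1sphere \<Longrightarrow> q \<theta> \<in> {0<..<1}"
  shows "cont_homogeneous (ratio_predictor q)"
proof -
  define r where "r \<theta> = q \<theta> / (1 - q \<theta>)" for \<theta>
  have g: "ratio_predictor q x = l1norm x * r (l1dir x)" for x by (simp add: ratio_predictor_alt r_def)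
  have r0: "0 \<le> r (l1dir x)" for x using range[OF l1dir_in_l1sphere[of x]] by (simp add: r_def)
  have rc: "continuous_on l1sphere r"
    unfolding r_def[abs_def] using range by (intro continuous_intros cont) force
  then have "bounded (r ` l1sphere)"
    by (intro compact_imp_bounded compact_continuous_image compact_l1sphere)
  then obtain K where K: "\<And>\<theta>. \<theta> \<in> l1sphere \<Longrightarrow> \<bar>r \<theta>\<bar> \<le> K" by (force simp: bounded_iff)
  have "isCont (ratio_predictor q) x" for x
  proof (cases "x = 0")
    case True
    have "continuous_on UNIV (\<lambda>x :: real ^ 'd. K * l1norm x)" by (intro continuous_intros)
    then have "((\<lambda>x. K * l1norm x) \<longlongrightarrow> K * l1norm (0 :: real ^ 'd)) (at (0 :: real ^ 'd))"
      unfolding continuous_on_eq_continuous_at[OF open_UNIV] isCont_def by (rule bspec[OF _ UNIV_I])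
    then have "((\<lambda>x. K * l1norm x) \<longlongrightarrow> 0) (at (0 :: real ^ 'd))" by (simp add: l1norm_def)
    then have "(ratio_predictor q \<longlongrightarrow> 0) (at 0)"
    proof (rule Lim_null_comparison[rotated])
      have "norm (ratio_predictor q x) \<le> K * l1norm x" for x
        using K[OF l1dir_in_l1sphere[of x]] l1norm_nonneg[of x]
        by (simp add: g abs_mult) (metis mult.commute mult_left_mono)
      then show "\<forall>\<^sub>F x in at 0. norm (ratio_predictor q x) \<le> K * l1norm x" by simp
    qed
    with True show ?thesis by (simp add: isCont_def ratio_predictor_def)
  next
    case False
    have "continuous_on (- {0}) (\<lambda>x. l1norm x * r (x /\<^sub>R l1norm x))"
    proof (intro continuous_intros continuous_on_compose2[OF rc])
      show "(\<lambda>x. x /\<^sub>R l1norm x) ` (- {0 :: real ^ 'd}) \<subseteq> l1sphere"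
        using l1dir_in_l1sphere by (force simp: l1dir_def split: if_splits)
    qed (auto simp: l1norm_eq_0_iff)
    then have "continuous_on (- {0}) (ratio_predictor q)"
      by (rule continuous_on_eq) (auto simp: g l1dir_def)
    moreover have "open (- {0 :: real ^ 'd})" by auto
    ultimately show ?thesis using False by (simp add: continuous_on_eq_continuous_at)
  qed
  moreover have "ratio_predictor q (s *\<^sub>R x) = s * ratio_predictor q x" if "0 < s" for s x
  proof (cases "x = 0")
    case False
    then have "l1dir (s *\<^sub>R x) = l1dir x" using that by (simp add: l1dir_def l1norm_scaleR)
    then show ?thesis using that by (simp add: g l1norm_scaleR)
  qed (simp add: ratio_predictor_def)
  moreover have "0 \<le> ratio_predictor q x" for x
    unfolding g by (intro mult_nonneg_nonneg l1norm_nonneg r0)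
  ultimately show ?thesis
    by (simp add: cont_homogeneous_def continuous_at_imp_continuous_on)
qed

text \<open>The difference is (x - y) / ((1 - x) (1 - y)). Here d is the distance of y from 1, and e
  \<le> d / 2 leaves x the distance d / 2, so the denominator is at least d^2 / 2.\<close>

lemma ratio_diff_le:
  fixes x y :: real
  assumes "\<bar>x - y\<bar> \<le> e" "y \<le> 1 - d" "0 < d" "e \<le> d / 2"
  shows "\<bar>x / (1 - x) - y / (1 - y)\<bar> \<le> 2 * e / d\<^sup>2"
proof -
  have *: "d / 2 \<le> 1 - x" "d \<le> 1 - y" using assms by linarith+
  then have nz: "0 < 1 - x" "0 < 1 - y" using assms by linarith+
  have "x / (1 - x) - y / (1 - y) = (x - y) / ((1 - x) * (1 - y))"
    using nz by (simp add: diff_frac_eq) (simp add: algebra_simps)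
  then have "\<bar>x / (1 - x) - y / (1 - y)\<bar> = \<bar>x - y\<bar> / ((1 - x) * (1 - y))"
    using nz by (simp add: abs_mult)
  also have "\<dots> \<le> e / ((d / 2) * d)"
    using assms * nz by (intro frac_le mult_mono mult_pos_pos) auto
  finally show ?thesis using assms by (simp add: power2_eq_square field_simps)
qed


locale pot_model = opt_model M "Y 0" "X 0" P f S a
  for M :: "'w measure" and Y :: "nat \<Rightarrow> 'w \<Rightarrow> real" and X :: "nat \<Rightarrow> 'w \<Rightarrow> real ^ 'd"
    and P :: "(real \<times> (real ^ 'd)) measure" and f :: "real \<Rightarrow> real ^ 'd \<Rightarrow> real"
    and S :: "(real ^ 'd) set" and a :: real +
  fixes qhat :: "nat \<Rightarrow> real \<Rightarrow> (nat \<Rightarrow> real \<times> (real ^ 'd)) \<Rightarrow> real ^ 'd \<Rightarrow> real"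
    and \<alpha> :: "nat \<Rightarrow> 'w \<Rightarrow> real" and t :: "nat \<Rightarrow> real"
  assumes indep: "indep_vars (\<lambda>_. borel) (\<lambda>i \<omega>. (Y i \<omega>, X i \<omega>)) UNIV"
    and ident: "distr M borel (\<lambda>\<omega>. (Y i \<omega>, X i \<omega>)) = distr M borel (\<lambda>\<omega>. (Y 0 \<omega>, X 0 \<omega>))"
    and nonneg: "\<omega> \<in> space M \<Longrightarrow> 0 \<le> Y i \<omega>"
    and q_cont: "continuous_on ({0<..<1} \<times> S) (\<lambda>(\<alpha>, \<theta>). q_opt f \<alpha> \<theta>)"
    and qhat_meas: "\<theta> \<in> l1sphere \<Longrightarrow>
        (\<lambda>(\<alpha>, z). qhat k \<alpha> z \<theta>) \<in> borel_measurable (restrict_space borel {0<..<1} \<Otimes>\<^sub>M sample_space k)"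
    and qhat_cont: "b \<in> {0<..<1} \<Longrightarrow> z \<in> space (sample_space k) \<Longrightarrow> continuous_on l1sphere (qhat k b z)"
    and qhat_range: "b \<in> {0<..<1} \<Longrightarrow> z \<in> space (sample_space k) \<Longrightarrow> \<theta> \<in> l1sphere \<Longrightarrow> qhat k b z \<theta> \<in> {0<..<1}"
    and qhat_conv: "0 < a\<^sub>0 \<Longrightarrow> a\<^sub>0 < a\<^sub>1 \<Longrightarrow> a\<^sub>1 < 1 \<Longrightarrow>
        tendsto_in_prob (\<lambda>k. \<Pi>\<^sub>M i\<in>{..<k}. P)
          (\<lambda>k z. SUP \<alpha>\<in>{a\<^sub>0..a\<^sub>1}. SUP \<theta>\<in>S. \<bar>qhat k \<alpha> z \<theta> - q_opt f \<alpha> \<theta>\<bar>) 0"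
    and \<alpha>_estimator: "\<exists>e \<in> borel_measurable (\<Pi>\<^sub>M i\<in>{1..n}. borel).
        \<forall>\<omega>\<in>space M. \<alpha> n \<omega> = e (\<lambda>i\<in>{1..n}. (Y i \<omega>, X i \<omega>))"
    and \<alpha>_range: "\<omega> \<in> space M \<Longrightarrow> \<alpha> n \<omega> \<in> {0<..<1}"
    and \<alpha>_conv: "tendsto_in_prob (\<lambda>_. M) \<alpha> a"
    and K_conv: "(\<lambda>n. \<P>(\<omega> in M. m \<le> card (exceedances (\<lambda>i. (Y i \<omega>, X i \<omega>)) (t n) n))) \<longlonglongrightarrow> 1"
    and bias: "(\<lambda>n. real n * \<P>(\<omega> in M. t n < tau (Y 0 \<omega>, X 0 \<omega>))
          * tv_norm_diff (cond_exceed M (\<lambda>\<omega>. (Y 0 \<omega>, X 0 \<omega>)) polar (t n)) P) \<longlonglongrightarrow> 0"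
begin

abbreviation "Z i \<omega> \<equiv> (Y i \<omega>, X i \<omega>)"
definition "I n \<omega> = exceedances (\<lambda>i. Z i \<omega>) (t n) n"
definition "sample n \<omega> = (\<lambda>j\<in>{..<card (I n \<omega>)}. polar (Z (sorted_list_of_set (I n \<omega>) ! j) \<omega>))"
definition "ghat n \<omega> = pot_predictor qhat (\<alpha> n \<omega>) (\<lambda>i. Z i \<omega>) (t n) n"

lemma Z_measurable [measurable]: "Z i \<in> M \<rightarrow>\<^sub>M borel"
  using indep by (auto simp: indep_vars_def)

lemma Z_law:
  assumes "W \<in> sets borel"
  shows "\<P>(\<omega> in M. Z i \<omega> \<in> W) = \<P>(\<omega> in M. Z 0 \<omega> \<in> W)"
proof -
  have "\<P>(\<omega> in M. Z i \<omega> \<in> W) = measure (distr M borel (Z i)) W" for i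
    using assms by (subst measure_distr) (auto simp: vimage_def Int_def conj_commute)
  then show ?thesis using ident[of i] by simp
qed

lemma ghat_eq: "ghat n \<omega> = ratio_predictor (qhat (card (I n \<omega>)) (\<alpha> n \<omega>) (sample n \<omega>))"
  by (simp add: ghat_def pot_predictor_def I_def sample_def Let_def)

lemma I_eq: "I n \<omega> = {i\<in>{1..n}. Z i \<omega> \<in> {z. t n < tau z}}"
  by (simp add: I_def exceedances_def)

lemma restrict_polar_mem:
  assumes "\<omega> \<in> space M"
  shows "(\<lambda>j\<in>{..<k}. polar (Z (s j) \<omega>)) \<in> space (sample_space k)"
  unfolding sample_space_def space_PiM space_restrict_space
  using polar_mem[of "Z i \<omega>" for i] nonneg[OF assms] by simp

lemma sample_mem: "\<omega> \<in> space M \<Longrightarrow> sample n \<omega> \<in> space (sample_space (card (I n \<omega>)))"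
  unfolding sample_def by (rule restrict_polar_mem)

lemma ghat_homogeneous: "\<omega> \<in> space M \<Longrightarrow> cont_homogeneous (ghat n \<omega>)"
  unfolding ghat_eq
  by (intro cont_homogeneous_ratio_predictor qhat_cont qhat_range \<alpha>_range sample_mem)

section \<open>Consistency of the predictors on exceedance samples\<close>

lemma S_ne: "S \<noteq> {}"
  using S_full by auto

lemma q_bounded:
  assumes "0 < a\<^sub>0" "a\<^sub>1 < 1"
  obtains C where "\<And>b \<theta>. b \<in> {a\<^sub>0..a\<^sub>1} \<Longrightarrow> \<theta> \<in> S \<Longrightarrow> \<bar>q_opt f b \<theta>\<bar> \<le> C"
proof -
  have "compact ((\<lambda>(\<alpha>, \<theta>). q_opt f \<alpha> \<theta>) ` ({a\<^sub>0..a\<^sub>1} \<times> S))"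
    using assms by (intro compact_continuous_image compact_Times S_compact continuous_on_subset[OF q_cont]) auto
  then have "bounded ((\<lambda>(\<alpha>, \<theta>). q_opt f \<alpha> \<theta>) ` ({a\<^sub>0..a\<^sub>1} \<times> S))" by (rule compact_imp_bounded)
  then show ?thesis using that by (force simp: bounded_iff)
qed

text \<open>Both real suprema need bounded families: the estimates lie in (0, 1), and the true
  quantiles are bounded by continuity on a compact set.\<close>

lemma sup_error_ge:
  assumes a01: "0 < a\<^sub>0" "a\<^sub>1 < 1" and z: "z \<in> space (sample_space k)"
    and b: "b \<in> {a\<^sub>0..a\<^sub>1}" and \<theta>: "\<theta> \<in> S"
  shows "\<bar>qhat k b z \<theta> - q_opt f b \<theta>\<bar>
    \<le> (SUP \<alpha>\<in>{a\<^sub>0..a\<^sub>1}. SUP \<theta>\<in>S. \<bar>qhat k \<alpha> z \<theta> - q_opt f \<alpha> \<theta>\<bar>)"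
proof -
  obtain C where C: "\<And>b \<theta>. b \<in> {a\<^sub>0..a\<^sub>1} \<Longrightarrow> \<theta> \<in> S \<Longrightarrow> \<bar>q_opt f b \<theta>\<bar> \<le> C"
    using q_bounded[OF a01] by blast
  have le: "\<bar>qhat k b z \<theta> - q_opt f b \<theta>\<bar> \<le> 1 + C" if "b \<in> {a\<^sub>0..a\<^sub>1}" "\<theta> \<in> S" for b \<theta>
    using C[OF that] qhat_range[of b z k \<theta>] that a01 z S_sub by (auto simp: abs_le_iff)
  have "\<bar>qhat k b z \<theta> - q_opt f b \<theta>\<bar> \<le> (SUP \<theta>\<in>S. \<bar>qhat k b z \<theta> - q_opt f b \<theta>\<bar>)"
    using le[OF b] by (intro cSUP_upper \<theta> bdd_aboveI2[where M="1 + C"])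
  also have "\<dots> \<le> (SUP \<alpha>\<in>{a\<^sub>0..a\<^sub>1}. SUP \<theta>\<in>S. \<bar>qhat k \<alpha> z \<theta> - q_opt f \<alpha> \<theta>\<bar>)"
    using le by (intro cSUP_upper b bdd_aboveI2[where M="1 + C"] cSUP_least S_ne)
  finally show ?thesis .
qed

text \<open>Transfers negligibility from iid samples of P to exceedance samples of random size. Of
  the three terms in \<open>exceedance_sample_bound\<close>, the first is small for a large fixed m,
  the second vanishes as the number of exceedances diverges, and the third is the bias.\<close>

lemma sample_negligible:
  assumes B: "\<And>k. B k \<in> sets (\<Pi>\<^sub>M j\<in>{..<k}. P)"
    and lim: "(\<lambda>k. measure (\<Pi>\<^sub>M j\<in>{..<k}. P) (B k)) \<longlonglongrightarrow> 0"
  defines "Bad \<equiv> \<lambda>n. {\<omega>\<in>space M. sample n \<omega> \<in> B (card (I n \<omega>))}"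
  shows "\<forall>\<^sub>F n in sequentially. Bad n \<in> sets M" "(\<lambda>n. prob (Bad n)) \<longlonglongrightarrow> 0"
proof -
  have B': "B k \<in> sets (\<Pi>\<^sub>M j\<in>{..<k}. borel)" for k
    using B[of k] sets_PiM_cong[OF refl P_sets, of "{..<k}"] by simp
  have key: "Bad n \<in> sets M \<and> prob (Bad n) \<le> e + (1 - \<P>(\<omega> in M. m \<le> card (I n \<omega>)))
        + real n * F (t n) * tv_norm_diff (P_exc (t n)) P"
    if n: "1 \<le> n" and e: "0 \<le> e" "\<And>k. m \<le> k \<Longrightarrow> measure (\<Pi>\<^sub>M j\<in>{..<k}. P) (B k) \<le> e" for n m e
  proof -
    let ?E = "{z. t n < tau z}"
    have E: "?E \<in> sets (borel :: (real \<times> (real ^ 'd)) measure)" by measurable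
    have p: "\<P>(\<omega> in M. Z i \<omega> \<in> ?E) = F (t n)" for i
      using Z_law[OF E, of i] by simp
    have cond: "\<P>(\<omega> in M. Z i \<omega> \<in> ?E \<and> polar (Z i \<omega>) \<in> A) = F (t n) * measure (P_exc (t n)) A"
      if A: "A \<in> sets borel" for i A
    proof -
      note [measurable] = A
      have W: "{z. z \<in> ?E \<and> polar z \<in> A} \<in> sets (borel :: (real \<times> (real ^ 'd)) measure)" by measurable
      show ?thesis using Z_law[OF W, of i] F.pos[of "t n"] by (simp add: P_exc_measure[OF A])
    qed
    have ind: "indep_vars (\<lambda>_. borel) Z {1..n}" by (rule indep_vars_subset[OF indep]) auto
    have ne: "{1..n} \<noteq> {}" using n by auto
    note * = exceedance_sample_bound[where N=borel and Z=Z and J="{1..n}" and E="?E" and \<phi>=polar and L=borel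
        and \<nu>="P_exc (t n)" and Q=P and p="F (t n)" and \<delta>="tv_norm_diff (P_exc (t n)) P"
        and B=B and e=e and m=m,
        OF ind finite_atLeastAtMost ne E borel_measurable_polar P_exc_prob P_exc_sets P_prob P_sets p cond tv_ge B' e]
    have "real (card {1..n}) = real n" by simp
    note ** = *(2)[unfolded this]
    show ?thesis unfolding Bad_def sample_def I_eq by (rule conjI[OF *(1) **])
  qed
  \<comment> \<open>For n = 0 the index set is empty, so the claim starts at n = 1. Measurability is
    read off from \<open>key\<close> with the trivial bound e = 1.\<close>
  show "\<forall>\<^sub>F n in sequentially. Bad n \<in> sets M"
  proof (rule eventually_sequentiallyI[of 1])
    fix n :: nat assume n: "1 \<le> n"
    have "measure (\<Pi>\<^sub>M j\<in>{..<k}. P) (B k) \<le> 1" for k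
    proof -
      interpret PP: prob_space "\<Pi>\<^sub>M j\<in>{..<k}. P" by (intro prob_space_PiM P_prob)
      show ?thesis by (rule PP.prob_le_1)
    qed
    then show "Bad n \<in> sets M" using key[OF n, of 1 0] by simp
  qed
  show "(\<lambda>n. prob (Bad n)) \<longlonglongrightarrow> 0"
  proof (rule order_tendstoI)
    fix e :: real assume e: "0 < e"
    obtain m where m: "\<And>k. m \<le> k \<Longrightarrow> measure (\<Pi>\<^sub>M j\<in>{..<k}. P) (B k) \<le> e / 2"
      using order_tendstoD(2)[OF lim, of "e / 2"] e by (auto simp: eventually_sequentially intro: less_imp_le)
    have "(\<lambda>n. e / 2 + (1 - \<P>(\<omega> in M. m \<le> card (I n \<omega>))) + real n * F (t n) * tv_norm_diff (P_exc (t n)) P)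
        \<longlonglongrightarrow> e / 2 + (1 - 1) + 0"
      unfolding I_def by (intro tendsto_intros K_conv bias)
    then have "\<forall>\<^sub>F n in sequentially. e / 2 + (1 - \<P>(\<omega> in M. m \<le> card (I n \<omega>)))
        + real n * F (t n) * tv_norm_diff (P_exc (t n)) P < e"
      by (rule order_tendstoD) (use e in simp)
    then show "\<forall>\<^sub>F n in sequentially. prob (Bad n) < e"
      using eventually_ge_at_top[of 1]
    proof eventually_elim
      case (elim n)
      then show ?case using key[OF elim(2) _ m] e by fastforce
    qed
  qed (auto intro!: always_eventually intro: less_le_trans)
qed

text \<open>Uniform continuity on a compact product. The interval ends at the midpoints of [0, a]
  and [a, 1], so it is a compact neighbourhood of a inside (0, 1).\<close>

lemma q_equicontinuous:
  assumes e: "0 < e"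
  obtains \<eta> where "0 < \<eta>" "\<And>b. \<bar>b - a\<bar> \<le> \<eta> \<Longrightarrow> b \<in> {a / 2..(1 + a) / 2}"
    "\<And>b \<theta>. \<bar>b - a\<bar> \<le> \<eta> \<Longrightarrow> \<theta> \<in> S \<Longrightarrow> \<bar>q_opt f b \<theta> - q_opt f a \<theta>\<bar> \<le> e"
proof -
  let ?C = "{a / 2..(1 + a) / 2} \<times> S"
  have "uniformly_continuous_on ?C (\<lambda>(\<alpha>, \<theta>). q_opt f \<alpha> \<theta>)"
    using a by (intro compact_uniformly_continuous continuous_on_subset[OF q_cont] compact_Times S_compact) auto
  then obtain d where d: "0 < d" "\<And>x x'. x \<in> ?C \<Longrightarrow> x' \<in> ?C \<Longrightarrow> dist x' x < d
      \<Longrightarrow> dist ((\<lambda>(\<alpha>, \<theta>). q_opt f \<alpha> \<theta>) x') ((\<lambda>(\<alpha>, \<theta>). q_opt f \<alpha> \<theta>) x) < e"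
    using e unfolding uniformly_continuous_on_def by metis
  \<comment> \<open>Half of d makes the uniform continuity estimate strict; the other two terms keep
    b in the compact interval.\<close>
  define \<eta> where "\<eta> = min (d / 2) (min (a / 2) ((1 - a) / 2))"
  have \<eta>: "0 < \<eta>" "\<eta> < d" using d a by (auto simp: \<eta>_def)
  have mem: "b \<in> {a / 2..(1 + a) / 2}" if "\<bar>b - a\<bar> \<le> \<eta>" for b
  proof -
    have *: "\<bar>b - a\<bar> \<le> a / 2" "\<bar>b - a\<bar> \<le> (1 - a) / 2" using that by (auto simp: \<eta>_def)
    have "a - b \<le> a / 2" "b - a \<le> (1 - a) / 2"
      using order_trans[OF abs_ge_self *(2)] order_trans[OF abs_ge_minus_self *(1)] by auto
    then show ?thesis by (simp add: field_simps)
  qed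
  show ?thesis
  proof (rule that[OF \<eta>(1) mem])
    fix b \<theta> assume b: "\<bar>b - a\<bar> \<le> \<eta>" and \<theta>: "\<theta> \<in> S"
    have "dist (b, \<theta>) (a, \<theta>) < d" using b \<eta> by (simp add: dist_Pair_Pair dist_real_def)
    moreover have "(b, \<theta>) \<in> ?C" "(a, \<theta>) \<in> ?C" using mem[OF b] mem[of a] \<eta> \<theta> by auto
    ultimately show "\<bar>q_opt f b \<theta> - q_opt f a \<theta>\<bar> \<le> e"
      using d(2)[of "(a, \<theta>)" "(b, \<theta>)"] by (simp add: dist_real_def)
  qed
qed

text \<open>The level \<open>\<alpha> n\<close> and the sample share their data, so the error at
  \<open>\<alpha> n\<close> is dominated by the supremum over levels, an event about the sample
  alone. Half of e pays for estimation at the level \<open>\<alpha> n\<close>, the other half for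
  moving that level to a.\<close>

lemma qhat_sample_conv:
  assumes e: "0 < e"
  shows "(\<lambda>n. outer_measure_of M {\<omega>\<in>space M. \<exists>\<theta>\<in>S.
      e < \<bar>qhat (card (I n \<omega>)) (\<alpha> n \<omega>) (sample n \<omega>) \<theta> - q_opt f a \<theta>\<bar>}) \<longlonglongrightarrow> 0"
proof -
  have e2: "0 < e / 2" using e by simp
  let ?a\<^sub>0 = "a / 2" and ?a\<^sub>1 = "(1 + a) / 2"
  have a01: "0 < ?a\<^sub>0" "?a\<^sub>0 < ?a\<^sub>1" "?a\<^sub>1 < 1" using a by auto
  obtain \<eta> where \<eta>: "0 < \<eta>" "\<And>b. \<bar>b - a\<bar> \<le> \<eta> \<Longrightarrow> b \<in> {?a\<^sub>0..?a\<^sub>1}"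
    "\<And>b \<theta>. \<bar>b - a\<bar> \<le> \<eta> \<Longrightarrow> \<theta> \<in> S \<Longrightarrow> \<bar>q_opt f b \<theta> - q_opt f a \<theta>\<bar> \<le> e / 2"
    using q_equicontinuous[OF e2] by blast
  define err where "err k z = (SUP \<alpha>\<in>{?a\<^sub>0..?a\<^sub>1}. SUP \<theta>\<in>S. \<bar>qhat k \<alpha> z \<theta> - q_opt f \<alpha> \<theta>\<bar>)" for k z
  let ?PP = "\<lambda>k. \<Pi>\<^sub>M i\<in>{..<k}. P"
  define D where "D k = {z\<in>space (?PP k). e / 2 < \<bar>err k z - 0\<bar>}" for k
  have D0: "(\<lambda>k. outer_measure_of (?PP k) (D k)) \<longlonglongrightarrow> 0"
    using qhat_conv[OF a01] e2 unfolding tendsto_in_prob_def D_def err_def by blast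
  \<comment> \<open>\<open>sample_negligible\<close> speaks of measurable sets, while
    \<open>D k\<close> is defined by an uncountable supremum; its measurable hull has the same outer
    measure.\<close>
  have "\<exists>B. B \<in> sets (?PP k) \<and> D k \<subseteq> B \<and> outer_measure_of (?PP k) (D k) = emeasure (?PP k) B" for k
    using outer_measure_of_attain[of "D k" "?PP k"] by (auto simp: D_def)
  then obtain B where B: "\<And>k. B k \<in> sets (?PP k)" "\<And>k. D k \<subseteq> B k"
    "\<And>k. outer_measure_of (?PP k) (D k) = emeasure (?PP k) (B k)" by metis
  have B0: "(\<lambda>k. measure (?PP k) (B k)) \<longlonglongrightarrow> 0"
  proof -
    have "emeasure (?PP k) (B k) = ennreal (measure (?PP k) (B k))" for k
    proof -
      interpret PP: prob_space "?PP k" by (intro prob_space_PiM P_prob)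
      show ?thesis by (rule PP.emeasure_eq_measure)
    qed
    then have "(\<lambda>k. ennreal (measure (?PP k) (B k))) \<longlonglongrightarrow> ennreal 0" using D0 B(3) by simp
    then show ?thesis by (subst (asm) tendsto_ennreal_iff) auto
  qed
  define Bad where "Bad n = {\<omega>\<in>space M. sample n \<omega> \<in> B (card (I n \<omega>))}" for n
  note Bad = sample_negligible[OF B(1) B0, folded Bad_def]
  define N where "N n = {\<omega>\<in>space M. \<eta> < \<bar>\<alpha> n \<omega> - a\<bar>}" for n
  have N0: "(\<lambda>n. outer_measure_of M (N n)) \<longlonglongrightarrow> 0"
    using \<alpha>_conv \<eta>(1) unfolding tendsto_in_prob_def N_def by blast
  have sub: "{\<omega>\<in>space M. \<exists>\<theta>\<in>S. e < \<bar>qhat (card (I n \<omega>)) (\<alpha> n \<omega>) (sample n \<omega>) \<theta> - q_opt f a \<theta>\<bar>}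
      \<subseteq> N n \<union> Bad n" for n
  proof
    fix \<omega> assume "\<omega> \<in> {\<omega>\<in>space M. \<exists>\<theta>\<in>S. e < \<bar>qhat (card (I n \<omega>)) (\<alpha> n \<omega>) (sample n \<omega>) \<theta> - q_opt f a \<theta>\<bar>}"
    then obtain \<theta> where \<omega>: "\<omega> \<in> space M" and \<theta>: "\<theta> \<in> S"
      and gt: "e < \<bar>qhat (card (I n \<omega>)) (\<alpha> n \<omega>) (sample n \<omega>) \<theta> - q_opt f a \<theta>\<bar>" by auto
    show "\<omega> \<in> N n \<union> Bad n"
    proof (rule ccontr)
      assume *: "\<omega> \<notin> N n \<union> Bad n"
      then have \<alpha>: "\<bar>\<alpha> n \<omega> - a\<bar> \<le> \<eta>" and nB: "sample n \<omega> \<notin> B (card (I n \<omega>))"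
        using \<omega> by (auto simp: N_def Bad_def not_less)
      have "sample n \<omega> \<in> space (?PP (card (I n \<omega>)))"
        by (simp add: space_PiM sample_def)
      then have "\<bar>err (card (I n \<omega>)) (sample n \<omega>)\<bar> \<le> e / 2"
        using nB B(2)[of "card (I n \<omega>)"] by (auto simp: D_def)
      with sup_error_ge[OF a01(1,3) sample_mem[OF \<omega>, of n] \<eta>(2)[OF \<alpha>] \<theta>]
      have "\<bar>qhat (card (I n \<omega>)) (\<alpha> n \<omega>) (sample n \<omega>) \<theta> - q_opt f (\<alpha> n \<omega>) \<theta>\<bar> \<le> e / 2"
        unfolding err_def[symmetric] by linarith
      with \<eta>(3)[OF \<alpha> \<theta>] gt show False by linarith
    qed
  qed
  show ?thesis
  proof (rule tendsto_0_le_ennreal)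
    have "(\<lambda>n. outer_measure_of M (N n) + ennreal (prob (Bad n))) \<longlonglongrightarrow> 0 + ennreal 0"
      by (intro tendsto_add N0 tendsto_ennrealI Bad)
    then show "(\<lambda>n. outer_measure_of M (N n) + ennreal (prob (Bad n))) \<longlonglongrightarrow> 0" by simp
    show "\<forall>\<^sub>F n in sequentially. outer_measure_of M {\<omega>\<in>space M. \<exists>\<theta>\<in>S.
        e < \<bar>qhat (card (I n \<omega>)) (\<alpha> n \<omega>) (sample n \<omega>) \<theta> - q_opt f a \<theta>\<bar>}
        \<le> outer_measure_of M (N n) + ennreal (prob (Bad n))"
      using Bad(1)
    proof eventually_elim
      case (elim n)
      have "outer_measure_of M (N n \<union> Bad n) \<le> outer_measure_of M (N n) + outer_measure_of M (Bad n)"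
        by (rule outer_measure_of_Un) (auto simp: N_def Bad_def)
      with outer_measure_of_mono[OF sub[of n], of M] elim show ?case
        by (simp add: emeasure_eq_measure)
    qed
  qed
qed

text \<open>The optimal quantile attains its maximum on the compact set \<open>S\<close>, and that
  maximum is below 1. The margin d makes q / (1 - q) Lipschitz near the optimal quantiles.\<close>

lemma ghat_conv:
  assumes e: "0 < e"
  shows "(\<lambda>n. outer_measure_of M {\<omega>\<in>space M. \<exists>\<theta>\<in>S. e < \<bar>ghat n \<omega> \<theta> - g \<theta>\<bar>}) \<longlonglongrightarrow> 0"
proof -
  have "continuous_on S (\<lambda>\<theta>. (\<lambda>(\<alpha>, \<theta>). q_opt f \<alpha> \<theta>) (a, \<theta>))"
    by (rule continuous_on_compose2[OF q_cont]) (use a in \<open>auto intro!: continuous_intros\<close>)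
  then have "continuous_on S (q_opt f a)" by simp
  then obtain \<theta>\<^sub>0 where \<theta>\<^sub>0: "\<theta>\<^sub>0 \<in> S" "\<And>\<theta>. \<theta> \<in> S \<Longrightarrow> q_opt f a \<theta> \<le> q_opt f a \<theta>\<^sub>0"
    using continuous_attains_sup[OF S_compact S_ne] by blast
  define d where "d = 1 - q_opt f a \<theta>\<^sub>0"
  have d: "0 < d" "\<And>\<theta>. \<theta> \<in> S \<Longrightarrow> q_opt f a \<theta> \<le> 1 - d"
    using q_opt_range[OF \<theta>\<^sub>0(1) a] \<theta>\<^sub>0(2) by (auto simp: d_def)
  \<comment> \<open>Both entries come from \<open>ratio_diff_le\<close>: the first keeps the
    estimate away from 1, the second makes 2 e' / d^2 at most e.\<close>
  define e' where "e' = min (d / 2) (e * d\<^sup>2 / 2)"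
  have e': "0 < e'" "e' \<le> d / 2" "2 * e' / d\<^sup>2 \<le> e" using e d by (auto simp: e'_def min_def field_simps)
  show ?thesis
  proof (rule tendsto_0_le_ennreal[OF qhat_sample_conv[OF e'(1)]], rule always_eventually, rule allI,
      rule outer_measure_of_mono, safe)
    fix n \<omega> \<theta> assume \<theta>: "\<theta> \<in> S" and gt: "e < \<bar>ghat n \<omega> \<theta> - g \<theta>\<bar>"
    let ?q = "qhat (card (I n \<omega>)) (\<alpha> n \<omega>) (sample n \<omega>) \<theta>"
    have "\<theta> \<in> l1sphere" using S_sub \<theta> by auto
    then have "ghat n \<omega> \<theta> = ?q / (1 - ?q)"
      using l1dir_l1sphere[of \<theta>] by (simp add: ghat_eq ratio_predictor_alt) (simp add: l1sphere_def)
    then have "\<not> \<bar>?q - q_opt f a \<theta>\<bar> \<le> e'"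
      using ratio_diff_le[of ?q "q_opt f a \<theta>" e' d] d(2)[OF \<theta>] d(1) e' gt g_opt_eq[OF \<theta>, of a] by auto
    then show "\<exists>\<theta>\<in>S. e' < \<bar>qhat (card (I n \<omega>)) (\<alpha> n \<omega>) (sample n \<omega>) \<theta> - q_opt f a \<theta>\<bar>"
      using \<theta> by (auto simp: not_le)
  qed
qed

text \<open>A continuous mapping principle: the modulus e' is the same for all n and \<omega>, so a
  large deviation of the functional forces a large uniform error of the predictor on
  \<open>S\<close>.\<close>

lemma tendsto_in_prob_ghatI:
  assumes "\<And>e. 0 < e \<Longrightarrow> \<exists>e'>0. \<forall>n. \<forall>\<omega>\<in>space M. (\<forall>\<theta>\<in>S. \<bar>ghat n \<omega> \<theta> - g \<theta>\<bar> \<le> e') \<longrightarrow> \<bar>\<xi> n \<omega> - x\<bar> \<le> e"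
  shows "tendsto_in_prob (\<lambda>_. M) \<xi> x"
  unfolding tendsto_in_prob_def
proof (intro allI impI)
  fix e :: real assume "0 < e"
  then obtain e' where e': "0 < e'"
    "\<And>n \<omega>. \<omega> \<in> space M \<Longrightarrow> (\<forall>\<theta>\<in>S. \<bar>ghat n \<omega> \<theta> - g \<theta>\<bar> \<le> e') \<Longrightarrow> \<bar>\<xi> n \<omega> - x\<bar> \<le> e"
    using assms[of e] by blast
  show "(\<lambda>n. outer_measure_of M {\<omega> \<in> space M. e < \<bar>\<xi> n \<omega> - x\<bar>}) \<longlonglongrightarrow> 0"
    by (rule tendsto_0_le_ennreal[OF ghat_conv[OF e'(1)]], rule always_eventually, rule allI,
        rule outer_measure_of_mono) (use e'(2) in \<open>force simp: not_le[symmetric]\<close>)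
qed

lemma tail_scale_conv: "tendsto_in_prob (\<lambda>_. M) (\<lambda>n \<omega>. tail_scale M (Y 0) (X 0) (ghat n \<omega>)) 1"
proof (rule tendsto_in_prob_ghatI)
  fix e :: real assume e: "0 < e"
  show "\<exists>e'>0. \<forall>n. \<forall>\<omega>\<in>space M. (\<forall>\<theta>\<in>S. \<bar>ghat n \<omega> \<theta> - g \<theta>\<bar> \<le> e')
      \<longrightarrow> \<bar>tail_scale M (Y 0) (X 0) (ghat n \<omega>) - 1\<bar> \<le> e"
    using functionals_close(1)[OF ghat_homogeneous, where e="e * EU"] EU_pos e
    by (intro exI[of _ "e * EU"]) (auto simp: tail_scale_eq[OF ghat_homogeneous])
qed

lemma Lambda_conv: "tendsto_in_prob (\<lambda>_. M) (\<lambda>n \<omega>. Lambda_fun P (ghat n \<omega>)) (Lambda_fun P g)"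
proof (rule tendsto_in_prob_ghatI)
  fix e :: real assume e: "0 < e"
  show "\<exists>e'>0. \<forall>n. \<forall>\<omega>\<in>space M. (\<forall>\<theta>\<in>S. \<bar>ghat n \<omega> \<theta> - g \<theta>\<bar> \<le> e')
      \<longrightarrow> \<bar>Lambda_fun P (ghat n \<omega>) - Lambda_fun P g\<bar> \<le> e"
    using functionals_close(2)[OF ghat_homogeneous, where e="e * EU"] EU_pos e
    by (intro exI[of _ "e * EU"]) auto
qed

lemma Lambda_rescaled_conv:
  "tendsto_in_prob (\<lambda>_. M)
    (\<lambda>n \<omega>. Lambda_fun P (\<lambda>x. ghat n \<omega> x / tail_scale M (Y 0) (X 0) (ghat n \<omega>))) (Lambda_fun P g)"
proof (rule tendsto_in_prob_ghatI)
  fix e :: real assume e: "0 < e"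
  \<comment> \<open>At most e / 2 for each of the two errors, rescaling and estimation; below 1 so
    that the scale, being within e' of 1, is positive.\<close>
  define e' where "e' = min 1 e / 2"
  have e': "0 < e'" "e' \<le> e / 2" "e' < 1" using e by (auto simp: e'_def)
  show "\<exists>e'>0. \<forall>n. \<forall>\<omega>\<in>space M. (\<forall>\<theta>\<in>S. \<bar>ghat n \<omega> \<theta> - g \<theta>\<bar> \<le> e')
      \<longrightarrow> \<bar>Lambda_fun P (\<lambda>x. ghat n \<omega> x / tail_scale M (Y 0) (X 0) (ghat n \<omega>)) - Lambda_fun P g\<bar> \<le> e"
  proof (intro exI[of _ "e' * EU"] conjI allI ballI impI)
    fix n \<omega> assume \<omega>: "\<omega> \<in> space M" and close: "\<forall>\<theta>\<in>S. \<bar>ghat n \<omega> \<theta> - g \<theta>\<bar> \<le> e' * EU"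
    note h = ghat_homogeneous[OF \<omega>, of n]
    let ?c = "tail_scale M (Y 0) (X 0) (ghat n \<omega>)"
    have 1: "\<bar>?c - 1\<bar> \<le> e'" "\<bar>Lambda_fun P (ghat n \<omega>) - Lambda_fun P g\<bar> \<le> e'"
      using functionals_close[OF h, of "e' * EU"] close EU_pos e' by (auto simp: tail_scale_eq[OF h])
    then have "0 < ?c" using e' by linarith
    then have "\<bar>Lambda_fun P (\<lambda>x. ghat n \<omega> x / ?c) - Lambda_fun P (ghat n \<omega>)\<bar> \<le> \<bar>?c - 1\<bar>"
      by (intro Lambda_rescaled[OF h]) (auto simp: tail_scale_eq[OF h])
    with 1 e' show "\<bar>Lambda_fun P (\<lambda>x. ghat n \<omega> x / ?c) - Lambda_fun P g\<bar> \<le> e" by linarith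
  qed (use e' EU_pos in simp)
qed

section \<open>Measurability in the training data and comparison with competitors\<close>

lemma \<alpha>_measurable: "\<alpha> n \<in> M \<rightarrow>\<^sub>M restrict_space borel {0<..<1}"
proof (rule measurable_restrict_space2)
  obtain e where e[measurable]: "e \<in> borel_measurable (\<Pi>\<^sub>M i\<in>{1..n}. borel)"
    and eq: "\<And>\<omega>. \<omega> \<in> space M \<Longrightarrow> \<alpha> n \<omega> = e (\<lambda>i\<in>{1..n}. Z i \<omega>)"
    using \<alpha>_estimator[of n] by auto
  have "(\<lambda>\<omega>. e (\<lambda>i\<in>{1..n}. Z i \<omega>)) \<in> borel_measurable M"
    by (rule measurable_compose[OF measurable_restrict e]) simp
  then show "\<alpha> n \<in> borel_measurable M"
    by (subst measurable_cong[OF eq])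
qed (use \<alpha>_range in auto)

text \<open>Sample size and selected indices are random, but constant on each of the finitely many
  events fixing the exceedance set; there the joint measurability of the estimator in level and
  sample applies.\<close>

lemma ghat_measurable: "(\<lambda>\<omega>. ghat n \<omega> x) \<in> borel_measurable M"
proof -
  define s where "s K j = sorted_list_of_set K ! j" for K :: "nat set" and j
  define q where "q K \<omega> = qhat (card K) (\<alpha> n \<omega>) (\<lambda>j\<in>{..<card K}. polar (Z (s K j) \<omega>)) (l1dir x)" for K \<omega>
  define r where "r K \<omega> = l1norm x * (q K \<omega> / (1 - q K \<omega>))" for K \<omega>
  have "(\<lambda>\<omega>. q K \<omega>) \<in> borel_measurable M" for K
  proof -
    have "(\<lambda>\<omega>. \<lambda>j\<in>{..<card K}. polar (Z (s K j) \<omega>)) \<in> M \<rightarrow>\<^sub>M sample_space (card K)"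
      unfolding sample_space_def
    proof (intro measurable_restrict measurable_restrict_space2)
      fix j show "(\<lambda>\<omega>. polar (Z (s K j) \<omega>)) \<in> space M \<rightarrow> {0..1} \<times> l1sphere"
        by (rule Pi_I, rule polar_mem) (simp add: nonneg)
      show "(\<lambda>\<omega>. polar (Z (s K j) \<omega>)) \<in> M \<rightarrow>\<^sub>M borel" by measurable
    qed
    then have "(\<lambda>\<omega>. (\<alpha> n \<omega>, \<lambda>j\<in>{..<card K}. polar (Z (s K j) \<omega>)))
        \<in> M \<rightarrow>\<^sub>M restrict_space borel {0<..<1} \<Otimes>\<^sub>M sample_space (card K)"
      by (intro measurable_Pair \<alpha>_measurable)
    from measurable_compose[OF this qhat_meas[OF l1dir_in_l1sphere[of x]]] show ?thesis
      by (simp add: q_def)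
  qed
  then have r[measurable]: "r K \<in> borel_measurable M" for K unfolding r_def[abs_def] by measurable
  have [measurable]: "{\<omega>\<in>space M. I n \<omega> = K} \<in> sets M" for K
  proof -
    have "{\<omega>\<in>space M. I n \<omega> = K} = {\<omega>\<in>space M. K \<subseteq> {1..n} \<and> (\<forall>i\<in>{1..n}. (t n < tau (Z i \<omega>)) = (i \<in> K))}"
      by (auto simp: I_eq)
    also have "\<dots> \<in> sets M" by measurable
    finally show ?thesis .
  qed
  have "ghat n \<omega> x = (\<Sum>K\<in>Pow {1..n}. indicator {\<omega>\<in>space M. I n \<omega> = K} \<omega> * r K \<omega>)" if \<omega>: "\<omega> \<in> space M" for \<omega>
  proof -
    have "ghat n \<omega> x = r (I n \<omega>) \<omega>"
      by (simp add: ghat_eq ratio_predictor_alt r_def q_def s_def sample_def)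
    also have "\<dots> = (\<Sum>K\<in>Pow {1..n}. if K = I n \<omega> then r K \<omega> else 0)"
      by (subst sum.delta) (auto simp: I_eq)
    also have "\<dots> = (\<Sum>K\<in>Pow {1..n}. indicator {\<omega>\<in>space M. I n \<omega> = K} \<omega> * r K \<omega>)"
      by (intro sum.cong refl) (auto simp: \<omega> indicator_def)
    finally show ?thesis .
  qed
  moreover have "(\<lambda>\<omega>. \<Sum>K\<in>Pow {1..n}. indicator {\<omega>\<in>space M. I n \<omega> = K} \<omega> * r K \<omega>) \<in> borel_measurable M"
    by measurable
  ultimately show ?thesis by (subst measurable_cong) auto
qed

text \<open>Continuity in x upgrades pointwise measurability to joint measurability, after which the
  integral over P is measurable in the parameter.\<close>

lemma Lambda_measurable:
  assumes meas: "\<And>x. (\<lambda>\<omega>. h \<omega> x) \<in> borel_measurable M"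
    and cont: "\<And>\<omega>. \<omega> \<in> space M \<Longrightarrow> continuous_on UNIV (h \<omega>)"
  shows "(\<lambda>\<omega>. Lambda_fun P (h \<omega>)) \<in> borel_measurable M"
proof -
  have hx: "(\<lambda>p. h (fst p) (snd p)) \<in> borel_measurable (M \<Otimes>\<^sub>M borel)"
    using borel_measurable_Caratheodory[OF meas cont] by (simp add: case_prod_beta')
  have "(\<lambda>p. (fst p, snd (snd p))) \<in> M \<Otimes>\<^sub>M (borel :: (real \<times> (real ^ 'd)) measure) \<rightarrow>\<^sub>M M \<Otimes>\<^sub>M borel"
    by measurable
  from measurable_compose[OF this hx]
  have [measurable]: "(\<lambda>p. h (fst p) (snd (snd p))) \<in> borel_measurable (M \<Otimes>\<^sub>M (borel :: (real \<times> (real ^ 'd)) measure))"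
    by simp
  have "(\<lambda>(\<omega>, z). min (fst z) ((1 - fst z) * h \<omega> (snd z))) \<in> borel_measurable (M \<Otimes>\<^sub>M P)"
    unfolding case_prod_beta'
    by (subst measurable_cong_sets[OF sets_pair_measure_cong[OF refl P_sets] refl]) measurable
  then have "(\<lambda>\<omega>. \<integral>z. min (fst z) ((1 - fst z) * h \<omega> (snd z)) \<partial>P) \<in> borel_measurable M"
    by (rule P.borel_measurable_lebesgue_integral)
  then show ?thesis unfolding Lambda_fun_def case_prod_beta' by measurable
qed

text \<open>In \<open>Lambda_le\<close> the ratio C(h) / E[U] is the tail scale of h. So h can beat
  the estimated predictor by more than e only if the scale of h is off by more than e / 2 or the
  precision of the predictor is off by more than e / 2.\<close>

lemma asymptotic_optimality:
  fixes h :: "nat \<Rightarrow> 'w \<Rightarrow> real ^ 'd \<Rightarrow> real"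
  assumes h: "\<And>n \<omega>. \<omega> \<in> space M \<Longrightarrow> cont_homogeneous (h n \<omega>)"
    and meas: "\<And>n x. (\<lambda>\<omega>. h n \<omega> x) \<in> borel_measurable M"
    and conv: "tendsto_in_prob (\<lambda>_. M) (\<lambda>n \<omega>. tail_scale M (Y 0) (X 0) (h n \<omega>)) 1"
    and e: "0 < e"
  shows "(\<lambda>n. \<P>(\<omega> in M. Lambda_fun P (h n \<omega>) \<le> Lambda_fun P (ghat n \<omega>) + e)) \<longlonglongrightarrow> 1"
proof -
  have [measurable]: "(\<lambda>\<omega>. Lambda_fun P (h n \<omega>)) \<in> borel_measurable M"
    "(\<lambda>\<omega>. Lambda_fun P (ghat n \<omega>)) \<in> borel_measurable M" for n
    using Lambda_measurable[OF meas] Lambda_measurable[OF ghat_measurable] h ghat_homogeneous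
    by (auto simp: cont_homogeneous_def)
  let ?Bad = "\<lambda>n. {\<omega>\<in>space M. Lambda_fun P (ghat n \<omega>) + e < Lambda_fun P (h n \<omega>)}"
  let ?N1 = "\<lambda>n. {\<omega>\<in>space M. e / 2 < \<bar>tail_scale M (Y 0) (X 0) (h n \<omega>) - 1\<bar>}"
  let ?N2 = "\<lambda>n. {\<omega>\<in>space M. e / 2 < \<bar>Lambda_fun P (ghat n \<omega>) - Lambda_fun P g\<bar>}"
  have "(\<lambda>n. outer_measure_of M (?N1 n) + outer_measure_of M (?N2 n)) \<longlonglongrightarrow> 0 + 0"
    using conv[unfolded tendsto_in_prob_def, rule_format, OF half_gt_zero[OF e]]
      Lambda_conv[unfolded tendsto_in_prob_def, rule_format, OF half_gt_zero[OF e]]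
    by (rule tendsto_add)
  then have lim: "(\<lambda>n. outer_measure_of M (?N1 n) + outer_measure_of M (?N2 n)) \<longlonglongrightarrow> 0" by simp
  have sub: "?Bad n \<subseteq> ?N1 n \<union> ?N2 n" for n
  proof
    fix \<omega> assume "\<omega> \<in> ?Bad n"
    then have \<omega>: "\<omega> \<in> space M" and gt: "Lambda_fun P (ghat n \<omega>) + e < Lambda_fun P (h n \<omega>)" by auto
    let ?d = "tail_scale M (Y 0) (X 0) (h n \<omega>)"
    have "Lambda_fun P (h n \<omega>) \<le> Lambda_fun P g + (1 - a) * (?d - 1)"
      using Lambda_le[OF h[OF \<omega>]] by (simp add: tail_scale_eq[OF h[OF \<omega>]])
    moreover have "(1 - a) * (?d - 1) \<le> 1 * \<bar>?d - 1\<bar>"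
      using a by (intro order_trans[OF mult_left_mono[OF abs_ge_self] mult_right_mono]) auto
    moreover have "Lambda_fun P g - Lambda_fun P (ghat n \<omega>) \<le> \<bar>Lambda_fun P (ghat n \<omega>) - Lambda_fun P g\<bar>"
      using abs_ge_minus_self[of "Lambda_fun P (ghat n \<omega>) - Lambda_fun P g"] by simp
    moreover have "e / 2 < x \<or> e / 2 < y" if "l \<le> l' + p" "p \<le> 1 * x" "l' - l'' \<le> y" "l'' + e < l" for l l' l'' p x y
      using that by (cases "e / 2 < x") auto
    ultimately have "e / 2 < \<bar>?d - 1\<bar> \<or> e / 2 < \<bar>Lambda_fun P (ghat n \<omega>) - Lambda_fun P g\<bar>"
      using gt by blast
    then show "\<omega> \<in> ?N1 n \<union> ?N2 n" using \<omega> by simp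
  qed
  have "(\<lambda>n. outer_measure_of M (?Bad n)) \<longlonglongrightarrow> 0"
  proof (rule tendsto_0_le_ennreal[OF lim], rule always_eventually, rule allI)
    fix n
    show "outer_measure_of M (?Bad n) \<le> outer_measure_of M (?N1 n) + outer_measure_of M (?N2 n)"
      by (rule order_trans[OF outer_measure_of_mono[OF sub] outer_measure_of_Un]) auto
  qed
  moreover have "outer_measure_of M (?Bad n) = ennreal (prob (?Bad n))" for n
    by (subst outer_measure_of_eq) (measurable, rule emeasure_eq_measure)
  ultimately have "(\<lambda>n. ennreal (prob (?Bad n))) \<longlonglongrightarrow> ennreal 0" by simp
  then have "(\<lambda>n. prob (?Bad n)) \<longlonglongrightarrow> 0" by (subst (asm) tendsto_ennreal_iff) auto
  then have "(\<lambda>n. 1 - prob (?Bad n)) \<longlonglongrightarrow> 1 - 0" by (intro tendsto_intros)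
  moreover have "1 - prob (?Bad n) = \<P>(\<omega> in M. Lambda_fun P (h n \<omega>) \<le> Lambda_fun P (ghat n \<omega>) + e)" for n
    using prob_neg[of "\<lambda>\<omega>. Lambda_fun P (ghat n \<omega>) + e < Lambda_fun P (h n \<omega>)"] by (simp add: not_less)
  ultimately show ?thesis by simp
qed

end


theorem theorem4p1:
  fixes M :: "'w measure"
    and Y :: "nat \<Rightarrow> 'w \<Rightarrow> real" and X :: "nat \<Rightarrow> 'w \<Rightarrow> real ^ 'd"
    and P :: "(real \<times> (real ^ 'd)) measure" and f :: "real \<Rightarrow> real ^ 'd \<Rightarrow> real"
    and qhat :: "nat \<Rightarrow> real \<Rightarrow> (nat \<Rightarrow> real \<times> (real ^ 'd)) \<Rightarrow> real ^ 'd \<Rightarrow> real"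
    and \<alpha> :: "nat \<Rightarrow> 'w \<Rightarrow> real" and \<alpha>_star :: real and t :: "nat \<Rightarrow> real"
    and ghat :: "nat \<Rightarrow> 'w \<Rightarrow> real ^ 'd \<Rightarrow> real" and c :: "nat \<Rightarrow> 'w \<Rightarrow> real"
  assumes "prob_space M"
    \<comment> \<open>index \<open>0\<close> is the new observation \<open>(Y, X)\<close>, indices \<open>1, 2, \<dots>\<close> are the training data\<close>
    and indep: "prob_space.indep_vars M (\<lambda>_. borel) (\<lambda>i \<omega>. (Y i \<omega>, X i \<omega>)) UNIV"
    and ident: "\<And>i. distr M borel (\<lambda>\<omega>. (Y i \<omega>, X i \<omega>)) = distr M borel (\<lambda>\<omega>. (Y 0 \<omega>, X 0 \<omega>))"
    and nonneg: "\<And>i \<omega>. \<omega> \<in> space M \<Longrightarrow> 0 \<le> Y i \<omega>"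
    and rv: "jointly_regularly_varying M (\<lambda>\<omega>. (Y 0 \<omega>, X 0 \<omega>)) P"
    and A: "assumption_A M (\<lambda>\<omega>. (Y 0 \<omega>, X 0 \<omega>)) P f"
    and B: "assumption_B P f qhat"
    and \<alpha>_estimator: "\<And>n. \<exists>e \<in> borel_measurable (\<Pi>\<^sub>M i\<in>{1..n}. borel).
          \<forall>\<omega>\<in>space M. \<alpha> n \<omega> = e (\<lambda>i\<in>{1..n}. (Y i \<omega>, X i \<omega>))"
    and \<alpha>_range: "\<And>n \<omega>. \<omega> \<in> space M \<Longrightarrow> \<alpha> n \<omega> \<in> {0<..<1}"
    and \<alpha>_star: "0 < \<alpha>_star" "\<alpha>_star < 1" "C_fun P (g_opt f \<alpha>_star) = (\<integral>(u, \<theta>). u \<partial>P)"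
    and \<alpha>_conv: "tendsto_in_prob (\<lambda>_. M) \<alpha> \<alpha>_star"
    and t: "filterlim t at_top sequentially"
    and K_conv: "\<And>m :: nat.
          (\<lambda>n. \<P>(\<omega> in M. m \<le> card (exceedances (\<lambda>i. (Y i \<omega>, X i \<omega>)) (t n) n))) \<longlonglongrightarrow> 1"
    and bias: "(\<lambda>n. real n * \<P>(\<omega> in M. t n < tau (Y 0 \<omega>, X 0 \<omega>))
          * tv_norm_diff (cond_exceed M (\<lambda>\<omega>. (Y 0 \<omega>, X 0 \<omega>)) polar (t n)) P) \<longlonglongrightarrow> 0"
    and ghat: "\<And>n \<omega>. ghat n \<omega> = pot_predictor qhat (\<alpha> n \<omega>) (\<lambda>i. (Y i \<omega>, X i \<omega>)) (t n) n"
    and c: "\<And>n \<omega>. c n \<omega> = tail_scale M (Y 0) (X 0) (ghat n \<omega>)"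
  shows
    \<comment> \<open>the three outer conjuncts are (i), (ii), (iii)\<close>
    "((\<forall>n. \<forall>\<omega>\<in>space M. (tail_ratio M (Y 0) (X 0) (ghat n \<omega>) \<longlongrightarrow> c n \<omega>) at_top)
      \<and> tendsto_in_prob (\<lambda>_. M) c 1
      \<and> (\<forall>n. \<forall>\<omega>\<in>space M. 0 < c n \<omega> \<longrightarrow>
           has_tail_dependence M (Y 0) (\<lambda>v. ghat n \<omega> (X 0 v)) (Lambda_fun P (\<lambda>x. ghat n \<omega> x / c n \<omega>))
         \<and> ((\<lambda>s. \<P>(v in M. c n \<omega> * s < ghat n \<omega> (X 0 v) \<bar> s < Y 0 v))
               \<longlongrightarrow> Lambda_fun P (\<lambda>x. ghat n \<omega> x / c n \<omega>)) at_top))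
     \<and> (tendsto_in_prob (\<lambda>_. M) (\<lambda>n \<omega>. Lambda_fun P (\<lambda>x. ghat n \<omega> x / c n \<omega>))
          (Lambda_fun P (g_opt f \<alpha>_star))
      \<and> tendsto_in_prob (\<lambda>_. M) (\<lambda>n \<omega>. Lambda_fun P (ghat n \<omega>)) (Lambda_fun P (g_opt f \<alpha>_star)))
     \<and> (\<forall>h :: nat \<Rightarrow> 'w \<Rightarrow> real ^ 'd \<Rightarrow> real.
          (\<forall>n. \<forall>\<omega>\<in>space M. continuous_on UNIV (h n \<omega>) \<and> (\<forall>x. 0 \<le> h n \<omega> x)
                \<and> (\<forall>r>0. \<forall>x. h n \<omega> (r *\<^sub>R x) = r * h n \<omega> x))
          \<and> (\<forall>n. independent_rvs M borel (\<lambda>\<omega>. (Y 0 \<omega>, X 0 \<omega>)) (\<Pi>\<^sub>M x\<in>UNIV. borel) (h n))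
          \<and> tendsto_in_prob (\<lambda>_. M) (\<lambda>n \<omega>. tail_scale M (Y 0) (X 0) (h n \<omega>)) 1
          \<longrightarrow> (\<forall>\<epsilon>>0. (\<lambda>n. \<P>(\<omega> in M. Lambda_fun P (h n \<omega>) \<le> Lambda_fun P (ghat n \<omega>) + \<epsilon>))
                 \<longlonglongrightarrow> 1))"
proof -
  interpret prob_space M by fact
  obtain S where S: "compact S" "S \<subseteq> l1sphere" "measure (distr P borel snd) S = 1"
    and S_int_pos: "\<forall>\<theta>\<in>S. set_integrable lborel {0..1} (\<lambda>u. (1 - u) * f u \<theta>) \<and>
                 0 < (LBINT u:{0..1}. (1 - u) * f u \<theta>)"
    and q_cont: "continuous_on ({0<..<1} \<times> S) (\<lambda>(\<alpha>, \<theta>). q_opt f \<alpha> \<theta>)"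
    and qhat_meas: "\<forall>k. \<forall>\<theta>\<in>l1sphere. (\<lambda>(\<alpha>, z). qhat k \<alpha> z \<theta>)
            \<in> borel_measurable (restrict_space borel {0<..<1} \<Otimes>\<^sub>M sample_space k)"
    and qhat_range: "\<forall>k. \<forall>\<alpha>\<in>{0<..<1}. \<forall>z\<in>space (sample_space k).
            continuous_on l1sphere (qhat k \<alpha> z) \<and> (\<forall>\<theta>\<in>l1sphere. qhat k \<alpha> z \<theta> \<in> {0<..<1})"
    and qhat_conv: "\<forall>\<alpha>\<^sub>0 \<alpha>\<^sub>1. 0 < \<alpha>\<^sub>0 \<and> \<alpha>\<^sub>0 < \<alpha>\<^sub>1 \<and> \<alpha>\<^sub>1 < 1 \<longrightarrow>
            tendsto_in_prob (\<lambda>k. \<Pi>\<^sub>M i\<in>{..<k}. P)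
              (\<lambda>k z. SUP \<alpha>\<in>{\<alpha>\<^sub>0..\<alpha>\<^sub>1}. SUP \<theta>\<in>S. \<bar>qhat k \<alpha> z \<theta> - q_opt f \<alpha> \<theta>\<bar>) 0"
    using B unfolding assumption_B_def by (elim exE conjE) (rule that)
  have Z0: "(\<lambda>\<omega>. (Y 0 \<omega>, X 0 \<omega>)) \<in> M \<rightarrow>\<^sub>M borel" using indep by (auto simp: indep_vars_def)
  have YX: "Y 0 \<in> borel_measurable M" "X 0 \<in> borel_measurable M"
    using measurable_compose[OF Z0 borel_measurable_fst_snd(1)] measurable_compose[OF Z0 borel_measurable_fst_snd(2)]
    by simp_all
  interpret pot: rv_model M "Y 0" "X 0" P f
    by unfold_locales (rule YX nonneg rv A; assumption?)+
  interpret pot: opt_model M "Y 0" "X 0" P f S \<alpha>_star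
    by unfold_locales (use S S_int_pos \<alpha>_star in simp_all)
  interpret pot: pot_model M Y X P f S \<alpha>_star qhat \<alpha> t
  proof
    show "indep_vars (\<lambda>_. borel) (\<lambda>i \<omega>. (Y i \<omega>, X i \<omega>)) UNIV" by (rule indep)
    show "distr M borel (\<lambda>\<omega>. (Y i \<omega>, X i \<omega>)) = distr M borel (\<lambda>\<omega>. (Y 0 \<omega>, X 0 \<omega>))" for i by (rule ident)
    show "0 \<le> Y i \<omega>" if "\<omega> \<in> space M" for i \<omega> using that by (rule nonneg)
    show "continuous_on ({0<..<1} \<times> S) (\<lambda>(\<alpha>, \<theta>). q_opt f \<alpha> \<theta>)" by (rule q_cont)
    show "(\<lambda>(\<alpha>, z). qhat k \<alpha> z \<theta>) \<in> borel_measurable (restrict_space borel {0<..<1} \<Otimes>\<^sub>M sample_space k)"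
      if "\<theta> \<in> l1sphere" for k \<theta> by (rule qhat_meas[rule_format, OF that])
    show "continuous_on l1sphere (qhat k b z)" if "b \<in> {0<..<1}" "z \<in> space (sample_space k)" for k b z
      using qhat_range[rule_format, OF that] by (rule conjunct1)
    show "qhat k b z \<theta> \<in> {0<..<1}"
      if "b \<in> {0<..<1}" "z \<in> space (sample_space k)" "\<theta> \<in> l1sphere" for k b z \<theta>
      using qhat_range[rule_format, OF that(1,2), THEN conjunct2] that(3) by (rule bspec)
    show "tendsto_in_prob (\<lambda>k. \<Pi>\<^sub>M i\<in>{..<k}. P)
        (\<lambda>k z. SUP \<alpha>\<in>{a\<^sub>0..a\<^sub>1}. SUP \<theta>\<in>S. \<bar>qhat k \<alpha> z \<theta> - q_opt f \<alpha> \<theta>\<bar>) 0"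
      if "0 < a\<^sub>0" "a\<^sub>0 < a\<^sub>1" "a\<^sub>1 < 1" for a\<^sub>0 a\<^sub>1
      by (rule qhat_conv[rule_format]) (intro conjI that)
  qed (rule \<alpha>_estimator \<alpha>_range \<alpha>_conv K_conv bias; assumption?)+
  have ghat_eq: "ghat n \<omega> = pot.ghat n \<omega>" for n \<omega> by (simp add: ghat pot.ghat_def)
  have hom: "cont_homogeneous (ghat n \<omega>)" if "\<omega> \<in> space M" for n \<omega>
    using pot.ghat_homogeneous[OF that] by (simp add: ghat_eq)
  have c_lim: "(tail_ratio M (Y 0) (X 0) (ghat n \<omega>) \<longlongrightarrow> c n \<omega>) at_top" if "\<omega> \<in> space M" for n \<omega>
    using pot.tail_ratio_lim[OF hom[OF that]] by (simp add: c pot.tail_scale_eq[OF hom[OF that]])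
  have c_conv: "tendsto_in_prob (\<lambda>_. M) c 1"
    using pot.tail_scale_conv by (simp add: c[abs_def] ghat_eq[abs_def])
  show ?thesis
  proof (intro conjI allI ballI impI)
    show "(tail_ratio M (Y 0) (X 0) (ghat n \<omega>) \<longlongrightarrow> c n \<omega>) at_top" if "\<omega> \<in> space M" for n \<omega>
      by (rule c_lim[OF that])
    show "tendsto_in_prob (\<lambda>_. M) c 1" by (rule c_conv)
    show "has_tail_dependence M (Y 0) (\<lambda>v. ghat n \<omega> (X 0 v)) (Lambda_fun P (\<lambda>x. ghat n \<omega> x / c n \<omega>))"
      if "\<omega> \<in> space M" "0 < c n \<omega>" for n \<omega>
      by (rule pot.tail_dependence(1)[OF hom c]) (use that in auto)
    show "((\<lambda>s. \<P>(v in M. c n \<omega> * s < ghat n \<omega> (X 0 v) \<bar> s < Y 0 v))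
        \<longlongrightarrow> Lambda_fun P (\<lambda>x. ghat n \<omega> x / c n \<omega>)) at_top"
      if "\<omega> \<in> space M" "0 < c n \<omega>" for n \<omega>
      by (rule pot.tail_dependence(2)[OF hom c]) (use that in auto)
    show "tendsto_in_prob (\<lambda>_. M) (\<lambda>n \<omega>. Lambda_fun P (\<lambda>x. ghat n \<omega> x / c n \<omega>)) (Lambda_fun P (g_opt f \<alpha>_star))"
      using pot.Lambda_rescaled_conv by (simp add: c ghat_eq)
    show "tendsto_in_prob (\<lambda>_. M) (\<lambda>n \<omega>. Lambda_fun P (ghat n \<omega>)) (Lambda_fun P (g_opt f \<alpha>_star))"
      using pot.Lambda_conv by (simp add: ghat_eq)
  next
    fix h :: "nat \<Rightarrow> 'w \<Rightarrow> real ^ 'd \<Rightarrow> real" and \<epsilon> :: real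
    assume h: "(\<forall>n. \<forall>\<omega>\<in>space M. continuous_on UNIV (h n \<omega>) \<and> (\<forall>x. 0 \<le> h n \<omega> x)
                \<and> (\<forall>r>0. \<forall>x. h n \<omega> (r *\<^sub>R x) = r * h n \<omega> x))
          \<and> (\<forall>n. independent_rvs M borel (\<lambda>\<omega>. (Y 0 \<omega>, X 0 \<omega>)) (\<Pi>\<^sub>M x\<in>UNIV. borel) (h n))
          \<and> tendsto_in_prob (\<lambda>_. M) (\<lambda>n \<omega>. tail_scale M (Y 0) (X 0) (h n \<omega>)) 1"
      and \<epsilon>: "0 < \<epsilon>"
    \<comment> \<open>Measurability into the product sigma-algebra yields measurability of each
      evaluation, the form used by \<open>asymptotic_optimality\<close>.\<close>
    have "h n \<in> M \<rightarrow>\<^sub>M (\<Pi>\<^sub>M x\<in>UNIV. borel)" for n using h by (simp add: independent_rvs_def)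
    then have "(\<lambda>\<omega>. h n \<omega> x) \<in> borel_measurable M" for n x
      by (rule measurable_compose[OF _ measurable_component_singleton]) simp
    moreover have "cont_homogeneous (h n \<omega>)" if "\<omega> \<in> space M" for n \<omega>
      using h that by (auto simp: cont_homogeneous_def)
    ultimately show "(\<lambda>n. \<P>(\<omega> in M. Lambda_fun P (h n \<omega>) \<le> Lambda_fun P (ghat n \<omega>) + \<epsilon>)) \<longlonglongrightarrow> 1"
      unfolding ghat_eq using h \<epsilon> by (intro pot.asymptotic_optimality) auto
  qed
qed

end
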